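(* Let $(\Omega,T)$ be the symbolic model of a reasonable rank-one construction, and $\mu$ its unique non-atomic $T$-invariant probability measure. Assume $(\Omega,T,\mu)$ is weakly mixing and that for all distinct primes $p,q$ the systems $(\Omega,T^p,\mu)$ and $(\Omega,T^q,\mu)$ are disjoint in the sense of Furstenberg. Then for every continuous $f:\Omega\to\mathbb C$ and every $\omega\in\Omega$, $\frac1N\sum_{n=1}^Nf(T^n\omega)\boldsymbol\mu(n)\to0$, where $\boldsymbol\mu$ is the Möbius function.
   Context: Rank-one parameters: integers $p_n\ge2$, integers $s_{n,i}\ge0$ ($0\le i\le p_n-1$), $h_1=1$, $h_{n+1}=p_nh_n+\sum_is_{n,i}$, $\sum_n\frac1{h_{n+1}}\sum_is_{n,i}<\infty$. The construction is reasonable if $t_n:=\max_{0\le i\le p_n-1}s_{n,i}=o(h_n)$. Symbolic model: $B_1=0$, $B_{n+1}=B_n1^{s_{n,0}}B_n1^{s_{n,1}}\cdots B_n1^{s_{n,p_n-1}}$; $\Omega\subset\{0,1\}^{\mathbb Z}$ is the set of sequences all of whose finite subwords are subwords of some $B_m$; $T$ is the left shift on $\Omega$ (product topology). For each finite word $W$ the frequency of $W$ in $B_n$ converges to a limit $\mu([W])$, defining a shift-invariant probability $\mu$; it is the unique non-atomic invariant probability (the only other possible ergodic one is the Dirac mass at the all-ones sequence). Disjointness: the only joining (invariant probability on the product with the given marginals) is the product measure. $\boldsymbol\mu$: Möbius function. *)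

theory Defs
  imports "HOL-Probability.Probability" "HOL-Computational_Algebra.Computational_Algebra"
begin

section \<open>Rank-one constructions (indices n start at 1, as in the paper)\<close>

text \<open>Heights: h_1 = 1, h_{n+1} = p_n h_n + sum_{i<p_n} s_{n,i}. The value at 0 is unused.\<close>
fun rk_h :: "(nat \<Rightarrow> nat) \<Rightarrow> (nat \<Rightarrow> nat \<Rightarrow> nat) \<Rightarrow> nat \<Rightarrow> nat" where
  "rk_h p s 0 = 0"
| "rk_h p s (Suc 0) = 1"
| "rk_h p s (Suc (Suc n)) =
     p (Suc n) * rk_h p s (Suc n) + (\<Sum>i<p (Suc n). s (Suc n) i)"

text \<open>Rank-one parameters: p_n >= 2 and the finite-measure summability condition.\<close>
definition rank_one_params :: "(nat \<Rightarrow> nat) \<Rightarrow> (nat \<Rightarrow> nat \<Rightarrow> nat) \<Rightarrow> bool" where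
  "rank_one_params p s \<longleftrightarrow>
     (\<forall>n\<ge>1. p n \<ge> 2) \<and>
     summable (\<lambda>n. real (\<Sum>i<p (Suc n). s (Suc n) i) / real (rk_h p s (Suc (Suc n))))"

definition reasonable :: "(nat \<Rightarrow> nat) \<Rightarrow> (nat \<Rightarrow> nat \<Rightarrow> nat) \<Rightarrow> bool" where
  "reasonable p s \<longleftrightarrow>
     (\<lambda>n. real (Max (s n ` {..<p n})) / real (rk_h p s n)) \<longlonglongrightarrow> 0"

text \<open>Blocks: B_1 = 0, B_{n+1} = B_n 1^{s_{n,0}} ... B_n 1^{s_{n,p_n-1}}. B 0 is unused.\<close>
fun rk_B :: "(nat \<Rightarrow> nat) \<Rightarrow> (nat \<Rightarrow> nat \<Rightarrow> nat) \<Rightarrow> nat \<Rightarrow> nat list" where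
  "rk_B p s 0 = []"
| "rk_B p s (Suc 0) = [0]"
| "rk_B p s (Suc (Suc n)) =
     concat (map (\<lambda>i. rk_B p s (Suc n) @ replicate (s (Suc n) i) 1) [0..<p (Suc n)])"

definition subword :: "'a list \<Rightarrow> 'a list \<Rightarrow> bool" where
  "subword W L \<longleftrightarrow> (\<exists>u v. L = u @ W @ v)"

text \<open>Symbolic model: bi-infinite 0-1 sequences all of whose finite subwords
  occur in some B_m. The ambient space int => nat carries the product topology
  (nat discrete), which induces the product topology of {0,1}^Z on this set.\<close>
definition rk_Omega :: "(nat \<Rightarrow> nat) \<Rightarrow> (nat \<Rightarrow> nat \<Rightarrow> nat) \<Rightarrow> (int \<Rightarrow> nat) set" where
  "rk_Omega p s = {x. (\<forall>k. x k \<in> {0, 1}) \<and>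
     (\<forall>a b. \<exists>m\<ge>1. subword (map x [a..b]) (rk_B p s m))}"

definition rk_shift :: "(int \<Rightarrow> nat) \<Rightarrow> (int \<Rightarrow> nat)" where
  "rk_shift x = (\<lambda>k. x (k + 1))"

definition invariant_measure :: "'a measure \<Rightarrow> ('a \<Rightarrow> 'a) \<Rightarrow> bool" where
  "invariant_measure M S \<longleftrightarrow> S \<in> M \<rightarrow>\<^sub>M M \<and> distr M M S = M"

definition weakly_mixing :: "'a measure \<Rightarrow> ('a \<Rightarrow> 'a) \<Rightarrow> bool" where
  "weakly_mixing M S \<longleftrightarrow>
     (\<forall>A\<in>sets M. \<forall>B\<in>sets M.
        (\<lambda>N. (\<Sum>n<N. \<bar>measure M (((S ^^ n) -` A \<inter> space M) \<inter> B)
                       - measure M A * measure M B\<bar>) / real N) \<longlonglongrightarrow> 0)"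

definition joining :: "'a measure \<Rightarrow> ('a \<Rightarrow> 'a) \<Rightarrow> 'b measure \<Rightarrow> ('b \<Rightarrow> 'b)
                        \<Rightarrow> ('a \<times> 'b) measure \<Rightarrow> bool" where
  "joining M S N R L \<longleftrightarrow>
     sets L = sets (M \<Otimes>\<^sub>M N) \<and> prob_space L \<and>
     invariant_measure L (\<lambda>(x, y). (S x, R y)) \<and>
     distr L M fst = M \<and> distr L N snd = N"

definition disjoint_systems :: "'a measure \<Rightarrow> ('a \<Rightarrow> 'a) \<Rightarrow> 'b measure \<Rightarrow> ('b \<Rightarrow> 'b) \<Rightarrow> bool" where
  "disjoint_systems M S N R \<longleftrightarrow> (\<forall>L. joining M S N R L \<longrightarrow> L = M \<Otimes>\<^sub>M N)"

definition moebius :: "nat \<Rightarrow> complex" where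
  "moebius n = (if n = 0 then 0
                else if squarefree n then (-1) ^ card (prime_factors n) else 0)"

end

theory Submission
  imports Defs "HOL-Complex_Analysis.Complex_Analysis"
begin

text \<open>
  By the Katai-Bourgain-Sarnak-Ziegler criterion, a bounded sequence \<open>a\<close> is orthogonal to the Moebius
  function as soon as the correlations of \<open>a (q m)\<close> and \<open>a (r m)\<close> vanish for distinct primes \<open>q\<close> and \<open>r\<close>.
  Cluster points of the empirical measures of \<open>(\<omega>, \<omega>)\<close> under \<open>T^q \<times> T^r\<close> are joinings, hence product
  measures by disjointness, provided that their marginals are the non-atomic measure \<open>M\<close>. Counting
  blocks shows that this can only fail because of long runs of ones. In a reasonable construction only
  one such run matters in the window \<open>[0, N]\<close>: a run between two blocks of level at most \<open>l\<close>, where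
  \<open>h l \<le> N < h (l + 1)\<close>, is short, and two longer runs would be separated by a block of length
  greater than \<open>N\<close>. The criterion is therefore applied to the sequence set to 0 on the
  exceptional run; on that run the orbit is essentially constant, and its contribution is negligible
  because the Moebius function has mean value 0. This fact also takes care of constant functions; it is
  obtained from Newman's contour argument for the reciprocal of the zeta function.
\<close>

section \<open>The zeta function to the left of the line Re s = 1\<close>

text \<open>The obstacle is that \<Omega> may carry a second invariant measure, the Dirac mass at
  the all-ones sequence. Counting copies of \<open>B n\<close> bounds from above, uniformly in the
  orbit, the frequency of every local set that misses the all-ones point; the matching lower bound
  comes from the complement inside \<open>nonones K\<close> and is lost only on long runs of ones.
  Below level \<open>l\<close> such runs are rare because the spacer proportions are summable. At
  level \<open>l\<close> the window is shorter than \<open>h (Suc l)\<close>, so summability says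
  nothing and \<open>reasonable\<close> takes over. These counts use all consecutive times, whereas
  a marginal along multiples of \<open>q\<close> sees one residue class. They identify only the
  average of its translates by T^i, i < q; weak mixing upgrades this to the marginal itself. Since
  the run moves with N, the criterion is stated for an array \<open>a N n\<close>, and the estimates
  are uniform over subintervals of the window. Cluster points are taken along filters, for all local
  sets at once, and compactness of \<Omega> turns the limiting finitely additive set functions into
  measures.\<close>

lemma norm_nat_powr: "n > 0 \<Longrightarrow> norm ((of_nat n :: complex) powr s) = real n powr Re s"
  by (subst norm_powr_real_powr) auto

text \<open>\<open>zetaH s = (s - 1) * zeta s\<close>, continued to \<open>Re s > 0\<close> by comparing each \<open>n powr (-s)\<close> with
  the integral of \<open>x powr (-s)\<close> over \<open>[n, n + 1]\<close>; the factor \<open>s - 1\<close> removes the pole.\<close>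
definition zeta_term :: "nat \<Rightarrow> complex \<Rightarrow> complex" where
  "zeta_term n s = (s - 1) * of_nat (Suc n) powr (-s) - of_nat (Suc n) powr (1 - s)
     + of_nat (Suc (Suc n)) powr (1 - s)"

definition zetaH :: "complex \<Rightarrow> complex" where
  "zetaH s = 1 + (\<Sum>n. zeta_term n s)"

text \<open>The term is \<phi>(a + 1) - \<phi>(a) for a function whose derivative (1 - s)(z powr -s
  - a powr -s) is itself small by the mean value inequality. This gains a factor 1/n over the terms
  of the series, which is what makes the sum converge for all Re s > 0.\<close>

lemma norm_zeta_term_le:
  assumes "Re s > 0"
  shows "norm (zeta_term n s) \<le> norm s * norm (s - 1) * real (Suc n) powr (- Re s - 1)"
proof -
  define a :: complex where "a = of_nat (Suc n)"
  define S where "S = closed_segment a (a + 1)"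
  have SE: "\<exists>x. z = of_real x \<and> real (Suc n) \<le> x \<and> x \<le> real (Suc n) + 1" if zS: "z \<in> S" for z
  proof -
    obtain u where u: "0 \<le> u" "u \<le> 1" "z = (1 - u) *\<^sub>R a + u *\<^sub>R (a + 1)"
      using zS unfolding S_def closed_segment_def by auto
    have "z = of_real (real (Suc n) + u)"
      unfolding u(3) a_def by (simp add: scaleR_conv_of_real algebra_simps)
    then show ?thesis using u by (intro exI[of _ "real (Suc n) + u"]) auto
  qed
  have nonpos: "z \<notin> \<real>\<^sub>\<le>\<^sub>0" "z \<noteq> 0" if "z \<in> S" for z
    using SE[OF that] by (auto simp: complex_nonpos_Reals_iff)
  have aS: "a \<in> S" "a + 1 \<in> S" by (auto simp: S_def)
  define B where "B = norm s * real (Suc n) powr (- Re s - 1)"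
  have dist_le: "norm (z - a) \<le> 1" if zS: "z \<in> S" for z
  proof -
    obtain x where x: "z = of_real x" "real (Suc n) \<le> x" "x \<le> real (Suc n) + 1" using SE[OF zS] by auto
    have "z - a = of_real (x - real (Suc n))" unfolding a_def x(1) by simp
    then show ?thesis using x by (simp add: norm_of_real del: of_real_diff)
  qed
  have 1: "norm (z powr (-s) - a powr (-s)) \<le> B" if "z \<in> S" for z
  proof -
    have "norm (z powr (-s) - a powr (-s)) \<le> B * norm (z - a)"
    proof (rule field_differentiable_bound[of S _ "\<lambda>z. (-s) * z powr (-s-1)"])
      show "convex S" by (simp add: S_def)
      show "((\<lambda>z. z powr - s) has_field_derivative - s * x powr (- s - 1)) (at x within S)" if "x \<in> S" for x
        using nonpos[OF that] by (auto intro!: derivative_eq_intros simp: powr_diff field_simps)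
      show "norm (- s * x powr (- s - 1)) \<le> B" if xS: "x \<in> S" for x
      proof -
        obtain y where y: "x = of_real y" "real (Suc n) \<le> y" using SE[OF xS] by auto
        have "norm (x powr (- s - 1)) = y powr (- Re s - 1)"
          using y by (subst norm_powr_real_powr) auto
        also have "\<dots> \<le> real (Suc n) powr (- Re s - 1)"
          using y assms by (intro powr_mono2') auto
        finally show ?thesis unfolding B_def norm_mult by (simp add: mult_left_mono)
      qed
    qed (use that aS in auto)
    also have "\<dots> \<le> B * 1" using dist_le[OF that] by (intro mult_left_mono) (auto simp: B_def)
    finally show ?thesis by simp
  qed
  define \<phi> where "\<phi> z = z powr (1 - s) - (1 - s) * a powr (-s) * z" for z
  have "norm (\<phi> (a + 1) - \<phi> a) \<le> (norm (1 - s) * B) * norm (a + 1 - a)"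
  proof (rule field_differentiable_bound[of S _ "\<lambda>z. (1 - s) * (z powr (-s) - a powr (-s))"])
    show "convex S" by (simp add: S_def)
    show "(\<phi> has_field_derivative (1 - s) * (x powr - s - a powr - s)) (at x within S)" if "x \<in> S" for x
    proof -
      have "((\<lambda>z. z powr (1 - s) - (1 - s) * a powr (-s) * z) has_field_derivative
          (1 - s) * x powr (1 - s - 1) - (1 - s) * a powr (-s) * 1) (at x)"
        using nonpos[OF that] by (intro DERIV_diff has_field_derivative_powr DERIV_cmult DERIV_ident)
      then show ?thesis unfolding \<phi>_def by (simp add: right_diff_distrib has_field_derivative_at_within)
    qed
    show "norm ((1 - s) * (x powr - s - a powr - s)) \<le> norm (1 - s) * B" if "x \<in> S" for x
      unfolding norm_mult using 1[OF that] by (intro mult_left_mono) auto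
  qed (use aS in auto)
  moreover have "\<phi> (a + 1) - \<phi> a = zeta_term n s"
    unfolding \<phi>_def zeta_term_def a_def by (simp add: algebra_simps)
  ultimately show ?thesis by (simp add: B_def norm_minus_commute mult_ac)
qed

lemma summable_Suc_powr: "x < -1 \<Longrightarrow> summable (\<lambda>n. real (Suc n) powr x)"
  by (subst summable_Suc_iff[of "\<lambda>n. real n powr x"]) (simp add: summable_real_powr_iff)

lemma zetaH_holomorphic: "zetaH holomorphic_on {s. Re s > 0}"
proof (rule holomorphic_uniform_sequence[where f = "\<lambda>N s. 1 + (\<Sum>n<N. zeta_term n s)"])
  show "open {s. Re s > 0}" by (rule open_halfspace_Re_gt)
  show "(\<lambda>s. 1 + (\<Sum>n<N. zeta_term n s)) holomorphic_on {s. 0 < Re s}" for N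
    unfolding zeta_term_def by (auto intro!: holomorphic_intros)
  fix x assume "x \<in> {s. 0 < Re s}"
  then have x: "Re x > 0" by simp
  define d where "d = Re x / 2"
  have d: "d > 0" using x by (simp add: d_def)
  have Re_ge: "Re s \<ge> d" if "s \<in> cball x d" for s
  proof -
    have "\<bar>Re (x - s)\<bar> \<le> d" using that abs_Re_le_cmod[of "x - s"] by (simp add: dist_norm)
    then show ?thesis unfolding d_def minus_complex.sel by linarith
  qed
  define B where "B = norm x + d + 1"
  have "uniform_limit (cball x d) (\<lambda>N s. \<Sum>n<N. zeta_term n s) (\<lambda>s. \<Sum>n. zeta_term n s) sequentially"
  proof (rule Weierstrass_m_test)
    fix n s assume s: "s \<in> cball x d"
    have "norm (s - x) \<le> d" using s by (simp add: dist_norm norm_minus_commute)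
    then have "norm s \<le> B" "norm (s - 1) \<le> B" "B \<ge> 0"
      using norm_triangle_ineq[of "s - x" x, simplified] norm_triangle_ineq[of "s - x" "x - 1", simplified]
        norm_triangle_ineq4[of x 1] norm_ge_zero[of x] d unfolding B_def norm_one
      by linarith+
    have "norm (zeta_term n s) \<le> norm s * norm (s - 1) * real (Suc n) powr (- Re s - 1)"
      using Re_ge[OF s] d by (intro norm_zeta_term_le) auto
    also have "\<dots> \<le> B * B * real (Suc n) powr (- d - 1)"
      using \<open>norm s \<le> B\<close> \<open>norm (s - 1) \<le> B\<close> Re_ge[OF s]
        \<open>B \<ge> 0\<close> by (intro mult_mono powr_mono) auto
    finally show "norm (zeta_term n s) \<le> B * B * real (Suc n) powr (- d - 1)" .
  next
    show "summable (\<lambda>n. B * B * real (Suc n) powr (- d - 1))"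
      using d by (intro summable_mult summable_Suc_powr) auto
  qed
  then have "uniform_limit (cball x d) (\<lambda>N s. 1 + (\<Sum>n<N. zeta_term n s)) zetaH sequentially"
    unfolding zetaH_def by (rule uniform_limit_add[OF uniform_limit_const])
  moreover have "cball x d \<subseteq> {s. 0 < Re s}"
  proof
    fix s assume "s \<in> cball x d"
    then show "s \<in> {s. 0 < Re s}" using Re_ge[of s] d by simp
  qed
  ultimately show "\<exists>d>0. cball x d \<subseteq> {s. 0 < Re s} \<and> uniform_limit (cball x d) (\<lambda>N s. 1 + (\<Sum>n<N. zeta_term n s)) zetaH sequentially"
    using d by blast
qed

lemma zetaH_1: "zetaH 1 = 1"
proof -
  have "zeta_term n 1 = 0" for n
    using of_nat_neq_0[of n, where 'a=complex] of_nat_neq_0[of "Suc n", where 'a=complex]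
    by (simp add: zeta_term_def del: of_nat_Suc)
  then show ?thesis by (simp add: zetaH_def)
qed

text \<open>An unordered sum, so that the sieve for the Euler product may split and reindex the set
  of integers freely. It is used for Re s > 1.\<close>

definition dzeta :: "complex \<Rightarrow> complex" where
  "dzeta s = infsum (\<lambda>n. of_nat n powr (-s)) {0<..}"

lemma abs_summable_nat_powr:
  assumes "Re s > 1"
  shows "(\<lambda>n. norm ((of_nat n :: complex) powr (-s))) summable_on A"
proof -
  have "summable (\<lambda>n. real n powr (- Re s))" using assms by (simp add: summable_real_powr_iff)
  moreover have "norm ((of_nat n :: complex) powr (-s)) = real n powr (- Re s)" for n
    by (cases "n = 0") (simp_all add: norm_nat_powr)
  ultimately have "(\<lambda>n. norm ((of_nat n :: complex) powr (-s))) summable_on UNIV"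
    by (simp add: summable_on_UNIV_nonneg_real_iff)
  then show ?thesis by (rule summable_on_subset_banach) auto
qed

lemma summable_on_nat_powr:
  assumes "Re s > 1"
  shows "(\<lambda>n. (of_nat n :: complex) powr (-s)) summable_on A"
  by (rule abs_summable_summable[OF abs_summable_nat_powr[OF assms]])

lemma summable_on_nat_real_powr:
  assumes "x > 1"
  shows "(\<lambda>n. real n powr (-x)) summable_on A"
proof -
  have "(\<lambda>n. real n powr (- x)) summable_on UNIV" 
    using assms by (simp add: summable_on_UNIV_nonneg_real_iff summable_real_powr_iff)
  then show ?thesis by (rule summable_on_subset_banach) auto
qed

lemma dzeta_sums:
  assumes "Re s > 1"
  shows "(\<lambda>n. of_nat (Suc n) powr (-s)) sums dzeta s"
proof -
  have "((\<lambda>n. (of_nat n :: complex) powr (-s)) has_sum dzeta s) (Suc ` UNIV)"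
    using has_sum_infsum[OF summable_on_nat_powr[OF assms, of "{0<..}"]]
    unfolding dzeta_def by (simp only: greaterThan_0)
  then have "((\<lambda>n. (of_nat (Suc n) :: complex) powr (-s)) has_sum dzeta s) UNIV"
    by (subst (asm) has_sum_reindex) (auto simp: o_def)
  then show ?thesis by (rule has_sum_imp_sums)
qed

text \<open>The partial sums of \<open>zeta_term\<close> telescope. The 1 in \<open>zetaH\<close> is
  s - 1 times the integral of x powr (-s) over [1, \<infinity>).\<close>

lemma zetaH_eq:
  assumes "Re s > 1"
  shows "zetaH s = (s - 1) * dzeta s"
proof -
  have part: "(\<Sum>n<N. zeta_term n s) = (s - 1) * (\<Sum>n<N. of_nat (Suc n) powr (-s)) - 1 + of_nat (Suc N) powr (1 - s)" for N
  proof (induction N)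
    case (Suc N)
    then show ?case unfolding sum.lessThan_Suc zeta_term_def by (simp only: ring_distribs) simp
  qed simp
  have "(\<lambda>N. of_nat (Suc N) powr (1 - s)) \<longlonglongrightarrow> 0"
  proof (rule Lim_null_comparison)
    have "((\<lambda>N. real (Suc N) powr (1 - Re s)) \<longlongrightarrow> 0) sequentially"
      using assms by (intro tendsto_neg_powr filterlim_compose[OF filterlim_real_sequentially filterlim_Suc]) auto
    then show "(\<lambda>N. real (Suc N) powr (1 - Re s)) \<longlonglongrightarrow> 0" .
    show "\<forall>\<^sub>F n in sequentially. norm ((of_nat (Suc n) :: complex) powr (1 - s)) \<le> real (Suc n) powr (1 - Re s)"
      by (intro always_eventually allI) (subst norm_nat_powr, auto)
  qed
  moreover have "(\<lambda>N. \<Sum>n<N. of_nat (Suc n) powr (-s)) \<longlonglongrightarrow> dzeta s"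
    using dzeta_sums[OF assms] by (simp add: sums_def)
  ultimately have "(\<lambda>N. \<Sum>n<N. zeta_term n s) \<longlonglongrightarrow> (s - 1) * dzeta s - 1 + 0"
    unfolding part by (intro tendsto_intros)
  then have "(\<lambda>n. zeta_term n s) sums ((s - 1) * dzeta s - 1)" by (simp add: sums_def)
  then show ?thesis by (simp add: zetaH_def sums_unique[symmetric])
qed

lemma powr_diff_mvt:
  fixes y :: real
  assumes "n > (0::nat)"
  obtains z where "real n < z" "z < real (Suc n)" "real (Suc n) powr y - real n powr y = y * z powr (y - 1)"
proof -
  define a where "a = real n"
  have a: "0 < a" using assms by (simp add: a_def)
  have "\<exists>z. a < z \<and> z < a + 1 \<and> (a + 1) powr y - a powr y = (a + 1 - a) * (y * z powr (y - 1))"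
    by (intro MVT2) (use a in \<open>auto intro!: derivative_eq_intros has_real_derivative_powr\<close>)
  then obtain z where "a < z" "z < a + 1" "(a + 1) powr y - a powr y = y * z powr (y - 1)" by auto
  then show ?thesis by (intro that[of z]) (auto simp: a_def add.commute)
qed

text \<open>Comparison with the integral over \<open>(N, \<infinity>)\<close>.\<close>
lemma infsum_tail_powr_le:
  assumes x: "x > 0" and N: "N > 0"
  shows "infsum (\<lambda>n. real n powr (-1-x)) {N<..} \<le> real N powr (-x) / x"
proof -
  have tele: "x * real (Suc n) powr (-1-x) \<le> real n powr (-x) - real (Suc n) powr (-x)" if n: "n > 0" for n
  proof -
    obtain z where z: "real n < z" "z < real (Suc n)" "real (Suc n) powr (-x) - real n powr (-x) = (-x) * z powr (-x - 1)"
      using powr_diff_mvt[OF n] by metis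
    have "real (Suc n) powr (-x-1) \<le> z powr (-x-1)"
      using powr_mono2'[of "-x-1" z "real (Suc n)"] z(1,2) x n by simp
    moreover have "-x-1 = -1-x" by simp
    ultimately have "real (Suc n) powr (-1-x) \<le> z powr (-x-1)" by metis
    then have "x * real (Suc n) powr (-1-x) \<le> x * z powr (-x-1)" using x by simp
    then show ?thesis using z(3) by linarith
  qed
  have part: "(\<Sum>n\<in>{N<..M}. x * real n powr (-1-x)) \<le> real N powr (-x) - real M powr (-x)" if "M \<ge> N" for M
    using that
  proof (induction M rule: dec_induct)
    case (step n)
    have "{N<..Suc n} = insert (Suc n) {N<..n}" using step by auto
    then have "(\<Sum>n\<in>{N<..Suc n}. x * real n powr (-1-x)) = x * real (Suc n) powr (-1-x) + (\<Sum>n\<in>{N<..n}. x * real n powr (-1-x))"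
      by simp
    moreover have "n > 0" using N step by simp
    ultimately show ?case using step tele[of n] by linarith
  qed simp
  have "infsum (\<lambda>n. real n powr (-1-x)) {N<..} \<le> real N powr (-x) / x"
  proof (rule infsum_le_finite_sums)
    show "(\<lambda>n. real n powr (-1-x)) summable_on {N<..}"
      using summable_on_nat_real_powr[of "1 + x"] x by simp
    fix F assume F: "finite F" "F \<subseteq> {N<..}"
    define M where "M = Max (insert N F)"
    have "F \<subseteq> {N<..M}" "M \<ge> N" using F by (auto simp: M_def)
    then have "(\<Sum>n\<in>F. real n powr (-1-x)) \<le> (\<Sum>n\<in>{N<..M}. real n powr (-1-x))"
      by (intro sum_mono2) auto
    moreover have "x * (\<Sum>n\<in>{N<..M}. real n powr (-1-x)) \<le> real N powr (-x)"
      using part[OF \<open>M \<ge> N\<close>] powr_ge_zero[of "real M" "-x"] unfolding sum_distrib_left by linarith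
    then have "(\<Sum>n\<in>{N<..M}. real n powr (-1-x)) \<le> real N powr (-x) / x"
      using x by (simp add: pos_le_divide_eq mult.commute)
    ultimately show "(\<Sum>n\<in>F. real n powr (-1-x)) \<le> real N powr (-x) / x" by linarith
  qed
  then show ?thesis .
qed

text \<open>Comparison with the integral of x powr (y - 1). For y \<le> 1 the terms decrease and the
  integral alone suffices; for y > 1 they increase, and the second summand is the last term of the
  sum.\<close>

lemma sum_powr_le:
  assumes y: "y > 0" and N: "N > 0"
  shows "(\<Sum>n=1..N. real n powr (y-1)) \<le> real N powr y / y + real N powr (y-1)"
proof (cases "y \<le> 1")
  case True
  have "(\<Sum>n=1..N. real n powr (y-1)) \<le> real N powr y / y"
  using N proof (induction N rule: nat_induct_non_zero)
    case 1 then show ?case using y True by simp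
  next
    case (Suc n)
    obtain z where z: "real n < z" "z < real (Suc n)" "real (Suc n) powr y - real n powr y = y * z powr (y - 1)"
      using powr_diff_mvt[OF Suc.hyps] by metis
    have "real (Suc n) powr (y-1) \<le> z powr (y-1)"
      using powr_mono2'[of "y-1" z "real (Suc n)"] z(1,2) True Suc.hyps by simp
    then have "y * real (Suc n) powr (y-1) \<le> y * z powr (y-1)" using y by simp
    then have "real (Suc n) powr (y-1) \<le> real (Suc n) powr y / y - real n powr y / y"
      using z(3) y by (simp add: field_simps del: of_nat_Suc)
    then show ?case using Suc.IH by (simp del: of_nat_Suc)
  qed
  then show ?thesis using powr_ge_zero[of "real N" "y-1"] by linarith
next
  case False
  show ?thesis
  using N proof (induction N rule: nat_induct_non_zero)
    case 1 then show ?case using y by simp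
  next
    case (Suc n)
    obtain z where z: "real n < z" "z < real (Suc n)" "real (Suc n) powr y - real n powr y = y * z powr (y - 1)"
      using powr_diff_mvt[OF Suc.hyps] by metis
    have "real n powr (y-1) \<le> z powr (y-1)"
      using powr_mono2[of "y-1" "real n" z] z(1,2) False Suc.hyps by simp
    then have "y * real n powr (y-1) \<le> y * z powr (y-1)" using y by simp
    then have "real n powr (y-1) \<le> real (Suc n) powr y / y - real n powr y / y"
      using z(3) y by (simp add: field_simps del: of_nat_Suc)
    then show ?case using Suc.IH by (simp del: of_nat_Suc)
  qed
qed

section \<open>Euler product and the Dirichlet series of the Moebius function\<close>

definition sieved :: "nat set \<Rightarrow> nat set" where
  "sieved P = {n. n > 0 \<and> (\<forall>p\<in>P. \<not> p dvd n)}"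

text \<open>The primes are sieved out one at a time: the multiples of \<open>q\<close> in
  \<open>sieved P\<close> are q times the elements of \<open>sieved P\<close>, and contribute q powr
  (-s) times the whole sum.\<close>

lemma infsum_sieved:
  assumes s: "Re s > 1" and "finite P" "\<And>p. p \<in> P \<Longrightarrow> prime p"
  shows "infsum (\<lambda>n. of_nat n powr (-s)) (sieved P) = dzeta s * (\<Prod>p\<in>P. 1 - of_nat p powr (-s))"
  using assms(2,3)
proof (induction P rule: finite_induct)
  case empty
  have "sieved {} = {0<..}" by (auto simp: sieved_def)
  then show ?case by (simp add: dzeta_def)
next
  case (insert q P)
  have q: "prime q" and P: "\<And>p. p \<in> P \<Longrightarrow> prime p" using insert by auto
  let ?f = "\<lambda>n. (of_nat n :: complex) powr (-s)"
  have "q > 0" using q by (simp add: prime_gt_0_nat)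
  have split: "sieved P = sieved (insert q P) \<union> (*) q ` sieved P"
  proof (intro equalityI subsetI)
    fix n assume n: "n \<in> sieved P"
    show "n \<in> sieved (insert q P) \<union> (*) q ` sieved P"
    proof (cases "q dvd n")
      case True
      then obtain m where "n = q * m" by (auto elim: dvdE)
      moreover have "m \<in> sieved P" using n \<open>n = q * m\<close> by (auto simp: sieved_def)
      ultimately show ?thesis by blast
    qed (use n in \<open>auto simp: sieved_def\<close>)
  next
    fix n assume n: "n \<in> sieved (insert q P) \<union> (*) q ` sieved P"
    have "\<not> p dvd q" if "p \<in> P" for p
      using P[OF that] q insert.hyps(2) that primes_dvd_imp_eq by blast
    then show "n \<in> sieved P"
      using n P \<open>q > 0\<close> by (auto simp: sieved_def prime_dvd_mult_iff)
  qed
  have disj: "sieved (insert q P) \<inter> (*) q ` sieved P = {}" by (auto simp: sieved_def)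
  have "infsum ?f (sieved P) = infsum ?f (sieved (insert q P)) + infsum ?f ((*) q ` sieved P)"
    by (subst split, rule infsum_Un_disjoint) (use disj summable_on_nat_powr[OF s] in auto)
  also have "infsum ?f ((*) q ` sieved P) = infsum (?f \<circ> (*) q) (sieved P)"
    using \<open>q > 0\<close> by (intro infsum_reindex) (auto simp: inj_on_def)
  also have "\<dots> = infsum (\<lambda>n. ?f q * ?f n) (sieved P)"
    by (intro infsum_cong) (simp add: powr_times_real)
  also have "\<dots> = ?f q * infsum ?f (sieved P)" by (rule infsum_cmult_right')
  finally have "infsum ?f (sieved (insert q P)) = infsum ?f (sieved P) * (1 - ?f q)"
    by (simp add: algebra_simps)
  then show ?case using insert by (simp add: mult_ac)
qed

definition primes_upto :: "nat \<Rightarrow> nat set" where "primes_upto N = {p. prime p \<and> p \<le> N}"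

lemma finite_primes_upto [simp]: "finite (primes_upto N)"
  unfolding primes_upto_def by (rule finite_subset[of _ "{..N}"]) auto

text \<open>The bounded coefficient covers both series that occur: the constant 1 in the Euler
  product and the Moebius function in its inverse.\<close>

lemma norm_infsum_tail_le:
  fixes c :: "nat \<Rightarrow> complex"
  assumes s: "Re s > 1" and N: "N > 0" and A: "A \<subseteq> {N<..}" and c: "\<And>n. norm (c n :: complex) \<le> 1"
  shows "(\<lambda>n. c n * of_nat n powr (-s)) summable_on A"
    "norm (infsum (\<lambda>n. c n * of_nat n powr (-s)) A) \<le> real N powr (1 - Re s) / (Re s - 1)"
proof -
  have le: "norm (c n * of_nat n powr (-s)) \<le> real n powr (- Re s)" for n
  proof -
    have "norm ((of_nat n :: complex) powr (-s)) = real n powr (- Re s)"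
      by (cases "n = 0") (simp_all add: norm_nat_powr)
    then show ?thesis using mult_right_mono[OF c[of n], of "real n powr (- Re s)"] by (simp add: norm_mult)
  qed
  have sm: "(\<lambda>n. real n powr (- Re s)) summable_on B" for B
    using s by (rule summable_on_nat_real_powr)
  have abs: "(\<lambda>n. norm (c n * of_nat n powr (-s))) summable_on A"
    by (rule summable_on_comparison_test[OF sm le]) auto
  then show "(\<lambda>n. c n * of_nat n powr (-s)) summable_on A" by (rule abs_summable_summable)
  have "norm (infsum (\<lambda>n. c n * of_nat n powr (-s)) A) \<le> infsum (\<lambda>n. norm (c n * of_nat n powr (-s))) A"
    by (rule norm_infsum_bound[OF abs])
  also have "\<dots> \<le> infsum (\<lambda>n. real n powr (- Re s)) {N<..}"
    by (rule infsum_mono_neutral[OF abs sm]) (use A le in auto)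
  also have "\<dots> \<le> real N powr (- (Re s - 1)) / (Re s - 1)"
    using infsum_tail_powr_le[of "Re s - 1" N] s N by simp
  finally show "norm (infsum (\<lambda>n. c n * of_nat n powr (-s)) A) \<le> real N powr (1 - Re s) / (Re s - 1)" by simp
qed

lemma tail_bound_tendsto_0:
  assumes "x > 1"
  shows "(\<lambda>N. real N powr (1 - x) / (x - 1)) \<longlonglongrightarrow> 0"
proof -
  have "(\<lambda>N. real N powr (1 - x)) \<longlonglongrightarrow> 0"
    using assms by (intro tendsto_neg_powr filterlim_real_sequentially) auto
  from tendsto_divide[OF this tendsto_const[of "x - 1"]] assms show ?thesis by simp
qed

text \<open>Apart from 1, every integer that survives the sieve by the primes up to \<open>N\<close>
  exceeds \<open>N\<close>, so the product differs from 1 by a tail of the series.\<close>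

lemma euler_product:
  assumes s: "Re s > 1"
  shows "(\<lambda>N. dzeta s * (\<Prod>p\<in>primes_upto N. 1 - of_nat p powr (-s))) \<longlonglongrightarrow> 1"
proof -
  let ?f = "\<lambda>n. (of_nat n :: complex) powr (-s)"
  have "(\<lambda>N. dzeta s * (\<Prod>p\<in>primes_upto N. 1 - of_nat p powr (-s)) - 1) \<longlonglongrightarrow> 0"
  proof (rule Lim_null_comparison[OF _ tail_bound_tendsto_0[OF s]], intro eventually_sequentiallyI[of 1])
    fix N :: nat assume N: "1 \<le> N"
    define A where "A = sieved (primes_upto N) - {1}"
    have A: "A \<subseteq> {N<..}"
    proof
      fix n assume n: "n \<in> A"
      then have "n \<noteq> 1" "n > 0" by (auto simp: A_def sieved_def)
      then obtain p where "prime p" "p dvd n" using prime_factor_nat by blast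
      then have "p > N" using n by (auto simp: A_def sieved_def primes_upto_def)
      moreover have "p \<le> n" using \<open>p dvd n\<close> \<open>n > 0\<close> by (rule dvd_imp_le)
      ultimately show "n \<in> {N<..}" by simp
    qed
    have "1 \<in> sieved (primes_upto N)"
      by (auto simp: sieved_def primes_upto_def)
    then have "sieved (primes_upto N) = {1} \<union> A" by (auto simp: A_def)
    then have "infsum ?f (sieved (primes_upto N)) = infsum ?f ({1} \<union> A)" by simp
    also have "\<dots> = infsum ?f {1} + infsum ?f A"
      by (rule infsum_Un_disjoint) (use summable_on_nat_powr[OF s] in \<open>auto simp: A_def\<close>)
    moreover have "infsum ?f (sieved (primes_upto N)) = dzeta s * (\<Prod>p\<in>primes_upto N. 1 - of_nat p powr (-s))"
      by (rule infsum_sieved[OF s finite_primes_upto]) (simp add: primes_upto_def)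
    ultimately have "dzeta s * (\<Prod>p\<in>primes_upto N. 1 - of_nat p powr (-s)) - 1 = infsum ?f A"
      by simp
    then show "norm (dzeta s * (\<Prod>p\<in>primes_upto N. 1 - of_nat p powr (-s)) - 1) \<le> real N powr (1 - Re s) / (Re s - 1)"
      using norm_infsum_tail_le(2)[OF s _ A, of "\<lambda>_. 1"] N by simp
  qed
  then show ?thesis by (simp add: LIM_zero_iff)
qed

section \<open>Expansion of the Euler product into the Moebius series\<close>

lemma norm_moebius_le: "norm (moebius n) \<le> 1"
  by (simp add: moebius_def norm_power)

lemma prod_primes_prime_factors:
  fixes A :: "nat set"
  assumes "finite A" "\<And>p. p \<in> A \<Longrightarrow> prime p"
  shows "prime_factors (\<Prod>A) = A" "squarefree (\<Prod>A)" "\<Prod>A > 0"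
proof -
  have *: "multiplicity q (\<Prod>A) = (if q \<in> A then 1 else 0)" if "prime q" for q
    using multiplicity_prod_prime_powers[of A q "\<lambda>_. 1"] assms that by simp
  show pos: "\<Prod>A > 0" using assms by (simp add: prod_pos prime_gt_0_nat)
  show "prime_factors (\<Prod>A) = A"
    using * assms pos by (auto simp: prime_factors_multiplicity split: if_splits)
  show "squarefree (\<Prod>A)"
    using * pos by (subst squarefree_factorial_semiring'') (auto simp: prime_factors_multiplicity)
qed

lemma prod_prime_factors_squarefree:
  assumes "squarefree (n::nat)"
  shows "\<Prod>(prime_factors n) = n"
proof -
  have "n \<noteq> 0" using assms by (metis not_squarefree_0)
  then have "n = (\<Prod>p\<in>prime_factors n. p ^ multiplicity p n)"
    by (simp add: prime_factorization_nat)
  also have "\<dots> = (\<Prod>p\<in>prime_factors n. p)"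
  proof (rule prod.cong[OF refl])
    fix p assume p: "p \<in> prime_factors n"
    then have "prime p" "multiplicity p n > 0" by (auto simp: prime_factors_multiplicity)
    moreover have "multiplicity p n \<le> 1" using assms \<open>n \<noteq> 0\<close> p by (auto simp: squarefree_factorial_semiring'')
    ultimately have "multiplicity p n = 1" by linarith
    then show "p ^ multiplicity p n = p" by simp
  qed
  finally show ?thesis by simp
qed

lemma prod_one_minus_primes:
  assumes "finite P" "\<And>p. p \<in> P \<Longrightarrow> prime p"
  shows "(\<Prod>p\<in>P. 1 - (of_nat p :: complex) powr (-s)) = (\<Sum>n\<in>Prod ` Pow P. moebius n * of_nat n powr (-s))"
proof -
  have inj: "inj_on Prod (Pow P)"
  proof (rule inj_onI)
    fix A B assume A: "A \<in> Pow P" and B: "B \<in> Pow P" and eq: "\<Prod>A = \<Prod>B"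
    have "prime_factors (\<Prod>A) = A" using A assms finite_subset by (intro prod_primes_prime_factors) auto
    moreover have "prime_factors (\<Prod>B) = B" using B assms finite_subset by (intro prod_primes_prime_factors) auto
    ultimately show "A = B" using eq by metis
  qed
  have "(\<Prod>p\<in>P. 1 - (of_nat p :: complex) powr (-s)) = (\<Prod>p\<in>P. - (of_nat p powr (-s)) + 1)" by simp
  also have "\<dots> = (\<Sum>A\<in>Pow P. (\<Prod>p\<in>A. - ((of_nat p::complex) powr (-s))) * (\<Prod>p\<in>P-A. 1))"
    by (rule prod_add[OF assms(1)])
  also have "\<dots> = (\<Sum>A\<in>Pow P. moebius (\<Prod>A) * of_nat (\<Prod>A) powr (-s))"
  proof (rule sum.cong[OF refl])
    fix A assume A: "A \<in> Pow P"
    then have fA: "finite A" and pA: "\<And>p. p \<in> A \<Longrightarrow> prime p" using assms finite_subset by auto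
    have "(\<Prod>p\<in>A. (of_nat p :: complex) powr (-s)) = of_nat (\<Prod>A) powr (-s)"
      using fA by (induction A rule: finite_induct) (simp_all add: powr_times_real del: of_nat_prod)
    moreover have "moebius (\<Prod>A) = (-1) ^ card A"
      using prod_primes_prime_factors[OF fA pA] by (simp add: moebius_def)
    ultimately show "(\<Prod>p\<in>A. - ((of_nat p :: complex) powr (-s))) * (\<Prod>p\<in>P-A. 1) = moebius (\<Prod>A) * of_nat (\<Prod>A) powr (-s)"
      by (simp add: prod_uminus)
  qed
  also have "\<dots> = (\<Sum>n\<in>Prod ` Pow P. moebius n * of_nat n powr (-s))"
    using inj by (simp add: sum.reindex)
  finally show ?thesis .
qed

text \<open>The expanded partial product contains every squarefree integer up to \<open>N\<close>
  and otherwise only integers beyond \<open>N\<close>, which form a tail of the series.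
  Non-vanishing of \<open>dzeta\<close> comes along, since products tending to 1 cannot all have the
  factor 0.\<close>

lemma moebius_dirichlet:
  assumes s: "Re s > 1"
  shows "(\<lambda>N. \<Sum>n=1..N. moebius n * of_nat n powr (-s)) \<longlonglongrightarrow> 1 / dzeta s" "dzeta s \<noteq> 0"
proof -
  let ?f = "\<lambda>n. moebius n * (of_nat n :: complex) powr (-s)"
  define D where "D N = (\<Prod>p\<in>primes_upto N. 1 - (of_nat p :: complex) powr (-s))" for N
  have lim: "(\<lambda>N. dzeta s * D N) \<longlonglongrightarrow> 1" unfolding D_def by (rule euler_product[OF s])
  show nz: "dzeta s \<noteq> 0" using lim by (auto simp: LIMSEQ_const_iff)
  have D: "D \<longlonglongrightarrow> 1 / dzeta s"
    using tendsto_divide[OF lim tendsto_const[of "dzeta s"]] nz by simp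
  have "(\<lambda>N. D N - (\<Sum>n=1..N. ?f n)) \<longlonglongrightarrow> 0"
  proof (rule Lim_null_comparison[OF _ tail_bound_tendsto_0[OF s]], intro eventually_sequentiallyI[of 1])
    fix N :: nat assume N: "1 \<le> N"
    let ?Q = "Prod ` Pow (primes_upto N)"
    have D: "D N = sum ?f ?Q"
      unfolding D_def by (intro prod_one_minus_primes) (auto simp: primes_upto_def)
    have fQ: "finite ?Q" by simp
    have pos: "n > 0" if "n \<in> ?Q" for n
    proof -
      obtain A where "A \<subseteq> primes_upto N" "n = \<Prod>A" using \<open>n \<in> ?Q\<close> by auto
      then show ?thesis using prod_primes_prime_factors(3)[of A] finite_subset[of A]
        by (auto simp: primes_upto_def)
    qed
    have "sum ?f ({1..N} \<inter> ?Q) = sum ?f {1..N}"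
    proof (rule sum.mono_neutral_left)
      show "\<forall>i\<in>{1..N} - {1..N} \<inter> ?Q. ?f i = 0"
      proof
        fix i assume i: "i \<in> {1..N} - {1..N} \<inter> ?Q"
        have "\<not> squarefree i"
        proof
          assume "squarefree i"
          then have "i = \<Prod>(prime_factors i)" by (simp add: prod_prime_factors_squarefree)
          moreover have "prime_factors i \<subseteq> primes_upto N"
          proof
            fix x assume "x \<in> prime_factors i"
            then have "prime x" "x dvd i" by (auto simp: prime_factors_dvd)
            moreover have "x \<le> i" using \<open>x dvd i\<close> i by (intro dvd_imp_le) auto
            ultimately show "x \<in> primes_upto N" using i by (auto simp: primes_upto_def)
          qed
          ultimately have "i \<in> ?Q" by (metis PowI imageI)
          then show False using i by auto
        qed
        then show "?f i = 0" by (simp add: moebius_def)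
      qed
    qed auto
    moreover have "sum ?f ?Q = sum ?f ({1..N} \<inter> ?Q) + sum ?f (?Q - {1..N})"
      by (subst sum.union_disjoint[symmetric]) (use fQ in \<open>auto intro!: sum.cong\<close>)
    ultimately have "D N - sum ?f {1..N} = sum ?f (?Q - {1..N})" using D by simp
    also have "\<dots> = infsum ?f (?Q - {1..N})" using fQ by simp
    finally have "D N - sum ?f {1..N} = infsum ?f (?Q - {1..N})" .
    moreover have Qs: "?Q - {1..N} \<subseteq> {N<..}" using pos by (auto simp: not_le Suc_le_eq)
    have "norm (infsum ?f (?Q - {1..N})) \<le> real N powr (1 - Re s) / (Re s - 1)"
      by (rule norm_infsum_tail_le(2)[OF s _ Qs norm_moebius_le]) (use N in simp)
    ultimately show "norm (D N - sum ?f {1..N}) \<le> real N powr (1 - Re s) / (Re s - 1)" by (simp only:)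
  qed
  from tendsto_diff[OF D this] show "(\<lambda>N. \<Sum>n=1..N. ?f n) \<longlonglongrightarrow> 1 / dzeta s" by simp
qed

lemma moebius_dirichlet_tail:
  assumes s: "Re s > 1" and N: "N > 0"
  shows "norm (1 / dzeta s - (\<Sum>n=1..N. moebius n * of_nat n powr (-s))) \<le> real N powr (1 - Re s) / (Re s - 1)"
proof (rule Lim_norm_ubound)
  let ?f = "\<lambda>n. moebius n * (of_nat n :: complex) powr (-s)"
  show "((\<lambda>M. (\<Sum>n=1..M. ?f n) - (\<Sum>n=1..N. ?f n)) \<longlongrightarrow> 1 / dzeta s - (\<Sum>n=1..N. ?f n)) sequentially"
    by (intro tendsto_intros moebius_dirichlet s)
  show "\<forall>\<^sub>F M in sequentially. norm ((\<Sum>n=1..M. ?f n) - (\<Sum>n=1..N. ?f n)) \<le> real N powr (1 - Re s) / (Re s - 1)"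
  proof (intro eventually_sequentiallyI[of N])
    fix M assume M: "N \<le> M"
    have "{1..M} = {1..N} \<union> {N<..M}" using M by auto
    then have "(\<Sum>n=1..M. ?f n) = (\<Sum>n=1..N. ?f n) + sum ?f {N<..M}"
      by (simp add: sum.union_disjoint ivl_disj_int)
    then have *: "(\<Sum>n=1..M. ?f n) - (\<Sum>n=1..N. ?f n) = infsum ?f {N<..M}" by simp
    have "{N<..M} \<subseteq> {N<..}" by auto
    then show "norm ((\<Sum>n=1..M. ?f n) - (\<Sum>n=1..N. ?f n)) \<le> real N powr (1 - Re s) / (Re s - 1)"
      unfolding * by (rule norm_infsum_tail_le(2)[OF s N _ norm_moebius_le])
  qed
qed auto

section \<open>Non-vanishing on the line Re s = 1\<close>

lemma Re_Ln_one_minus_sums: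
  assumes "norm (w::complex) < 1"
  shows "(\<lambda>n. - (Re (w ^ n) / real n)) sums ln (norm (1 - w))"
proof -
  have "1 - w \<noteq> 0" using assms by auto
  \<comment> \<open>The series starts at n = 0, where division by 0 makes the term 0.\<close>
  have "(\<lambda>n. - ((- (- w)) ^ n) / of_nat n) sums ln (1 + - w)"
    using assms by (intro Ln_series') auto
  from sums_Re[OF this] have "(\<lambda>n. Re (- (w ^ n) / of_nat n)) sums Re (ln (1 - w))" by simp
  moreover have "Re (- (w ^ n) / of_nat n) = - (Re (w ^ n) / real n)" for n by (simp add: Re_divide_of_nat)
  ultimately show ?thesis using \<open>1 - w \<noteq> 0\<close> by (simp add: Re_Ln)
qed

text \<open>Termwise this is the identity 3 + 4 cos \<theta> + cos 2\<theta> = 2 (1 + cos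
  \<theta>)^2, with \<open>Re (z ^ n)\<close> as the cosine.\<close>

lemma three_four_one_ln:
  assumes r: "0 \<le> r" "r < 1" and z: "norm (z::complex) = 1"
  shows "3 * ln (norm (1 - complex_of_real r)) + 4 * ln (norm (1 - of_real r * z)) + ln (norm (1 - of_real r * z\<^sup>2)) \<le> 0"
proof -
  have sums: "(\<lambda>n. 3 * (- (Re (complex_of_real r ^ n) / real n)) + 4 * (- (Re ((of_real r * z) ^ n) / real n))
      + (- (Re ((of_real r * z\<^sup>2) ^ n) / real n))) sums
      (3 * ln (norm (1 - complex_of_real r)) + 4 * ln (norm (1 - of_real r * z)) + ln (norm (1 - of_real r * z\<^sup>2)))"
    using r z by (intro sums_add sums_mult Re_Ln_one_minus_sums) (auto simp: norm_mult norm_power)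
  have nonpos: "3 * (- (Re (complex_of_real r ^ n) / real n)) + 4 * (- (Re ((of_real r * z) ^ n) / real n))
      + (- (Re ((of_real r * z\<^sup>2) ^ n) / real n)) \<le> 0" for n
  proof -
    define w where "w = z ^ n"
    have nw: "norm w = 1" using z by (simp add: w_def norm_power)
    then have sq: "(Re w)\<^sup>2 + (Im w)\<^sup>2 = 1" by (simp add: cmod_def)
    have e1: "Re (complex_of_real r ^ n) = r ^ n" by (simp flip: of_real_power)
    have e2: "Re ((of_real r * z) ^ n) = r ^ n * Re w"
      by (simp add: power_mult_distrib w_def flip: of_real_power)
    have "(of_real r * z\<^sup>2) ^ n = of_real (r ^ n) * (w * w)"
      by (simp add: power_mult_distrib w_def power2_eq_square)
    then have "Re ((of_real r * z\<^sup>2) ^ n) = r ^ n * ((Re w)\<^sup>2 - (Im w)\<^sup>2)"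
      by (simp only:) (simp add: power2_eq_square)
    moreover have "(Re w)\<^sup>2 - (Im w)\<^sup>2 = 2 * (Re w)\<^sup>2 - 1" using sq by linarith
    ultimately have e3: "Re ((of_real r * z\<^sup>2) ^ n) = r ^ n * (2 * (Re w)\<^sup>2 - 1)" by simp
    have "3 * (- (Re (complex_of_real r ^ n) / real n)) + 4 * (- (Re ((of_real r * z) ^ n) / real n))
      + (- (Re ((of_real r * z\<^sup>2) ^ n) / real n)) = - (2 * (r ^ n / real n) * (1 + Re w)\<^sup>2)"
    proof -
      define q where "q = r ^ n / real n"
      have q: "r ^ n / real n = q" "r ^ n * x / real n = q * x" for x by (simp_all add: q_def)
      show ?thesis unfolding e1 e2 e3 q by (simp add: power2_eq_square algebra_simps)
    qed
    then show ?thesis using r by simp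
  qed
  show ?thesis by (rule sums_le[OF nonpos sums sums_zero])
qed

lemma three_four_one_factor:
  assumes r: "0 \<le> r" "r < 1" and z: "norm (z::complex) = 1"
  shows "norm (1 - complex_of_real r) ^ 3 * norm (1 - of_real r * z) ^ 4 * norm (1 - of_real r * z\<^sup>2) \<le> 1"
proof -
  have nz: "1 - w \<noteq> 0" if "norm w < 1" for w :: complex using that by auto
  have "norm (1 - complex_of_real r) > 0" "norm (1 - of_real r * z) > 0" "norm (1 - of_real r * z\<^sup>2) > 0"
    using nz[of "of_real r"] nz[of "of_real r * z"] nz[of "of_real r * z\<^sup>2"] r z
    by (auto simp: norm_mult norm_power)
  then have "ln (norm (1 - complex_of_real r) ^ 3 * norm (1 - of_real r * z) ^ 4 * norm (1 - of_real r * z\<^sup>2)) \<le> 0"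
      "norm (1 - complex_of_real r) ^ 3 * norm (1 - of_real r * z) ^ 4 * norm (1 - of_real r * z\<^sup>2) > 0"
    using three_four_one_ln[OF assms] by (auto simp: ln_mult ln_realpow)
  then show ?thesis by (meson ln_gt_zero not_le)
qed

text \<open>The opposite inequality holds for each Euler factor by
  \<open>three_four_one_factor\<close>. The partial products times \<open>dzeta\<close> tend to 1,
  so it turns into a lower bound for \<open>dzeta\<close> in the limit.\<close>

lemma dzeta_three_four_one:
  assumes \<sigma>: "\<sigma> > 1"
  shows "1 \<le> norm (dzeta (of_real \<sigma>)) ^ 3 * norm (dzeta (of_real \<sigma> + \<i> * of_real t)) ^ 4
    * norm (dzeta (of_real \<sigma> + 2 * (\<i> * of_real t)))"
proof -
  define s1 s2 s3 where s: "s1 = complex_of_real \<sigma>" "s2 = of_real \<sigma> + \<i> * of_real t" "s3 = of_real \<sigma> + 2 * (\<i> * of_real t)"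
  define P where "P s N = (\<Prod>p\<in>primes_upto N. 1 - (of_nat p :: complex) powr (-s))" for s N
  have Re: "Re s1 > 1" "Re s2 > 1" "Re s3 > 1" using \<sigma> by (simp_all add: s)
  have "(\<lambda>N. norm (dzeta s1 * P s1 N) ^ 3 * norm (dzeta s2 * P s2 N) ^ 4 * norm (dzeta s3 * P s3 N)) \<longlonglongrightarrow>
      norm (1::complex) ^ 3 * norm (1::complex) ^ 4 * norm (1::complex)"
    unfolding P_def by (intro tendsto_intros euler_product Re)
  moreover have "norm (P s1 N) ^ 3 * norm (P s2 N) ^ 4 * norm (P s3 N) \<le> 1" for N
  proof -
    have "norm (P s1 N) ^ 3 * norm (P s2 N) ^ 4 * norm (P s3 N) =
      (\<Prod>p\<in>primes_upto N. norm (1 - (of_nat p :: complex) powr (-s1)) ^ 3 * norm (1 - (of_nat p :: complex) powr (-s2)) ^ 4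
         * norm (1 - (of_nat p :: complex) powr (-s3)))"
      by (simp only: P_def prod_norm[symmetric] prod.distrib prod_power_distrib)
    also have "\<dots> \<le> 1"
    proof (rule prod_le_1)
      fix p assume "p \<in> primes_upto N"
      then have p: "p > 1" using prime_gt_1_nat by (auto simp: primes_upto_def)
      define r where "r = real p powr (-\<sigma>)"
      define z where "z = (of_nat p :: complex) powr (- (\<i> * of_real t))"
      have "r < real p powr 0" unfolding r_def using p \<sigma> by (intro powr_less_mono) auto
      then have r: "0 \<le> r" "r < 1" using p by (auto simp: r_def)
      have z: "norm z = 1" using p by (simp add: z_def norm_nat_powr)
      have e1: "(of_nat p :: complex) powr (-s1) = of_real r"
        unfolding s r_def using powr_of_real[of "real p" "-\<sigma>"] by simp
      have e2: "(of_nat p :: complex) powr (-s2) = of_real r * z"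
      proof -
        have "-s2 = -s1 + - (\<i> * of_real t)" by (simp add: s)
        then show ?thesis using e1 p by (simp only: powr_add z_def)
      qed
      have e3: "(of_nat p :: complex) powr (-s3) = of_real r * z\<^sup>2"
      proof -
        have "-s3 = -s1 + (- (\<i> * of_real t) + - (\<i> * of_real t))" by (simp add: s)
        then show ?thesis using e1 p by (simp only: powr_add z_def power2_eq_square)
      qed
      show "0 \<le> norm (1 - (of_nat p :: complex) powr (-s1)) ^ 3 * norm (1 - (of_nat p :: complex) powr (-s2)) ^ 4
         * norm (1 - (of_nat p :: complex) powr (-s3)) \<and>
         norm (1 - (of_nat p :: complex) powr (-s1)) ^ 3 * norm (1 - (of_nat p :: complex) powr (-s2)) ^ 4
         * norm (1 - (of_nat p :: complex) powr (-s3)) \<le> 1"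
        unfolding e1 e2 e3 using three_four_one_factor[OF r z] by simp
    qed
    finally show ?thesis .
  qed
  then have "norm (dzeta s1 * P s1 N) ^ 3 * norm (dzeta s2 * P s2 N) ^ 4 * norm (dzeta s3 * P s3 N) \<le>
     norm (dzeta s1) ^ 3 * norm (dzeta s2) ^ 4 * norm (dzeta s3)" for N
  proof -
    have "norm (dzeta s1 * P s1 N) ^ 3 * norm (dzeta s2 * P s2 N) ^ 4 * norm (dzeta s3 * P s3 N) =
      (norm (dzeta s1) ^ 3 * norm (dzeta s2) ^ 4 * norm (dzeta s3)) * (norm (P s1 N) ^ 3 * norm (P s2 N) ^ 4 * norm (P s3 N))"
      by (simp add: norm_mult power_mult_distrib mult_ac)
    also have "\<dots> \<le> (norm (dzeta s1) ^ 3 * norm (dzeta s2) ^ 4 * norm (dzeta s3)) * 1"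
      using \<open>\<And>N. _ N \<le> 1\<close>[of N] by (intro mult_left_mono) auto
    finally show ?thesis by simp
  qed
  ultimately show ?thesis unfolding s by (intro LIMSEQ_le_const2) auto
qed

lemma zetaH_isCont: "Re s > 0 \<Longrightarrow> isCont zetaH s"
  using holomorphic_on_imp_continuous_on[OF zetaH_holomorphic] open_halfspace_Re_gt
  by (simp add: continuous_on_eq_continuous_at)

text \<open>A zero on the line would make the product of \<open>dzeta_three_four_one\<close> at
  \<sigma> = 1 + x of order x^(-3) x^4 as x decreases to 0: a pole cubed against a zero to the
  fourth power, with the third factor bounded. But the product is at least 1.\<close>

lemma zetaH_nonzero_line:
  assumes t: "t \<noteq> 0"
  shows "zetaH (1 + \<i> * of_real t) \<noteq> 0"
proof
  define s0 where "s0 = 1 + \<i> * of_real t"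
  assume "zetaH (1 + \<i> * of_real t) = 0"
  then have z0: "zetaH s0 = 0" by (simp add: s0_def)
  have "zetaH field_differentiable at s0"
    using zetaH_holomorphic open_halfspace_Re_gt by (rule holomorphic_on_imp_differentiable_at) (simp add: s0_def)
  then obtain D where "(zetaH has_field_derivative D) (at s0)" by (auto simp: field_differentiable_def)
  then have lim: "((\<lambda>h. (zetaH (s0 + h) - zetaH s0) / h) \<longlongrightarrow> D) (at 0)" by (simp add: DERIV_def)
  have of_real_at: "filterlim complex_of_real (at 0) (at_right 0)"
    by (auto simp: filterlim_at eventually_at_filter intro!: tendsto_eq_intros)
  have q: "((\<lambda>x. zetaH (s0 + of_real x) / of_real x) \<longlongrightarrow> D) (at_right 0)"
    using filterlim_compose[OF lim of_real_at] z0 by simp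
  have cont: "((\<lambda>x. zetaH (s + of_real x)) \<longlongrightarrow> zetaH s) (at_right 0)" if "Re s > 0" for s
  proof -
    have "((\<lambda>x. s + complex_of_real x) \<longlongrightarrow> s) (at_right 0)" by (auto intro!: tendsto_eq_intros)
    with zetaH_isCont[OF that] show ?thesis by (rule isCont_tendsto_compose)
  qed
  \<comment> \<open>The product of the zeta factors with the pole and the supposed zero divided out;
    one spare factor x remains.\<close>
  define G where "G x = x * (norm (zetaH (1 + of_real x)) ^ 3
     * (norm (zetaH (s0 + of_real x) / of_real x) / norm (of_real x + \<i> * of_real t)) ^ 4
     * (norm (zetaH (1 + 2 * (\<i> * of_real t) + of_real x)) / norm (of_real x + 2 * (\<i> * of_real t))))" for x :: real
  have "(G \<longlongrightarrow> 0 * (norm (zetaH 1) ^ 3 * (norm D / norm (of_real 0 + \<i> * of_real t)) ^ 4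
     * (norm (zetaH (1 + 2 * (\<i> * of_real t))) / norm (of_real 0 + 2 * (\<i> * of_real t))))) (at_right 0)"
    unfolding G_def using t by (intro tendsto_intros cont q) auto
  then have "(G \<longlongrightarrow> 0) (at_right 0)" by simp
  moreover have "\<forall>\<^sub>F x in at_right 0. 1 \<le> G x"
    unfolding eventually_at_filter
  proof (intro always_eventually allI impI)
    fix x :: real assume "x \<noteq> 0" "x \<in> {0<..}"
    then have x: "x > 0" by simp
    have dz: "dzeta (1 + of_real x + u) = zetaH (1 + u + of_real x) / (of_real x + u)" if "Re u = 0" for u
    proof -
      have "of_real x + u \<noteq> 0" using x that by (auto simp: complex_eq_iff)
      then show ?thesis using zetaH_eq[of "1 + of_real x + u"] x that by (simp add: field_simps)
    qed
    have "1 \<le> norm (dzeta (of_real (1 + x))) ^ 3 * norm (dzeta (of_real (1 + x) + \<i> * of_real t)) ^ 4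
       * norm (dzeta (of_real (1 + x) + 2 * (\<i> * of_real t)))"
      using x by (intro dzeta_three_four_one) auto
    also have "\<dots> = (norm (zetaH (1 + of_real x)) / x) ^ 3 * (norm (zetaH (s0 + of_real x)) / norm (of_real x + \<i> * of_real t)) ^ 4
       * (norm (zetaH (1 + 2 * (\<i> * of_real t) + of_real x)) / norm (of_real x + 2 * (\<i> * of_real t)))"
      using dz[of 0] dz[of "\<i> * of_real t"] dz[of "2 * (\<i> * of_real t)"] x by (simp add: norm_divide s0_def)
    also have "\<dots> = G x"
    proof -
      have "(A / x) ^ 3 * (B / b) ^ 4 * C = x * (A ^ 3 * (B / x / b) ^ 4 * C)" for A B C b :: real
        using x by (simp add: field_simps power_divide power_mult_distrib eval_nat_numeral)
      moreover have "norm (complex_of_real x) = x" using x by simp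
      ultimately show ?thesis unfolding G_def norm_divide by metis
    qed
    finally show "1 \<le> G x" .
  qed
  ultimately have "1 \<le> (0::real)" by (intro tendsto_lowerbound) auto
  then show False by simp
qed

lemma zetaH_nonzero: "Re s \<ge> 1 \<Longrightarrow> zetaH s \<noteq> 0"
proof -
  assume s: "Re s \<ge> 1"
  consider "Re s > 1" | "s = 1" | "Re s = 1" "Im s \<noteq> 0" using s by (force simp: complex_eq_iff)
  then show ?thesis
  proof cases
    case 1 then show ?thesis using zetaH_eq[of s] moebius_dirichlet(2)[of s] by auto
  next
    case 2 then show ?thesis by (simp add: zetaH_1)
  next
    case 3
    then have "s = 1 + \<i> * of_real (Im s)" by (simp add: complex_eq_iff)
    then show ?thesis using zetaH_nonzero_line[OF 3(2)] by simp
  qed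
qed

section \<open>The mean value of the Moebius function\<close>

text \<open>On the circle 1 / z equals cnj z / R^2, so the kernel is the real number 2 Re z / R^2.
  Its factor Re z cancels the 1 / Re z in the bounds for the partial sums and tails on either side
  of the imaginary axis.\<close>

lemma norm_newman_kernel:
  assumes "norm z = R" "R > 0"
  shows "norm (1 / z + z / (of_real R)\<^sup>2) = 2 * \<bar>Re z\<bar> / R\<^sup>2"
proof -
  have "z \<noteq> 0" using assms by auto
  have "z * cnj z = (of_real R)\<^sup>2" using complex_norm_square[of z] assms by simp
  then have "1 / z = cnj z / (of_real R)\<^sup>2" using \<open>z \<noteq> 0\<close> assms by (simp add: field_simps)
  then have "1 / z + z / (of_real R)\<^sup>2 = of_real (2 * Re z / R\<^sup>2)"
    by (simp add: add_divide_distrib[symmetric] complex_add_cnj add.commute)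
  then have "norm (1 / z + z / (of_real R)\<^sup>2) = \<bar>2 * Re z / R\<^sup>2\<bar>" by (simp only: norm_of_real)
  then show ?thesis by (simp add: abs_mult)
qed

section \<open>Newman's contour integral for the Moebius series\<close>

definition moebius_sum :: "nat \<Rightarrow> complex \<Rightarrow> complex" where
  "moebius_sum N z = (\<Sum>n=1..N. moebius n * of_nat n powr (- (1 + z)))"

lemma moebius_sum_holomorphic: "moebius_sum N holomorphic_on A"
  unfolding moebius_sum_def[abs_def] by (auto intro!: holomorphic_intros)

lemma norm_moebius_sum_le:
  assumes "Re z < 0" "N > 0"
  shows "norm (moebius_sum N z) \<le> real N powr (- Re z) / (- Re z) + real N powr (- Re z - 1)"
proof -
  have "norm (moebius_sum N z) \<le> (\<Sum>n=1..N. real n powr (- Re z - 1))"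
    unfolding moebius_sum_def
  proof (rule sum_norm_le)
    fix n assume n: "n \<in> {1..N}"
    have "norm (moebius n * of_nat n powr (- (1 + z))) = norm (moebius n) * real n powr (- Re z - 1)"
      using n by (simp add: norm_mult norm_nat_powr minus_diff_commute)
    also have "\<dots> \<le> 1 * real n powr (- Re z - 1)" by (intro mult_right_mono norm_moebius_le) auto
    finally show "norm (moebius n * of_nat n powr (- (1 + z))) \<le> real n powr (- Re z - 1)" by simp
  qed
  also have "\<dots> \<le> real N powr (- Re z) / (- Re z) + real N powr (- Re z - 1)"
    using assms by (intro sum_powr_le) auto
  finally show ?thesis .
qed

lemma moebius_sum_tail:
  assumes "Re z > 0" "N > 0"
  shows "norm (z / zetaH (1 + z) - moebius_sum N z) \<le> real N powr (- Re z) / Re z"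
proof -
  have "z \<noteq> 0" using assms by auto
  have "zetaH (1 + z) = z * dzeta (1 + z)" using zetaH_eq[of "1 + z"] assms by simp
  then have "z / zetaH (1 + z) = 1 / dzeta (1 + z)" using \<open>z \<noteq> 0\<close> by simp
  then show ?thesis using moebius_dirichlet_tail[of "1 + z" N] assms by (simp add: moebius_sum_def)
qed

text \<open>\<open>circlepath\<close> starts at angle 0, so the right half of the circle consists of
  two separate quarters.\<close>

lemma contour_integral_circlepath_split:
  assumes "continuous_on (sphere 0 R) f" "R > 0"
  shows "contour_integral (circlepath 0 R) f = contour_integral (part_circlepath 0 R 0 (pi/2)) f
    + contour_integral (part_circlepath 0 R (pi/2) (3*pi/2)) f + contour_integral (part_circlepath 0 R (3*pi/2) (2*pi)) f"
proof -
  define g where "g t = f (0 + of_real R * cis t) * of_real R * \<i> * cis t" for t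
  have "continuous_on {0..2*pi} g"
    unfolding g_def using assms
    by (intro continuous_intros continuous_on_compose2[OF assms(1)]) (auto simp: norm_mult)
  then have int: "g integrable_on {0..2*pi}" by (rule integrable_continuous_real)
  have int2: "g integrable_on {0..3*pi/2}" by (rule integrable_on_subinterval[OF int]) auto
  have "integral {0..3*pi/2} g = integral {0..pi/2} g + integral {pi/2..3*pi/2} g"
    by (rule Henstock_Kurzweil_Integration.integral_combine[symmetric]) (use int2 in auto)
  moreover have "integral {0..2*pi} g = integral {0..3*pi/2} g + integral {3*pi/2..2*pi} g"
    by (rule Henstock_Kurzweil_Integration.integral_combine[symmetric]) (use int in auto)
  ultimately show ?thesis
    unfolding circlepath_def using pi_gt_zero by (simp add: contour_integral_part_circlepath_eq g_def[abs_def])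
qed

lemma part_circlepath_Re:
  assumes "z \<in> path_image (part_circlepath 0 R a b)" "R > 0" "a \<le> b"
  obtains x where "a \<le> x" "x \<le> b" "Re z = R * cos x" "norm z = R"
proof -
  obtain x where "a \<le> x" "x \<le> b" "z = of_real R * cis x"
    using assms by (auto simp: path_image_part_circlepath cis_conv_exp)
  then show ?thesis using assms by (intro that[of x]) (auto simp: norm_mult)
qed

text \<open>A segment of the imaginary axis is compact, hence has positive distance to the
  complement of the open set.\<close>

lemma open_halfplane_strip:
  assumes "open U" "{z::complex. Re z \<ge> 0} \<subseteq> U" "T \<ge> 0"
  obtains d where "d > 0" "{z. Re z > - d \<and> \<bar>Im z\<bar> < T} \<subseteq> U"
proof -
  define K where "K = (\<lambda>y. Complex 0 y) ` {-T..T}"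
  have "compact K"
    unfolding K_def by (intro compact_continuous_image) (auto intro!: continuous_intros simp: Complex_eq)
  moreover have "K \<subseteq> U" using assms(2) by (auto simp: K_def)
  ultimately obtain d where d: "d > 0" "\<And>x y. x \<in> K \<Longrightarrow> dist x y < d \<Longrightarrow> y \<in> U"
    using compact_subset_open_imp_ball_epsilon_subset[of K U] assms(1) by (auto simp: subset_iff) metis
  show ?thesis
  proof (rule that[OF d(1)], safe)
    fix z assume z: "Re z > - d" "\<bar>Im z\<bar> < T"
    show "z \<in> U"
    proof (cases "Re z \<ge> 0")
      case False
      have "Complex 0 (Im z) \<in> K" unfolding K_def by (rule imageI) (use z in auto)
      moreover have "Complex 0 (Im z) - z = - of_real (Re z)" by (simp add: complex_eq_iff)
      then have "dist (Complex 0 (Im z)) z = \<bar>Re z\<bar>" by (simp add: dist_norm)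
      ultimately show ?thesis using d(2)[of "Complex 0 (Im z)" z] z False by auto
    qed (use assms(2) in auto)
  qed
qed

text \<open>Newman's contour argument. Since \<open>zetaH 1 \<noteq> 0\<close>, the function \<open>z / zetaH (1 + z)\<close> vanishes at 0,
  so that against the kernel \<open>N powr z * (1 / z + z / R\<^sup>2)\<close> it has no residue there.\<close>
lemma moebius_sum_0_bound:
  assumes R: "R \<ge> 1"
  shows "\<forall>\<^sub>F N in sequentially. norm (moebius_sum N 0) \<le> 8 / R"
proof -
  have "R > 0" using R by simp
  define U where "U = {z. Re z > -1 \<and> zetaH (1 + z) \<noteq> 0}"
  have contH: "continuous_on {z. Re z > -1} (\<lambda>z. zetaH (1 + z))"
    by (intro continuous_on_compose2[OF holomorphic_on_imp_continuous_on[OF zetaH_holomorphic]] continuous_intros) auto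
  have "U = {z. Re z > -1} \<inter> (\<lambda>z. zetaH (1 + z)) -` (- {0})" by (auto simp: U_def)
  moreover have "open ({z. Re z > -1} \<inter> (\<lambda>z. zetaH (1 + z)) -` (- {0}))"
    by (rule continuous_open_preimage[OF contH]) (auto simp: open_halfspace_Re_gt)
  ultimately have "open U" by simp
  moreover have "{z. Re z \<ge> 0} \<subseteq> U" using zetaH_nonzero by (auto simp: U_def)
  ultimately obtain d0 where d0: "d0 > 0" "{z. Re z > - d0 \<and> \<bar>Im z\<bar> < R + 1} \<subseteq> U"
    using open_halfplane_strip[of U "R + 1"] R by auto
  define V where "V = {z. Re z > - d0 \<and> \<bar>Im z\<bar> < R + 1}"
  have Veq: "V = {z. Re z > - d0} \<inter> {z. Im z < R + 1} \<inter> {z. Im z > - (R + 1)}" by (auto simp: V_def)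
  then have V: "convex V"
    by (auto intro!: convex_Int convex_halfspace_Re_gt convex_halfspace_Im_gt convex_halfspace_Im_lt)
  \<comment> \<open>This is z / \<open>zetaH (1 + z)\<close> times the kernel without its factor
    \<open>N powr z\<close>; the factor z cancels the pole of the kernel at 0.\<close>
  define Q where "Q z = (1 + z\<^sup>2 / (of_real R)\<^sup>2) / zetaH (1 + z)" for z
  have holH: "(\<lambda>z. zetaH (1 + z)) holomorphic_on U"
  proof -
    have "(zetaH \<circ> (\<lambda>z. 1 + z)) holomorphic_on U"
      by (rule holomorphic_on_compose_gen[OF _ zetaH_holomorphic]) (auto intro!: holomorphic_intros simp: U_def)
    then show ?thesis by (simp add: o_def)
  qed
  have holQ: "Q holomorphic_on V"
    unfolding Q_def using d0(2) R
    by (intro holomorphic_intros holomorphic_on_subset[OF holH]) (auto simp: V_def U_def)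
  define K where "K = cbox (Complex (- d0/2) (-R)) (Complex 0 R)"
  have KV: "K \<subseteq> V" using d0(1) by (auto simp: K_def V_def in_cbox_complex_iff)
  have "compact (Q ` K)"
    using holomorphic_on_imp_continuous_on[OF holQ] KV
    by (intro compact_continuous_image) (auto simp: K_def intro: continuous_on_subset)
  then obtain B0 where "\<And>z. z \<in> K \<Longrightarrow> norm (Q z) \<le> B0"
    using compact_imp_bounded bounded_iff by (metis imageI)
  then obtain B where B: "B > 0" "\<And>z. z \<in> K \<Longrightarrow> norm (Q z) \<le> B"
    by (metis less_max_iff_disj max.coboundedI1 zero_less_one)
  \<comment> \<open>The bound d0/2 keeps the contour inside \<open>K\<close>. The bound 1/(B R)
    makes each horizontal segment, of length d, contribute at most 1/R.\<close>
  define d where "d = min (d0/2) (1 / (B * R))"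
  have d: "d > 0" "d \<le> d0/2" "B * d \<le> 1 / R"
    using d0 B \<open>R > 0\<close> by (auto simp: d_def field_simps min_def)
  define a where "a = \<i> * of_real R"
  define b where "b = - of_real d + \<i> * of_real R"
  define b' where "b' = - of_real d - \<i> * of_real R"
  have segK: "closed_segment x y \<subseteq> K" if "x \<in> K" "y \<in> K" for x y
    using that by (intro closed_segment_subset) (auto simp: K_def convex_box)
  have inK: "a \<in> K" "b \<in> K" "b' \<in> K" "-a \<in> K"
    using d R d0 by (auto simp: a_def b_def b'_def K_def in_cbox_complex_iff)
  let ?A1 = "part_circlepath 0 R 0 (pi/2)"
  let ?A2 = "part_circlepath 0 R (pi/2) (3*pi/2)"
  let ?A3 = "part_circlepath 0 R (3*pi/2) (2*pi)"
  have ends: "pathstart ?A1 = of_real R" "pathfinish ?A1 = a" "pathstart ?A3 = -a" "pathfinish ?A3 = of_real R"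
    using cos_3over2_pi sin_3over2_pi by (simp_all add: a_def exp_eq_polar cis_conv_exp[symmetric] complex_eq_iff)
  have "\<forall>\<^sub>F N in sequentially. 2 * R * B * real N powr (- d) < 1 / R"
  proof -
    have "(\<lambda>N. 2 * R * B * real N powr (- d)) \<longlonglongrightarrow> 2 * R * B * 0"
      using d by (intro tendsto_intros tendsto_neg_powr filterlim_real_sequentially) auto
    then show ?thesis using \<open>R > 0\<close> by (intro order_tendstoD) auto
  qed
  moreover have "\<forall>\<^sub>F N in sequentially. N \<ge> (1::nat)" by (rule eventually_ge_at_top)
  moreover have "\<forall>\<^sub>F N in sequentially. real N \<ge> R"
    using filterlim_real_sequentially by (simp add: filterlim_at_top)
  ultimately show ?thesis
  proof eventually_elim
    case (elim N)
    then have N: "N \<ge> 1" and NR: "real N \<ge> R" and small: "2 * R * B * real N powr (- d) < 1 / R" by auto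
    define k where "k z = (of_nat N :: complex) powr z * (1 / z + z / (of_real R)\<^sup>2)" for z
    have nk: "norm (k z) = real N powr (Re z) * (2 * \<bar>Re z\<bar> / R\<^sup>2)" if "norm z = R" for z
      unfolding k_def norm_mult using N norm_newman_kernel[OF that \<open>R > 0\<close>] by (simp add: norm_nat_powr)
    define G where "G z = Q z * (of_nat N :: complex) powr z" for z
    have holG: "G holomorphic_on V" unfolding G_def using N by (intro holomorphic_intros holQ) auto
    have Gk: "G z = z / zetaH (1 + z) * k z" if "z \<noteq> 0" for z
    proof -
      have "1 + z\<^sup>2 / (of_real R)\<^sup>2 = z * (1 / z + z / (of_real R)\<^sup>2)"
        using that by (simp add: distrib_left power2_eq_square)
      then show ?thesis unfolding G_def Q_def k_def by (simp only: times_divide_eq_left mult_ac)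
    qed
    define S where "S z = moebius_sum N z * k z" for z
    have contk: "continuous_on (sphere 0 R) k"
      unfolding k_def using N \<open>R > 0\<close> by (intro continuous_intros) auto
    have contS: "continuous_on (sphere 0 R) S"
      unfolding S_def
      by (intro continuous_on_mult contk holomorphic_on_imp_continuous_on[OF moebius_sum_holomorphic])
    have sub: "path_image (part_circlepath 0 R x y) \<subseteq> sphere 0 R" if "x \<le> y" for x y
      using that \<open>R > 0\<close> by (intro path_image_part_circlepath_subset) auto
    have right: "Re z \<ge> 0 \<and> norm z = R" if "z \<in> path_image ?A1 \<or> z \<in> path_image ?A3" for z
    proof -
      have "\<exists>x. Re z = R * cos x \<and> norm z = R \<and> cos x \<ge> 0"
        using that
      proof
        assume "z \<in> path_image ?A1"
        then obtain x where "0 \<le> x" "x \<le> pi/2" "Re z = R * cos x" "norm z = R"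
          using part_circlepath_Re[of z R 0 "pi/2"] \<open>R > 0\<close> by auto
        then show ?thesis by (intro exI[of _ x]) (auto intro!: cos_ge_zero)
      next
        assume "z \<in> path_image ?A3"
        then obtain x where x: "3*pi/2 \<le> x" "x \<le> 2*pi" "Re z = R * cos x" "norm z = R"
          using part_circlepath_Re[of z R "3*pi/2" "2*pi"] \<open>R > 0\<close> by auto
        have "cos x = cos (2*pi - x)" by (simp add: cos_diff)
        moreover have "cos (2*pi - x) \<ge> 0" using x by (intro cos_ge_zero) auto
        ultimately show ?thesis using x by auto
      qed
      then show ?thesis using \<open>R > 0\<close> by auto
    qed
    have left: "Re z \<le> 0 \<and> norm z = R" if zA2: "z \<in> path_image ?A2" for z
    proof -
      obtain x where x: "pi/2 \<le> x" "x \<le> 3*pi/2" "Re z = R * cos x" "norm z = R"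
        by (rule part_circlepath_Re[OF zA2 \<open>R > 0\<close>]) auto
      have "cos x = - cos (x - pi)" by (simp add: cos_diff)
      moreover have "cos (x - pi) \<ge> 0" using x by (intro cos_ge_zero) auto
      ultimately show ?thesis using x \<open>R > 0\<close> by (simp add: mult_nonneg_nonpos)
    qed
    have arcV: "path_image ?A1 \<subseteq> V" "path_image ?A3 \<subseteq> V"
    proof -
      have "z \<in> V" if "Re z \<ge> 0 \<and> norm z = R" for z
        using that abs_Im_le_cmod[of z] d0(1) unfolding V_def mem_Collect_eq by linarith
      then show "path_image ?A1 \<subseteq> V" "path_image ?A3 \<subseteq> V" using right by blast+
    qed
    have segV: "closed_segment a b \<subseteq> V" "closed_segment b b' \<subseteq> V" "closed_segment b' (-a) \<subseteq> V"
      using segK inK KV by blast+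
    let ?g = "?A1 +++ linepath a b +++ linepath b b' +++ linepath b' (-a) +++ ?A3"
    \<comment> \<open>The contour follows the right semicircle and closes through a thin rectangle
      to the left of the imaginary axis, where \<open>G\<close> is still holomorphic.\<close>
    have "(G has_contour_integral 0) ?g"
    proof (rule Cauchy_theorem_convex_simple[OF holG V])
      show "valid_path ?g" by (simp add: ends del: pathstart_part_circlepath pathfinish_part_circlepath)
      show "path_image ?g \<subseteq> V"
        using arcV segV by (simp add: path_image_join ends del: pathstart_part_circlepath pathfinish_part_circlepath)
      show "pathfinish ?g = pathstart ?g" by (simp add: ends del: pathstart_part_circlepath pathfinish_part_circlepath)
    qed
    then have "contour_integral ?g G = 0" by (rule contour_integral_unique)
    moreover have intG: "G contour_integrable_on \<gamma>" if "valid_path \<gamma>" "path_image \<gamma> \<subseteq> V" for \<gamma>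
      using contour_integrable_holomorphic_simple[OF holG _ that]
      by (simp add: Veq open_Int open_halfspace_Re_gt open_halfspace_Im_gt open_halfspace_Im_lt)
    ultimately have sum0: "contour_integral ?A1 G + (contour_integral (linepath a b) G
        + (contour_integral (linepath b b') G + (contour_integral (linepath b' (-a)) G + contour_integral ?A3 G))) = 0"
      using arcV segV by (simp add: contour_integral_join ends path_image_join del: pathstart_part_circlepath pathfinish_part_circlepath)
    have lineint: "G contour_integrable_on linepath x y" if "closed_segment x y \<subseteq> V" for x y
      using that by (intro intG) auto
    have normG: "norm (G z) \<le> B * real N powr (Re z)" if "z \<in> K" for z
      unfolding G_def norm_mult using B(2)[OF that] N by (auto simp: norm_nat_powr intro!: mult_right_mono)
    have ReK: "real N powr (Re z) \<le> 1" if "z \<in> K" for z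
    proof -
      have "Re z \<le> 0" using that by (simp add: K_def in_cbox_complex_iff)
      then have "real N powr (Re z) \<le> real N powr 0" using N by (intro powr_mono) auto
      then show ?thesis using N by simp
    qed
    have normG1: "norm (G z) \<le> B" if "z \<in> K" for z
    proof -
      have "B * real N powr (Re z) \<le> B * 1" using ReK[OF that] B(1) by (intro mult_left_mono) auto
      then show ?thesis using normG[OF that] by linarith
    qed
    have l1: "norm (contour_integral (linepath a b) G) \<le> 1 / R"
    proof -
      have "norm (contour_integral (linepath a b) G) \<le> B * norm (b - a)"
        using segK[OF inK(1,2)] B(1) by (intro contour_integral_bound_linepath lineint segV) (auto intro: normG1)
      also have "norm (b - a) = d" using d by (simp add: a_def b_def)
      finally show ?thesis using d by simp
    qed
    have l3: "norm (contour_integral (linepath b' (-a)) G) \<le> 1 / R"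
    proof -
      have "norm (contour_integral (linepath b' (-a)) G) \<le> B * norm (-a - b')"
        using segK[OF inK(3,4)] B(1) by (intro contour_integral_bound_linepath lineint segV) (auto intro: normG1)
      also have "norm (-a - b') = d" using d by (simp add: a_def b'_def)
      finally show ?thesis using d by simp
    qed
    have l2: "norm (contour_integral (linepath b b') G) \<le> 1 / R"
    proof -
      have "norm (G z) \<le> B * real N powr (- d)" if zb: "z \<in> closed_segment b b'" for z
      proof -
        obtain u where "z = (1 - u) *\<^sub>R b + u *\<^sub>R b'" using zb by (auto simp: closed_segment_def)
        then have "Re z = (1 - u) * (- d) + u * (- d)" by (simp add: b_def b'_def)
        then have "Re z = - d" by (simp add: algebra_simps)
        moreover have "z \<in> K" using segK[OF inK(2,3)] zb by auto
        ultimately show ?thesis using normG by metis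
      qed
      then have "norm (contour_integral (linepath b b') G) \<le> B * real N powr (- d) * norm (b' - b)"
        using B(1) by (intro contour_integral_bound_linepath lineint segV) auto
      also have "b' - b = - (2 * (\<i> * of_real R))" by (simp add: b_def b'_def)
      then have "norm (b' - b) = 2 * R" using \<open>R > 0\<close> by (simp add: norm_mult)
      finally show ?thesis using small by (simp add: mult_ac)
    qed
    define arcs where "arcs f = contour_integral ?A1 f + contour_integral ?A3 f" for f
    have arcsG: "norm (arcs G) \<le> 3 / R"
    proof -
      have "arcs G = - (contour_integral (linepath a b) G + contour_integral (linepath b b') G + contour_integral (linepath b' (-a)) G)"
        using sum0 unfolding arcs_def by (simp add: algebra_simps eq_neg_iff_add_eq_0)
      moreover have "norm (- (x + y + z)) \<le> norm x + norm y + norm z" for x y z :: complex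
        using norm_triangle_ineq[of "x + y" z] norm_triangle_ineq[of x y] unfolding norm_minus_cancel by linarith
      ultimately have "norm (arcs G) \<le> norm (contour_integral (linepath a b) G) + norm (contour_integral (linepath b b') G) + norm (contour_integral (linepath b' (-a)) G)"
        by metis
      then show ?thesis using l1 l2 l3 by (simp add: field_simps)
    qed
    have intS: "S contour_integrable_on part_circlepath 0 R x y" if "x \<le> y" for x y
      using sub[OF that] contS by (intro contour_integrable_continuous_part_circlepath) (auto intro: continuous_on_subset)
    have GS: "norm (G z - S z) \<le> 2 / R\<^sup>2" if "z \<in> path_image ?A1 \<or> z \<in> path_image ?A3" for z
    proof -
      have z: "Re z \<ge> 0" "norm z = R" using right[OF that] by auto
      then have "z \<noteq> 0" using \<open>R > 0\<close> by auto
      have eq: "G z - S z = (z / zetaH (1 + z) - moebius_sum N z) * k z"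
        unfolding S_def Gk[OF \<open>z \<noteq> 0\<close>] by (simp add: algebra_simps)
      show ?thesis
      proof (cases "Re z = 0")
        case True
        then have "norm (k z) = 0" using nk[OF z(2)] by simp
        then show ?thesis unfolding eq by simp
      next
        case False
        then have pos: "Re z > 0" using z by simp
        have "norm (G z - S z) \<le> (real N powr (- Re z) / Re z) * (real N powr (Re z) * (2 * \<bar>Re z\<bar> / R\<^sup>2))"
          unfolding eq norm_mult nk[OF z(2)] using moebius_sum_tail[OF pos, of N] N by (intro mult_right_mono) auto
        also have "\<dots> = 2 / R\<^sup>2" using pos N by (simp add: powr_minus field_simps)
        finally show ?thesis .
      qed
    qed
    have GS_int: "norm (contour_integral \<gamma> G - contour_integral \<gamma> S) \<le> 2 / R\<^sup>2 * R * (pi/2)"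
      if "\<gamma> = ?A1 \<or> \<gamma> = ?A3" for \<gamma>
    proof -
      have i: "G contour_integrable_on \<gamma>" "S contour_integrable_on \<gamma>"
        using that intG[of \<gamma>] arcV intS by auto
      then have "contour_integral \<gamma> G - contour_integral \<gamma> S = contour_integral \<gamma> (\<lambda>z. G z - S z)"
        by (simp add: contour_integral_diff)
      moreover have "norm (contour_integral (part_circlepath 0 R x y) (\<lambda>z. G z - S z)) \<le> 2 / R\<^sup>2 * R * \<bar>y - x\<bar>"
        if "\<gamma> = part_circlepath 0 R x y" "\<gamma> = ?A1 \<or> \<gamma> = ?A3" for x y
        using that i GS \<open>R > 0\<close> by (intro contour_integral_bound_part_circlepath contour_integrable_diff) auto
      from this[of 0 "pi/2"] this[of "3*pi/2" "2*pi"] that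
      have "norm (contour_integral \<gamma> (\<lambda>z. G z - S z)) \<le> 2 / R\<^sup>2 * R * (pi/2)"
        by (auto simp: field_simps)
      ultimately show ?thesis by simp
    qed
    have arcsGS: "norm (arcs G - arcs S) \<le> 2 * pi / R"
    proof -
      have "arcs G - arcs S = (contour_integral ?A1 G - contour_integral ?A1 S) + (contour_integral ?A3 G - contour_integral ?A3 S)"
        by (simp add: arcs_def)
      then have "norm (arcs G - arcs S) \<le> 2 / R\<^sup>2 * R * (pi/2) + 2 / R\<^sup>2 * R * (pi/2)"
        using norm_triangle_le[OF add_mono[OF GS_int GS_int]] by metis
      also have "\<dots> = 2 * pi / R" using \<open>R > 0\<close> by (simp add: field_simps power2_eq_square)
      finally show ?thesis .
    qed
    \<comment> \<open>The partial sum is entire, so for \<open>S\<close> the circle is completed by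
      the left semicircle instead of the rectangle. There the powers \<open>N powr y\<close> and
      \<open>N powr (-y)\<close> cancel.\<close>
    have leftS: "norm (contour_integral ?A2 S) \<le> 4 * pi / R"
    proof -
      have "norm (S z) \<le> 4 / R\<^sup>2" if "z \<in> path_image ?A2" for z
      proof -
        have z: "Re z \<le> 0" "norm z = R" using left[OF that] by auto
        show ?thesis
        proof (cases "Re z = 0")
          case True
          then have "norm (k z) = 0" using nk[OF z(2)] by simp
          then show ?thesis unfolding S_def by simp
        next
          case False
          define y where "y = - Re z"
          have y: "y > 0" "y \<le> R" using z False abs_Re_le_cmod[of z] by (auto simp: y_def)
          have "norm (S z) \<le> (real N powr y / y + real N powr (y - 1)) * (real N powr (-y) * (2 * y / R\<^sup>2))"
          proof -
            have "norm (moebius_sum N z) \<le> real N powr y / y + real N powr (y - 1)"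
              using norm_moebius_sum_le[of z N] N y by (simp add: y_def)
            moreover have "norm (k z) = real N powr (-y) * (2 * y / R\<^sup>2)"
              using nk[OF z(2)] y by (simp add: y_def)
            ultimately show ?thesis unfolding S_def norm_mult using y by (simp only:) (intro mult_right_mono, auto)
          qed
          also have "\<dots> = 2 / R\<^sup>2 + 2 * (y / real N) / R\<^sup>2"
            using y N \<open>R > 0\<close> by (simp add: powr_minus powr_diff field_simps)
          also have "\<dots> \<le> 4 / R\<^sup>2"
          proof -
            \<comment> \<open>The radius bounds y, so N \<ge> R absorbs the extra summand of
              \<open>sum_powr_le\<close>.\<close>
            have "y / real N \<le> 1" using y NR N by simp
            then have "2 * (y / real N) / R\<^sup>2 \<le> 2 * 1 / R\<^sup>2" by (intro divide_right_mono) auto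
            then show ?thesis by (simp add: field_simps)
          qed
          finally show ?thesis .
        qed
      qed
      then have "norm (contour_integral ?A2 S) \<le> 4 / R\<^sup>2 * R * \<bar>3*pi/2 - pi/2\<bar>"
        using \<open>R > 0\<close> by (intro contour_integral_bound_part_circlepath intS) auto
      also have "\<dots> = 4 * pi / R" using \<open>R > 0\<close> by (simp add: field_simps power2_eq_square)
      finally show ?thesis .
    qed
    \<comment> \<open>Cauchy's formula at 0, since the kernel is (1 + z^2 / R^2) / z.\<close>
    have full: "contour_integral (circlepath 0 R) S = 2 * of_real pi * \<i> * moebius_sum N 0"
    proof -
      define F where "F z = moebius_sum N z * of_nat N powr z * (1 + z\<^sup>2 / (of_real R)\<^sup>2)" for z
      have "F holomorphic_on cball 0 R"
        unfolding F_def using N \<open>R > 0\<close> by (intro holomorphic_intros moebius_sum_holomorphic) auto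
      then have "((\<lambda>u. F u / (u - 0)) has_contour_integral 2 * of_real pi * \<i> * F 0) (circlepath 0 R)"
        using \<open>R > 0\<close> by (intro Cauchy_integral_circlepath_simple) auto
      moreover have "F 0 = moebius_sum N 0" using N by (simp add: F_def)
      ultimately have "((\<lambda>u. F u / u) has_contour_integral 2 * of_real pi * \<i> * moebius_sum N 0) (circlepath 0 R)"
        by simp
      then have "(S has_contour_integral 2 * of_real pi * \<i> * moebius_sum N 0) (circlepath 0 R)"
      proof (rule has_contour_integral_eq)
        fix z assume "z \<in> path_image (circlepath 0 R)"
        then have "z \<noteq> 0" using \<open>R > 0\<close> by auto
        then show "F z / z = S z" using \<open>R > 0\<close> unfolding F_def S_def k_def by (simp add: field_simps power2_eq_square)
      qed
      then show ?thesis by (rule contour_integral_unique)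
    qed
    have "2 * of_real pi * \<i> * moebius_sum N 0 = arcs S + contour_integral ?A2 S"
      using contour_integral_circlepath_split[OF contS \<open>R > 0\<close>] full by (simp add: arcs_def)
    also have "\<dots> = arcs G - (arcs G - arcs S) + contour_integral ?A2 S" by simp
    finally have "norm (2 * of_real pi * \<i> * moebius_sum N 0) \<le> norm (arcs G) + norm (arcs G - arcs S) + norm (contour_integral ?A2 S)"
      using norm_triangle_ineq[of "arcs G - (arcs G - arcs S)" "contour_integral ?A2 S"]
        norm_triangle_ineq4[of "arcs G" "arcs G - arcs S"] by (simp only:)
    \<comment> \<open>Dividing 3 + 6 pi by 2 pi gives less than 8, the constant of the
      statement.\<close>
    also have "\<dots> \<le> 3 / R + 2 * pi / R + 4 * pi / R" by (intro add_mono arcsG arcsGS leftS)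
    finally have "2 * pi * norm (moebius_sum N 0) \<le> (3 + 6 * pi) / R"
      by (simp add: norm_mult add_divide_distrib)
    also have "\<dots> \<le> (2 * pi) * 8 / R" using pi_gt3 \<open>R > 0\<close> by (intro divide_right_mono) auto
    finally have "(2 * pi) * norm (moebius_sum N 0) \<le> (2 * pi) * (8 / R)" by simp
    then show ?case using pi_gt_zero by (subst (asm) mult_le_cancel_left_pos) auto
  qed
qed

section \<open>From the logarithmic mean to the ordinary mean\<close>

lemma moebius_sum_over_n_tendsto: "(\<lambda>N. \<Sum>n=1..N. moebius n / of_nat n) \<longlonglongrightarrow> 0"
proof -
  have eq: "moebius_sum N 0 = (\<Sum>n=1..N. moebius n / of_nat n)" for N
    unfolding moebius_sum_def by (intro sum.cong) (auto simp: powr_minus field_simps)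
  have "(\<lambda>N. moebius_sum N 0) \<longlonglongrightarrow> 0"
  proof (rule tendstoI)
    fix e :: real assume e: "e > 0"
    define R where "R = max 1 (9 / e)"
    have "R \<ge> 1" "8 / R < e" using e by (auto simp: R_def field_simps max_def)
    with moebius_sum_0_bound[OF \<open>R \<ge> 1\<close>] show "\<forall>\<^sub>F N in sequentially. dist (moebius_sum N 0) 0 < e"
      by (auto elim!: eventually_mono)
  qed
  then show ?thesis by (simp add: eq)
qed

lemma cesaro_null:
  fixes f :: "nat \<Rightarrow> 'a::real_normed_vector"
  assumes "f \<longlonglongrightarrow> 0"
  shows "(\<lambda>N. (\<Sum>n<N. f n) /\<^sub>R real N) \<longlonglongrightarrow> 0"
proof (rule tendstoI)
  fix e :: real assume e: "e > 0"
  obtain K where K: "\<And>n. n \<ge> K \<Longrightarrow> norm (f n) < e / 2"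
    using LIMSEQ_D[OF assms, of "e/2"] e by auto
  define C where "C = (\<Sum>n<K. norm (f n))"
  have "(\<lambda>N. C / real N) \<longlonglongrightarrow> 0" by (rule lim_const_over_n)
  then have "\<forall>\<^sub>F N in sequentially. C / real N < e / 2" using e by (intro order_tendstoD) auto
  moreover have "\<forall>\<^sub>F N in sequentially. N \<ge> max K 1" by (rule eventually_ge_at_top)
  ultimately show "\<forall>\<^sub>F N in sequentially. dist ((\<Sum>n<N. f n) /\<^sub>R real N) 0 < e"
  proof eventually_elim
    case (elim N)
    have "norm (\<Sum>n<N. f n) \<le> (\<Sum>n<N. norm (f n))" by (rule norm_sum)
    also have "(\<Sum>n<N. norm (f n)) = C + (\<Sum>n\<in>{K..<N}. norm (f n))"
      unfolding C_def using elim
      by (subst sum.union_disjoint[symmetric]) (auto intro!: sum.cong)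
    also have "(\<Sum>n\<in>{K..<N}. norm (f n)) \<le> (\<Sum>n\<in>{K..<N}. e / 2)" by (intro sum_mono order.strict_implies_order[OF K]) auto
    also have "\<dots> \<le> real N * (e / 2)" using e by (simp add: mult_right_mono)
    finally have "norm (\<Sum>n<N. f n) / real N \<le> C / real N + e / 2"
      using elim by (simp add: field_simps)
    moreover have "dist ((\<Sum>n<N. f n) /\<^sub>R real N) 0 = norm (\<Sum>n<N. f n) / real N"
      by (simp only: dist_norm diff_zero norm_scaleR) (simp add: divide_inverse)
    ultimately show ?case using elim by linarith
  qed
qed

text \<open>Summation by parts from the previous limit: the ordinary mean is the logarithmic sum at
  N minus the average of the earlier ones, and the Cesaro means of a null sequence tend to
  0.\<close>

lemma mertens_little_o: "(\<lambda>N. (\<Sum>n=1..N. moebius n) / of_nat N) \<longlonglongrightarrow> 0"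
proof -
  define s where "s N = (\<Sum>n=1..N. moebius n / of_nat n)" for N
  have s: "s \<longlonglongrightarrow> 0" using moebius_sum_over_n_tendsto by (simp add: s_def[abs_def])
  have eq: "(\<Sum>n=1..N. moebius n) = of_nat N * s N - (\<Sum>n<N. s n)" for N
  proof (induction N)
    case (Suc N)
    have "of_nat (Suc N) * s (Suc N) = of_nat (Suc N) * s N + moebius (Suc N)"
      using of_nat_neq_0[of N, where 'a=complex] by (simp add: s_def distrib_left del: of_nat_Suc)
    then show ?case using Suc by (simp add: algebra_simps)
  qed (simp add: s_def)
  have "(\<lambda>N. s N - (\<Sum>n<N. s n) /\<^sub>R real N) \<longlonglongrightarrow> 0 - 0"
    by (intro tendsto_diff s cesaro_null)
  moreover have "\<forall>\<^sub>F N in sequentially. s N - (\<Sum>n<N. s n) /\<^sub>R real N = (\<Sum>n=1..N. moebius n) / of_nat N"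
    using eventually_gt_at_top[of "0::nat"]
    by eventually_elim (subst eq, simp add: scaleR_conv_of_real field_simps)
  ultimately show ?thesis by (simp add: tendsto_cong)
qed

section \<open>The Katai-Bourgain-Sarnak-Ziegler criterion\<close>

lemma sum_multiples:
  fixes f :: "nat \<Rightarrow> 'a::comm_monoid_add"
  assumes "d > 0"
  shows "(\<Sum>n=1..N. if d dvd n then f n else 0) = (\<Sum>m=1..N div d. f (d * m))"
proof -
  have "{n\<in>{1..N}. d dvd n} = (*) d ` {1..N div d}"
  proof (intro equalityI subsetI)
    fix n assume n: "n \<in> {n\<in>{1..N}. d dvd n}"
    then obtain m where m: "n = d * m" by auto
    then have "m \<in> {1..N div d}"
      using n assms by (auto simp: less_eq_div_iff_mult_less_eq mult.commute Suc_le_eq)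
    then show "n \<in> (*) d ` {1..N div d}" using m by auto
  qed (use assms in \<open>auto simp: less_eq_div_iff_mult_less_eq mult.commute Suc_le_eq\<close>)
  then have "(\<Sum>n\<in>{n\<in>{1..N}. d dvd n}. f n) = (\<Sum>m=1..N div d. f (d * m))"
    using assms by (simp add: sum.reindex inj_on_def)
  then show ?thesis by (simp only: sum.inter_filter[OF finite_atLeastAtMost])
qed

lemma sum_of_bool_multiples:
  assumes "d > 0"
  shows "(\<Sum>n=1..N. of_bool (d dvd n)) = real (N div d)"
  using sum_multiples[OF assms, where N = N and f = "\<lambda>_. 1::real"] by (simp add: of_bool_def)

text \<open>Multiplicativity with a correction term, so that it holds for every m > 0. The
  correction lives on multiples of q^2; over all primes this costs at most N because the reciprocal
  squares of primes sum to at most 1.\<close>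

lemma moebius_prime_mult:
  assumes q: "prime q" and m: "m > 0"
  shows "moebius (q * m) = - moebius m + (if q dvd m then moebius m else 0)"
proof (cases "q dvd m")
  case True
  then have "q\<^sup>2 dvd q * m" by (simp add: power2_eq_square mult_dvd_mono)
  then have "\<not> squarefree (q * m)" using q unfolding squarefree_def by (metis not_prime_unit)
  then show ?thesis using True by (simp add: moebius_def)
next
  case False
  then have cop: "coprime q m" using q by (simp add: prime_imp_coprime)
  have "squarefree (q * m) \<longleftrightarrow> squarefree m"
    using squarefree_mult_coprime[OF cop] squarefree_multD[of q m] squarefree_prime[OF q] by blast
  moreover have "prime_factors (q * m) = insert q (prime_factors m)"
    using q m prime_gt_0_nat[OF q] by (simp add: prime_factors_product prime_prime_factors)
  moreover have "q \<notin> prime_factors m" using False by (auto simp: prime_factors_dvd)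
  moreover have "q > 0" using q by (rule prime_gt_0_nat)
  ultimately show ?thesis using m False by (simp add: moebius_def)
qed

section \<open>Reciprocals of primes and of their squares\<close>

lemma sum_inverse_squares_le: "(\<Sum>k=2..K. 1 / (real k)\<^sup>2) \<le> 1"
proof -
  have "(\<Sum>k=2..Suc K. 1 / (real k)\<^sup>2) \<le> 1 - 1 / real (Suc K)" for K
  proof (induction K)
    case (Suc K)
    have "1 / (x + 1)\<^sup>2 \<le> 1 / x - 1 / (x + 1)" if "x > 0" for x :: real
    proof -
      have "x * (x + 1) \<le> (x + 1)\<^sup>2" using that by (simp add: power2_eq_square algebra_simps)
      then have "1 / (x + 1)\<^sup>2 \<le> 1 / (x * (x + 1))" using that by (intro divide_left_mono) auto
      also have "\<dots> = 1 / x - 1 / (x + 1)" using that by (simp add: field_simps)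
      finally show ?thesis .
    qed
    from this[of "real (Suc K)"] have "1 / (real (Suc (Suc K)))\<^sup>2 \<le> 1 / real (Suc K) - 1 / real (Suc (Suc K))"
      by (simp add: add.commute)
    moreover have "(\<Sum>k=2..Suc (Suc K). 1 / (real k)\<^sup>2) = (\<Sum>k=2..Suc K. 1 / (real k)\<^sup>2) + 1 / (real (Suc (Suc K)))\<^sup>2"
      by simp
    ultimately show ?case using Suc by linarith
  qed simp
  from this[of K] have "(\<Sum>k=2..Suc K. 1 / (real k)\<^sup>2) \<le> 1"
    by (smt (verit) divide_nonneg_nonneg of_nat_0_le_iff)
  moreover have "(\<Sum>k=2..K. 1 / (real k)\<^sup>2) \<le> (\<Sum>k=2..Suc K. 1 / (real k)\<^sup>2)"
    by (intro sum_mono2) auto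
  ultimately show ?thesis by linarith
qed

lemma sum_inverse_square_primes_le:
  assumes "finite P" "\<And>q. q \<in> P \<Longrightarrow> prime (q::nat)"
  shows "(\<Sum>q\<in>P. 1 / (real q)\<^sup>2) \<le> 1"
proof -
  obtain K where "P \<subseteq> {..K}" using assms(1) finite_nat_iff_bounded_le by auto
  then have "P \<subseteq> {2..K}" using assms(2) prime_ge_2_nat by (auto simp: subset_iff)
  then have "(\<Sum>q\<in>P. 1 / (real q)\<^sup>2) \<le> (\<Sum>q=2..K. 1 / (real q)\<^sup>2)" by (intro sum_mono2) auto
  then show ?thesis using sum_inverse_squares_le[of K] by linarith
qed

text \<open>Erdos' argument: if the primes outside \<open>P\<^sub>0\<close> have reciprocal sum at most 1/2, then half of the
  integers up to \<open>N\<close> are a square times a product of distinct elements of \<open>P\<^sub>0\<close>.\<close>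
lemma prime_reciprocals_unbounded:
  "\<exists>P. finite P \<and> (\<forall>q\<in>P. prime (q::nat)) \<and> (\<Sum>q\<in>P. 1 / real q) \<ge> C"
proof (rule ccontr)
  assume neg: "\<not> ?thesis"
  define PP where "PP = {P. finite P \<and> (\<forall>q\<in>P. prime (q::nat))}"
  define W where "W P = (\<Sum>q\<in>P. 1 / real q)" for P
  have bdd: "bdd_above (W ` PP)"
    using neg by (intro bdd_aboveI[of _ C]) (auto simp: PP_def W_def not_le intro: less_imp_le)
  have "{} \<in> PP" by (simp add: PP_def)
  \<comment> \<open>Within 1/2 of the supremum, so that every finite set of primes disjoint from
    \<open>P0\<close> has reciprocal sum at most 1/2.\<close>
  then obtain P0 where P0: "P0 \<in> PP" "W P0 > (SUP P\<in>PP. W P) - 1/2"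
    using less_cSUP_iff[of PP W "(SUP P\<in>PP. W P) - 1/2"] bdd by force
  have tail: "W P \<le> 1/2" if P: "P \<in> PP" "P \<inter> P0 = {}" for P
  proof -
    have "P \<union> P0 \<in> PP" using P P0 by (auto simp: PP_def)
    then have "W (P \<union> P0) \<le> (SUP P\<in>PP. W P)" using bdd by (rule cSUP_upper)
    moreover have "W (P \<union> P0) = W P + W P0"
      unfolding W_def using P P0 by (intro sum.union_disjoint) (auto simp: PP_def)
    ultimately show ?thesis using P0(2) by linarith
  qed
  define k where "k = card P0"
  \<comment> \<open>At most N/2 integers up to N = L^2 have a prime factor outside
    \<open>P0\<close>, and at most 2^k L have none. With L = 2^(k + 2) the latter number is N/4,
    which leaves N/4 integers unaccounted for.\<close>
  define L :: nat where "L = 2 ^ (k + 2)"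
  define N where "N = L\<^sup>2"
  define P where "P = {q. prime q \<and> q \<le> N} - P0"
  have "finite P" unfolding P_def by (rule finite_subset[of _ "{..N}"]) auto
  then have P: "P \<in> PP" by (auto simp: PP_def P_def)
  define A where "A = {n\<in>{1..N}. \<exists>q\<in>P. q dvd n}"
  define B where "B = {n\<in>{1..N}. prime_factors n \<subseteq> P0}"
  have "{1..N} \<subseteq> A \<union> B"
  proof
    fix n assume n: "n \<in> {1..N}"
    show "n \<in> A \<union> B"
    proof (cases "prime_factors n \<subseteq> P0")
      case False
      then obtain q where q: "q \<in> prime_factors n" "q \<notin> P0" by auto
      then have "prime q" "q dvd n" by (auto simp: prime_factors_dvd)
      moreover have "q \<le> n" using \<open>q dvd n\<close> n by (intro dvd_imp_le) auto
      ultimately have "q \<in> P" using q n by (auto simp: P_def)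
      then show ?thesis using n \<open>q dvd n\<close> by (auto simp: A_def)
    qed (use n in \<open>auto simp: B_def\<close>)
  qed
  then have "card {1..N} \<le> card (A \<union> B)" by (intro card_mono) (auto simp: A_def B_def)
  then have NAB: "N \<le> card A + card B" using card_Un_le[of A B] by simp
  have "real (card A) \<le> real N / 2"
  proof -
    have "real (card A) = (\<Sum>n=1..N. of_bool (\<exists>q\<in>P. q dvd n))" by (simp add: A_def Int_def)
    also have "\<dots> \<le> (\<Sum>n=1..N. \<Sum>q\<in>P. of_bool (q dvd n))"
    proof (rule sum_mono)
      fix n
      show "(of_bool (\<exists>q\<in>P. q dvd n) :: real) \<le> (\<Sum>q\<in>P. of_bool (q dvd n))"
      proof (cases "\<exists>q\<in>P. q dvd n")
        case True
        then obtain q where "q \<in> P" "q dvd n" by auto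
        then show ?thesis using member_le_sum[of q P "\<lambda>q. of_bool (q dvd n) :: real"] \<open>finite P\<close> by simp
      qed (simp add: sum_nonneg)
    qed
    also have "\<dots> = (\<Sum>q\<in>P. \<Sum>n=1..N. of_bool (q dvd n))" by (rule sum.swap)
    also have "\<dots> = (\<Sum>q\<in>P. real (N div q))"
      by (intro sum.cong refl sum_of_bool_multiples) (auto simp: P_def prime_gt_0_nat)
    also have "\<dots> \<le> (\<Sum>q\<in>P. real N * (1 / real q))"
      by (intro sum_mono) (simp add: of_nat_div_le_of_nat)
    also have "\<dots> = real N * W P" by (simp add: W_def sum_distrib_left)
    also have "\<dots> \<le> real N * (1/2)" using tail[OF P] by (intro mult_left_mono) (auto simp: P_def)
    finally show ?thesis by simp
  qed
  moreover have "card B \<le> 2 ^ k * L"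
  proof -
    define g where "g n = (prime_factors (squarefree_part n), square_part n)" for n :: nat
    have fP0: "finite P0" using P0 by (simp add: PP_def)
    have "inj_on g B"
    proof (rule inj_onI)
      fix m n assume mn: "m \<in> B" "n \<in> B" and eq: "g m = g n"
      have e: "prime_factors (squarefree_part m) = prime_factors (squarefree_part n)" "square_part m = square_part n"
        using eq unfolding g_def prod.inject by blast+
      have "\<Prod>(prime_factors (squarefree_part k)) = squarefree_part k" for k :: nat
        by (rule prod_prime_factors_squarefree) (rule squarefree_squarefree_part)
      then have "squarefree_part m = squarefree_part n" using e(1) by metis
      then show "m = n" using e(2) squarefree_decompose[of m] squarefree_decompose[of n] by metis
    qed
    moreover have "g ` B \<subseteq> Pow P0 \<times> {1..L}"
    proof safe
      fix n A' l assume n: "n \<in> B" and g: "(A', l) = g n"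
      have n0: "n > 0" "n \<le> N" "prime_factors n \<subseteq> P0" using n by (auto simp: B_def)
      have dec: "n = squarefree_part n * (square_part n)\<^sup>2" by (rule squarefree_decompose)
      have "squarefree_part n dvd n" using dec by (metis dvd_triv_left)
      then have "prime_factors (squarefree_part n) \<subseteq> prime_factors n" using n0 by (intro dvd_prime_factors) auto
      then show "\<And>x. x \<in> A' \<Longrightarrow> x \<in> P0" using g n0 by (auto simp: g_def)
      have "(square_part n)\<^sup>2 dvd n" using dec by (metis dvd_triv_right)
      then have "(square_part n)\<^sup>2 \<le> n" using n0 by (intro dvd_imp_le) auto
      then have "(square_part n)\<^sup>2 \<le> L\<^sup>2" using n0(2) unfolding N_def by (rule le_trans)
      then have "square_part n \<le> L" by (simp only: power2_nat_le_eq_le)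
      moreover have "1 \<le> square_part n"
        using dec n0(1) by (metis One_nat_def Suc_leI mult_zero_right power_zero_numeral neq0_conv)
      ultimately show "l \<in> {1..L}" using g unfolding g_def by (simp only: prod.inject atLeastAtMost_iff)
    qed
    ultimately have "card B \<le> card (Pow P0 \<times> {1..L})" using fP0 by (intro card_inj_on_le[of g]) auto
    also have "\<dots> = 2 ^ k * L" using fP0 by (simp add: card_cartesian_product card_Pow k_def)
    finally show ?thesis .
  qed
  ultimately have "real N \<le> real N / 2 + real (2 ^ k * L)"
    using NAB by (smt (verit) of_nat_add of_nat_mono)
  then have "real N \<le> 2 * real (2 ^ k * L)" by simp
  then have "N \<le> 2 * (2 ^ k * L)" by linarith
  then have "L * L \<le> (2 * 2 ^ k) * L" by (simp add: N_def power2_eq_square)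
  moreover have "2 * 2 ^ k < L" by (simp add: L_def)
  ultimately show False by (simp add: L_def)
qed

text \<open>Second moment of the number of prime divisors in \<open>P\<close>: on expanding the
  square the terms N W^2 cancel and the diagonal leaves N W. The last term comes from rounding N / q
  down in the cross term.\<close>

lemma turan_kubilius:
  assumes "finite P" "\<And>q. q \<in> P \<Longrightarrow> prime (q::nat)"
  defines "W \<equiv> (\<Sum>q\<in>P. 1 / real q)"
  shows "(\<Sum>n=1..N. ((\<Sum>q\<in>P. of_bool (q dvd n)) - W)\<^sup>2) \<le> real N * W + 2 * W * real (card P)"
proof -
  define w where "w n = (\<Sum>q\<in>P. of_bool (q dvd n) :: real)" for n
  have W0: "W \<ge> 0" by (simp add: W_def sum_nonneg)
  have pos: "q > 0" if "q \<in> P" for q using assms(2)[OF that] by (rule prime_gt_0_nat)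
  have w2: "(\<Sum>n=1..N. (w n)\<^sup>2) \<le> real N * W\<^sup>2 + real N * W"
  proof -
    have "(\<Sum>n=1..N. (w n)\<^sup>2) = (\<Sum>n=1..N. \<Sum>q\<in>P. \<Sum>r\<in>P. of_bool (q dvd n) * of_bool (r dvd n))"
      by (simp add: w_def power2_eq_square sum_product)
    also have "\<dots> = (\<Sum>q\<in>P. \<Sum>n=1..N. \<Sum>r\<in>P. of_bool (q dvd n) * of_bool (r dvd n))" by (rule sum.swap)
    also have "\<dots> = (\<Sum>q\<in>P. \<Sum>r\<in>P. \<Sum>n=1..N. of_bool (q dvd n) * of_bool (r dvd n))"
      by (intro sum.cong refl sum.swap)
    also have "\<dots> \<le> (\<Sum>q\<in>P. \<Sum>r\<in>P. real N * (1 / real q * (1 / real r)) + (if r = q then real N * (1 / real q) else 0))"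
    proof (intro sum_mono)
      fix q r assume q: "q \<in> P" and r: "r \<in> P"
      show "(\<Sum>n=1..N. of_bool (q dvd n) * of_bool (r dvd n)) \<le> real N * (1 / real q * (1 / real r)) + (if r = q then real N * (1 / real q) else 0)"
      proof (cases "r = q")
        case True
        have "(\<Sum>n=1..N. of_bool (q dvd n) * of_bool (r dvd n)) = (\<Sum>n=1..N. of_bool (q dvd n) :: real)"
          using True by (intro sum.cong) auto
        also have "\<dots> \<le> real N * (1 / real q)"
          unfolding sum_of_bool_multiples[OF pos[OF q]] by (simp add: of_nat_div_le_of_nat)
        finally show ?thesis using True by (smt (verit) divide_nonneg_nonneg mult_nonneg_nonneg of_nat_0_le_iff)
      next
        case False
        have "coprime q r" using primes_coprime[OF assms(2)[OF q] assms(2)[OF r]] False by auto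
        then have "q dvd n \<and> r dvd n \<longleftrightarrow> q * r dvd n" for n
          by (meson divides_mult dvd_mult_left dvd_mult_right)
        then have "(\<Sum>n=1..N. of_bool (q dvd n) * of_bool (r dvd n)) = (\<Sum>n=1..N. of_bool (q * r dvd n) :: real)"
          by (intro sum.cong) (auto simp flip: of_bool_conj)
        also have "\<dots> \<le> real N / real (q * r)"
          using sum_of_bool_multiples[of "q * r" N] pos[OF q] pos[OF r] by (simp add: of_nat_div_le_of_nat del: of_nat_mult)
        finally show ?thesis using False by simp
      qed
    qed
    also have "\<dots> = real N * W\<^sup>2 + real N * W"
    proof -
      have "(\<Sum>q\<in>P. \<Sum>r\<in>P. (if r = q then real N * (1 / real q) else 0)) = real N * W"
        using assms(1) by (simp add: W_def sum_distrib_left)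
      moreover have "(\<Sum>q\<in>P. \<Sum>r\<in>P. real N * (1 / real q * (1 / real r))) = real N * W\<^sup>2"
        unfolding W_def power2_eq_square sum_product by (simp add: sum_distrib_left)
      ultimately show ?thesis by (simp only: sum.distrib)
    qed
    finally show ?thesis .
  qed
  have w1: "(\<Sum>n=1..N. w n) \<ge> real N * W - real (card P)"
  proof -
    have "(\<Sum>n=1..N. w n) = (\<Sum>q\<in>P. \<Sum>n=1..N. of_bool (q dvd n))" unfolding w_def by (rule sum.swap)
    also have "\<dots> = (\<Sum>q\<in>P. real (N div q))" by (intro sum.cong refl sum_of_bool_multiples pos)
    also have "\<dots> \<ge> (\<Sum>q\<in>P. real N * (1 / real q) - 1)"
    proof (rule sum_mono)
      fix q assume "q \<in> P"
      then show "real N * (1 / real q) - 1 \<le> real (N div q)"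
        using real_of_int_floor_gt_diff_one[of "real N / real q"] by (simp add: floor_divide_of_nat_eq)
    qed
    also have "(\<Sum>q\<in>P. real N * (1 / real q) - 1) = real N * W - real (card P)"
      by (simp add: sum_subtractf W_def sum_distrib_left)
    finally show ?thesis .
  qed
  have "(\<Sum>n=1..N. (w n - W)\<^sup>2) = (\<Sum>n=1..N. (w n)\<^sup>2 - 2 * W * w n + W\<^sup>2)"
    by (intro sum.cong refl) (simp add: power2_eq_square algebra_simps)
  also have "\<dots> = (\<Sum>n=1..N. (w n)\<^sup>2) - 2 * W * (\<Sum>n=1..N. w n) + real N * W\<^sup>2"
    by (simp add: sum.distrib sum_subtractf sum_distrib_left)
  also have "\<dots> \<le> (real N * W\<^sup>2 + real N * W) - 2 * W * (real N * W - real (card P)) + real N * W\<^sup>2"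
    using w2 mult_left_mono[OF w1, of "2 * W"] W0 by linarith
  also have "\<dots> = real N * W + 2 * W * real (card P)" by (simp add: power2_eq_square algebra_simps)
  finally show ?thesis by (simp add: w_def)
qed

section \<open>Cauchy-Schwarz and the bilinear sum\<close>

lemma sum_abs_le_sqrt:
  fixes x :: "'i \<Rightarrow> real"
  assumes "(\<Sum>i\<in>I. (x i)\<^sup>2) \<le> B"
  shows "(\<Sum>i\<in>I. \<bar>x i\<bar>) \<le> sqrt (real (card I) * B)"
proof (rule real_le_rsqrt)
  have "(\<Sum>i\<in>I. \<bar>x i\<bar>)\<^sup>2 \<le> (\<Sum>i\<in>I. \<bar>x i\<bar>\<^sup>2) * real (card I)"
    by (rule sum_squared_le_sum_of_squares)
  also have "\<dots> \<le> B * real (card I)" using assms by (intro mult_right_mono) auto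
  finally show "(\<Sum>i\<in>I. \<bar>x i\<bar>)\<^sup>2 \<le> real (card I) * B" by (simp add: mult.commute)
qed

text \<open>The weight W is replaced by the number of prime divisors of n in \<open>P\<close>, which
  costs the first term (Turan-Kubilius). Writing n = q m, multiplicativity moves
  \<open>moebius\<close> to m; the m divisible by q give the term N. Cauchy-Schwarz in m then
  removes \<open>moebius\<close>, and the square leaves the diagonal N W and the
  correlations.\<close>

lemma bilinear_bound:
  fixes A :: "nat \<Rightarrow> real"
  assumes P: "finite P" "\<And>q. q \<in> P \<Longrightarrow> prime (q::nat)" and A: "\<And>n. \<bar>A n\<bar> \<le> 1"
  defines "W \<equiv> (\<Sum>q\<in>P. 1 / real q)"
  shows "W * norm (\<Sum>n=1..N. of_real (A n) * moebius n) \<le>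
    sqrt (real N * (real N * W + 2 * W * real (card P))) + real N
    + sqrt (real N * (real N * W + (\<Sum>q\<in>P. \<Sum>r\<in>P-{q}. \<Sum>m=1..N div max q r. A (q * m) * A (r * m))))"
proof -
  define w where "w n = (\<Sum>q\<in>P. of_bool (q dvd n) :: real)" for n
  define Y where "Y m = (\<Sum>q\<in>P. if q * m \<le> N then A (q * m) else 0)" for m
  have W0: "W \<ge> 0" by (simp add: W_def sum_nonneg)
  have pos: "q > 0" if "q \<in> P" for q using P(2)[OF that] by (rule prime_gt_0_nat)
  have AM: "norm (of_real (A n) * moebius m) \<le> 1" for n m
    unfolding norm_mult using A[of n] norm_moebius_le[of m] by (simp add: mult_le_one)
  have main: "(\<Sum>n=1..N. of_real (w n) * (of_real (A n) * moebius n)) =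
      (\<Sum>q\<in>P. \<Sum>m=1..N div q. if q dvd m then of_real (A (q * m)) * moebius m else 0) - (\<Sum>m=1..N. of_real (Y m) * moebius m)"
  proof -
    have "(\<Sum>n=1..N. of_real (w n) * (of_real (A n) * moebius n)) =
        (\<Sum>n=1..N. \<Sum>q\<in>P. if q dvd n then of_real (A n) * moebius n else 0)"
      by (intro sum.cong refl) (auto simp: w_def sum_distrib_right intro!: sum.cong)
    also have "\<dots> = (\<Sum>q\<in>P. \<Sum>n=1..N. if q dvd n then of_real (A n) * moebius n else 0)" by (rule sum.swap)
    also have "\<dots> = (\<Sum>q\<in>P. \<Sum>m=1..N div q. of_real (A (q * m)) * moebius (q * m))"
      by (intro sum.cong refl sum_multiples pos)
    also have "\<dots> = (\<Sum>q\<in>P. \<Sum>m=1..N div q. (if q dvd m then of_real (A (q * m)) * moebius m else 0) - of_real (A (q * m)) * moebius m)"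
      by (intro sum.cong refl) (auto simp: moebius_prime_mult P(2))
    also have "\<dots> = (\<Sum>q\<in>P. \<Sum>m=1..N div q. if q dvd m then of_real (A (q * m)) * moebius m else 0)
        - (\<Sum>q\<in>P. \<Sum>m=1..N div q. of_real (A (q * m)) * moebius m)"
      by (simp add: sum_subtractf)
    also have "(\<Sum>q\<in>P. \<Sum>m=1..N div q. of_real (A (q * m)) * moebius m) =
       (\<Sum>q\<in>P. \<Sum>m=1..N. if q * m \<le> N then of_real (A (q * m)) * moebius m else 0)"
    proof (rule sum.cong[OF refl])
      fix q assume q: "q \<in> P"
      have "{1..N div q} = {m\<in>{1..N}. q * m \<le> N}"
      proof -
        have "m \<le> N" if "q * m \<le> N" for m using that pos[OF q] by (metis le_trans mult_le_mono1 nat_mult_1 Suc_leI One_nat_def)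
        then show ?thesis using pos[OF q] by (auto simp: less_eq_div_iff_mult_less_eq mult.commute)
      qed
      then show "(\<Sum>m=1..N div q. of_real (A (q * m)) * moebius m) = (\<Sum>m=1..N. if q * m \<le> N then of_real (A (q * m)) * moebius m else 0)"
        by (simp only: sum.inter_filter[OF finite_atLeastAtMost])
    qed
    also have "\<dots> = (\<Sum>m=1..N. \<Sum>q\<in>P. if q * m \<le> N then of_real (A (q * m)) * moebius m else 0)" by (rule sum.swap)
    also have "\<dots> = (\<Sum>m=1..N. of_real (Y m) * moebius m)"
      by (intro sum.cong refl) (auto simp: Y_def sum_distrib_right intro!: sum.cong)
    finally show ?thesis .
  qed
  have t1: "norm (\<Sum>q\<in>P. \<Sum>m=1..N div q. if q dvd m then of_real (A (q * m)) * moebius m else 0) \<le> real N"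
  proof -
    have "norm (\<Sum>q\<in>P. \<Sum>m=1..N div q. if q dvd m then of_real (A (q * m)) * moebius m else 0) \<le>
       (\<Sum>q\<in>P. \<Sum>m=1..N div q. of_bool (q dvd m))"
      by (intro sum_norm_le) (use AM in auto)
    also have "\<dots> = (\<Sum>q\<in>P. real (N div q div q))" by (intro sum.cong refl sum_of_bool_multiples pos)
    also have "\<dots> \<le> (\<Sum>q\<in>P. real N * (1 / (real q)\<^sup>2))"
    proof (rule sum_mono)
      fix q
      have "real (N div q div q) = real (N div (q * q))" by (simp add: div_mult2_eq)
      also have "\<dots> \<le> real N / real (q * q)" by (rule of_nat_div_le_of_nat)
      finally show "real (N div q div q) \<le> real N * (1 / (real q)\<^sup>2)" by (simp add: power2_eq_square)
    qed
    also have "\<dots> \<le> real N * 1"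
      unfolding sum_distrib_left[symmetric] by (intro mult_left_mono sum_inverse_square_primes_le P) auto
    finally show ?thesis by simp
  qed
  have t2: "norm (\<Sum>m=1..N. of_real (Y m) * moebius m) \<le> (\<Sum>m=1..N. \<bar>Y m\<bar>)"
  proof (rule sum_norm_le)
    fix m show "norm (of_real (Y m) * moebius m) \<le> \<bar>Y m\<bar>"
      using mult_left_mono[OF norm_moebius_le[of m], of "\<bar>Y m\<bar>"] by (simp add: norm_mult)
  qed
  have Y2: "(\<Sum>m=1..N. (Y m)\<^sup>2) \<le> real N * W + (\<Sum>q\<in>P. \<Sum>r\<in>P-{q}. \<Sum>m=1..N div max q r. A (q * m) * A (r * m))"
  proof -
    have mx: "max q r * m \<le> N \<longleftrightarrow> q * m \<le> N \<and> r * m \<le> N" for q r m :: nat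
      by (simp add: nat_mult_max_left)
    define c where "c q r = (\<Sum>m=1..N div max q r. A (q * m) * A (r * m))" for q r
    have "(\<Sum>m=1..N. (Y m)\<^sup>2) = (\<Sum>m=1..N. \<Sum>q\<in>P. \<Sum>r\<in>P. if max q r * m \<le> N then A (q * m) * A (r * m) else 0)"
      unfolding Y_def power2_eq_square sum_product
      by (intro sum.cong refl) (auto simp: mx)
    also have "\<dots> = (\<Sum>q\<in>P. \<Sum>m=1..N. \<Sum>r\<in>P. if max q r * m \<le> N then A (q * m) * A (r * m) else 0)" by (rule sum.swap)
    also have "\<dots> = (\<Sum>q\<in>P. \<Sum>r\<in>P. \<Sum>m=1..N. if max q r * m \<le> N then A (q * m) * A (r * m) else 0)"
      by (intro sum.cong refl sum.swap)
    also have "\<dots> = (\<Sum>q\<in>P. \<Sum>r\<in>P. c q r)"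
    proof (intro sum.cong refl)
      fix q r assume q: "q \<in> P"
      define d where "d = max q r"
      have d: "d > 0" using pos[OF q] by (simp add: d_def)
      have "{1..N div d} = {m\<in>{1..N}. d * m \<le> N}"
      proof -
        have "m \<le> N" if "d * m \<le> N" for m using that d by (metis le_trans mult_le_mono1 nat_mult_1 Suc_leI One_nat_def)
        then show ?thesis using d by (auto simp: less_eq_div_iff_mult_less_eq mult.commute)
      qed
      then show "(\<Sum>m=1..N. if max q r * m \<le> N then A (q * m) * A (r * m) else 0) = c q r"
        unfolding c_def d_def by (simp only: sum.inter_filter[OF finite_atLeastAtMost])
    qed
    also have "\<dots> = (\<Sum>q\<in>P. c q q + (\<Sum>r\<in>P-{q}. c q r))"
      using P(1) by (intro sum.cong refl) (simp add: sum.remove)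
    also have "\<dots> = (\<Sum>q\<in>P. c q q) + (\<Sum>q\<in>P. \<Sum>r\<in>P-{q}. c q r)" by (rule sum.distrib)
    also have "(\<Sum>q\<in>P. c q q) \<le> (\<Sum>q\<in>P. real N * (1 / real q))"
    proof (rule sum_mono)
      fix q
      have sq1: "A n * A n \<le> 1" for n
        using A[of n] abs_square_le_1[of "A n"] by (simp add: power2_eq_square)
      have "c q q \<le> (\<Sum>m=1..N div q. 1)"
        unfolding c_def max.idem by (intro sum_mono sq1)
      also have "\<dots> \<le> real N * (1 / real q)" by (simp add: of_nat_div_le_of_nat)
      finally show "c q q \<le> real N * (1 / real q)" .
    qed
    also have "(\<Sum>q\<in>P. real N * (1 / real q)) = real N * W" by (simp add: W_def sum_distrib_left)
    finally show ?thesis by (simp add: c_def)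
  qed
  have "of_real W * (\<Sum>n=1..N. of_real (A n) * moebius n) =
     (\<Sum>n=1..N. of_real (w n) * (of_real (A n) * moebius n)) - (\<Sum>n=1..N. of_real (w n - W) * (of_real (A n) * moebius n))"
    by (simp add: sum_distrib_left sum_subtractf[symmetric] algebra_simps)
  then have "norm (of_real W * (\<Sum>n=1..N. of_real (A n) * moebius n)) \<le>
     norm (\<Sum>n=1..N. of_real (w n) * (of_real (A n) * moebius n)) + norm (\<Sum>n=1..N. of_real (w n - W) * (of_real (A n) * moebius n))"
    by (simp only: norm_triangle_ineq4)
  also have "norm (\<Sum>n=1..N. of_real (w n - W) * (of_real (A n) * moebius n)) \<le> (\<Sum>n=1..N. \<bar>w n - W\<bar>)"
  proof (rule sum_norm_le)
    fix n show "norm (of_real (w n - W) * (of_real (A n) * moebius n)) \<le> \<bar>w n - W\<bar>"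
      using mult_left_mono[OF AM[of n n], of "\<bar>w n - W\<bar>"] by (simp only: norm_mult norm_of_real) simp
  qed
  also have "(\<Sum>n=1..N. \<bar>w n - W\<bar>) \<le> sqrt (real (card {1..N}) * (real N * W + 2 * W * real (card P)))"
    unfolding w_def W_def by (intro sum_abs_le_sqrt turan_kubilius P)
  also have "norm (\<Sum>n=1..N. of_real (w n) * (of_real (A n) * moebius n)) \<le> real N + (\<Sum>m=1..N. \<bar>Y m\<bar>)"
    unfolding main using t1 t2 norm_triangle_ineq4 by (smt (verit))
  also have "(\<Sum>m=1..N. \<bar>Y m\<bar>) \<le> sqrt (real (card {1..N}) * (real N * W + (\<Sum>q\<in>P. \<Sum>r\<in>P-{q}. \<Sum>m=1..N div max q r. A (q * m) * A (r * m))))"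
    by (intro sum_abs_le_sqrt Y2)
  finally show ?thesis using W0 by (simp add: norm_mult)
qed

text \<open>The array form lets the sequence depend on the window. Divided by N, the bound of
  \<open>bilinear_bound\<close> tends to 2 sqrt W + 1 against the factor W on the left, so the mean
  is eventually at most 4 / sqrt W, and W can be made as large as desired.\<close>

theorem katai_bourgain_sarnak_ziegler:
  fixes a :: "nat \<Rightarrow> nat \<Rightarrow> real"
  assumes bd: "\<And>N n. \<bar>a N n\<bar> \<le> 1"
    and corr: "\<And>q r. prime q \<Longrightarrow> prime r \<Longrightarrow> q \<noteq> r \<Longrightarrow>
      (\<lambda>N. (\<Sum>m=1..N div max q r. a N (q * m) * a N (r * m)) / real N) \<longlonglongrightarrow> 0"
  shows "(\<lambda>N. (\<Sum>n=1..N. of_real (a N n) * moebius n) / of_nat N) \<longlonglongrightarrow> 0"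
proof (rule tendstoI)
  fix e :: real assume e: "e > 0"
  obtain P where P: "finite P" "\<And>q. q \<in> P \<Longrightarrow> prime (q::nat)"
    and PW: "(\<Sum>q\<in>P. 1 / real q) \<ge> (5 / e)\<^sup>2 + 1"
    using prime_reciprocals_unbounded by metis
  define W where "W = (\<Sum>q\<in>P. 1 / real q)"
  have W1: "W \<ge> (5 / e)\<^sup>2 + 1" using PW by (simp add: W_def)
  have "(5 / e)\<^sup>2 \<ge> 0" by simp
  then have "W \<ge> 1" "(5 / e)\<^sup>2 < W" using W1 by linarith+
  then have W: "W \<ge> 1" "sqrt W \<ge> 1" "sqrt W > 5 / e" by (auto intro: real_less_rsqrt)
  define D where "D N = (\<Sum>q\<in>P. \<Sum>r\<in>P-{q}. \<Sum>m=1..N div max q r. a N (q * m) * a N (r * m))" for N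
  have "(\<lambda>N. \<Sum>q\<in>P. \<Sum>r\<in>P-{q}. (\<Sum>m=1..N div max q r. a N (q * m) * a N (r * m)) / real N) \<longlonglongrightarrow> (\<Sum>q\<in>P. \<Sum>r\<in>P-{q}. 0)"
    by (intro tendsto_sum corr P(2)) auto
  then have D: "(\<lambda>N. D N / real N) \<longlonglongrightarrow> 0" by (simp add: D_def sum_divide_distrib)
  have "(\<lambda>N. sqrt (W + 2 * W * real (card P) / real N) + 1 + sqrt (W + D N / real N)) \<longlonglongrightarrow> sqrt (W + 0) + 1 + sqrt (W + 0)"
    by (intro tendsto_intros D lim_const_over_n)
  then have "\<forall>\<^sub>F N in sequentially. sqrt (W + 2 * W * real (card P) / real N) + 1 + sqrt (W + D N / real N) < 2 * sqrt W + 2"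
    by (intro order_tendstoD) auto
  moreover have "\<forall>\<^sub>F N in sequentially. N \<ge> (1::nat)" by (rule eventually_ge_at_top)
  ultimately show "\<forall>\<^sub>F N in sequentially. dist ((\<Sum>n=1..N. of_real (a N n) * moebius n) / of_nat N) 0 < e"
  proof eventually_elim
    case (elim N)
    define S where "S = norm (\<Sum>n=1..N. of_real (a N n) * moebius n)"
    have N: "real N > 0" using elim by simp
    have sq: "sqrt (real N * x) = real N * sqrt (x / real N)" for x
    proof -
      have "real N * x = (real N)\<^sup>2 * (x / real N)" using N by (simp add: power2_eq_square)
      then show ?thesis by (simp only: real_sqrt_mult real_sqrt_abs abs_of_nat)
    qed
    have "W * S \<le> sqrt (real N * (real N * W + 2 * W * real (card P))) + real N + sqrt (real N * (real N * W + D N))"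
      unfolding S_def D_def W_def by (intro bilinear_bound P bd)
    also have "\<dots> = real N * (sqrt (W + 2 * W * real (card P) / real N) + 1 + sqrt (W + D N / real N))"
      unfolding sq using N by (simp add: distrib_left add_divide_distrib)
    also have "\<dots> \<le> real N * (2 * sqrt W + 2)" using elim N by (intro mult_left_mono) auto
    finally have "W * (S / real N) \<le> 2 * sqrt W + 2" using N by (simp add: field_simps)
    also have "\<dots> \<le> 4 * sqrt W" using W by simp
    also have "\<dots> < W * e"
    proof -
      have "4 < sqrt W * e" using W(3) e by (simp add: field_simps)
      then have "4 * sqrt W < (sqrt W * e) * sqrt W" using W by (intro mult_strict_right_mono) auto
      also have "\<dots> = W * e" using W by (simp add: mult_ac)
      finally show ?thesis .
    qed
    finally have "W * (S / real N) < W * e" .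
    then have "S / real N < e" using W by (subst (asm) mult_less_cancel_left_pos) auto
    then show ?case by (simp add: S_def norm_divide)
  qed
qed

section \<open>Blocks\<close>

text \<open>Points at mutual distance at least \<open>h\<close> fall into different intervals [k h,
  (k + 1) h). The slack \<open>d\<close> admits blocks that begin before the window but reach into
  it; it is added to \<open>i\<close> to avoid truncated subtraction.\<close>

lemma card_separated_le:
  fixes S :: "nat set"
  assumes S: "\<And>i. i \<in> S \<Longrightarrow> lo \<le> i + d \<and> i < hi"
    and sep: "\<And>i j. i \<in> S \<Longrightarrow> j \<in> S \<Longrightarrow> i \<noteq> j \<Longrightarrow> i + h \<le> j \<or> j + h \<le> i"
    and h: "h > 0" and lohi: "lo \<le> hi + d"
  shows "real (card S) \<le> (real hi - real lo + real d) / real h + 2"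
proof -
  have inj: "inj_on (\<lambda>i. i div h) S"
  proof (rule inj_onI)
    fix i j assume ij: "i \<in> S" "j \<in> S" "i div h = j div h"
    show "i = j"
    proof (rule ccontr)
      assume "i \<noteq> j"
      then have "i + h \<le> j \<or> j + h \<le> i" using sep ij by blast
      then have "(i + h) div h \<le> j div h \<or> (j + h) div h \<le> i div h" using div_le_mono by blast
      then show False using ij h by simp
    qed
  qed
  have sub: "(\<lambda>i. i div h) ` S \<subseteq> {(lo - d) div h..hi div h}"
  proof
    fix y assume "y \<in> (\<lambda>i. i div h) ` S"
    then obtain i where "i \<in> S" "y = i div h" by auto
    moreover from this S[of i] have "lo - d \<le> i" "i \<le> hi" by auto
    ultimately show "y \<in> {(lo - d) div h..hi div h}" by (auto intro: div_le_mono)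
  qed
  have "card S = card ((\<lambda>i. i div h) ` S)" using inj by (simp add: card_image)
  also have "\<dots> \<le> card {(lo - d) div h..hi div h}" by (rule card_mono[OF _ sub]) simp
  finally have "card S \<le> Suc (hi div h) - (lo - d) div h" by simp
  moreover have "(lo - d) div h \<le> hi div h" using lohi by (intro div_le_mono) simp
  ultimately have "real (card S) \<le> real (hi div h) + 1 - real ((lo - d) div h)" by linarith
  moreover have "real (hi div h) \<le> real hi / real h" by (rule of_nat_div_le_of_nat)
  moreover have "real ((lo - d) div h) > real (lo - d) / real h - 1"
    using real_of_int_floor_gt_diff_one[of "real (lo - d) / real h"] by (simp add: floor_divide_of_nat_eq)
  moreover have "real (lo - d) / real h \<ge> (real lo - real d) / real h"
    by (intro divide_right_mono) auto
  ultimately have "real (card S) \<le> real hi / real h + 2 - (real lo - real d) / real h" by linarith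
  then show ?thesis by (simp add: diff_divide_distrib add_divide_distrib)
qed

lemma length_concat_map_upt: "length (concat (map f [0..<m])) = (\<Sum>i<m. length (f i))"
  by (induction m) auto

lemma nth_concat_map_upt:
  assumes "k < m" "t < length (f k)"
  shows "concat (map f [0..<m]) ! ((\<Sum>i<k. length (f i)) + t) = f k ! t"
  using assms(1)
proof (induction m)
  case (Suc m)
  show ?case
  proof (cases "k = m")
    case True
    then show ?thesis using length_concat_map_upt[of f m] by (simp add: nth_append)
  next
    case False
    then have k: "k < m" using Suc by simp
    have "(\<Sum>i<k. length (f i)) + t < (\<Sum>i<Suc k. length (f i))" using assms(2) by simp
    also have "\<dots> \<le> (\<Sum>i<m. length (f i))" using k by (intro sum_mono2) auto
    finally show ?thesis using Suc.IH[OF k] length_concat_map_upt[of f m] by (simp add: nth_append)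
  qed
qed simp

text \<open>The clopen sets decided by the coordinates in [-w, w]. They live on all maps rather than
  on \<Omega>, so that a pattern read off from a finite block, or the all-ones sequence, can be
  tested for membership.\<close>

definition local_set :: "nat \<Rightarrow> (int \<Rightarrow> nat) set \<Rightarrow> bool" where
  "local_set w C \<longleftrightarrow> (\<forall>x y. (\<forall>t. \<bar>t\<bar> \<le> int w \<longrightarrow> x t = y t) \<longrightarrow> (x \<in> C \<longleftrightarrow> y \<in> C))"

lemma rk_shift_funpow: "(rk_shift ^^ n) x = (\<lambda>k. x (k + int n))"
  by (induction n arbitrary: x) (simp_all add: rk_shift_def funpow_swap1 algebra_simps)

locale rank_one =
  fixes p :: "nat \<Rightarrow> nat" and s :: "nat \<Rightarrow> nat \<Rightarrow> nat"
  assumes p_ge_2: "n \<ge> 1 \<Longrightarrow> p n \<ge> 2"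
begin

abbreviation "h \<equiv> rk_h p s"
abbreviation "B \<equiv> rk_B p s"

text \<open>The position of copy number k of \<open>B j\<close> inside \<open>B (Suc j)\<close>; for
  k = \<open>p j\<close> it is the full length.\<close>

definition offs :: "nat \<Rightarrow> nat \<Rightarrow> nat" where "offs j k = (\<Sum>i<k. h j + s j i)"

lemma h_Suc: "j \<ge> 1 \<Longrightarrow> h (Suc j) = offs j (p j)"
  by (cases j) (simp_all add: offs_def sum.distrib)

lemma B_Suc: "j \<ge> 1 \<Longrightarrow> B (Suc j) = concat (map (\<lambda>i. B j @ replicate (s j i) 1) [0..<p j])"
  by (cases j) simp_all

lemma length_B: "j \<ge> 1 \<Longrightarrow> length (B j) = h j"
proof (induction j rule: dec_induct)
  case (step j)
  then show ?case by (simp add: B_Suc h_Suc length_concat_map_upt offs_def)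
qed simp

lemma offs_mono: "k \<le> k' \<Longrightarrow> offs j k \<le> offs j k'"
  unfolding offs_def by (intro sum_mono2) auto

lemma h_double: "j \<ge> 1 \<Longrightarrow> 2 * h j \<le> h (Suc j)"
proof -
  assume j: "j \<ge> 1"
  have "2 * h j \<le> offs j 2" by (simp add: offs_def numeral_2_eq_2)
  also have "\<dots> \<le> offs j (p j)" using p_ge_2[OF j] by (rule offs_mono)
  finally show ?thesis using h_Suc[OF j] by simp
qed

lemma h_pos: "j \<ge> 1 \<Longrightarrow> h j > 0"
proof (induction j rule: dec_induct)
  case (step j)
  then show ?case using h_double[of j] by linarith
qed simp

lemma h_ge: "j \<ge> 1 \<Longrightarrow> h j \<ge> j"
proof (induction j rule: dec_induct)
  case (step j)
  then show ?case using h_double[of j] h_pos[of j] by linarith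
qed simp

lemma h_mono:
  assumes "1 \<le> i" "i \<le> j"
  shows "h i \<le> h j"
  using assms(2)
proof (induction j rule: dec_induct)
  case (step j)
  then show ?case using h_double[of j] assms(1) by linarith
qed simp

section \<open>Symbols and copies inside a block\<close>

lemma B_Suc_nth_block:
  assumes "j \<ge> 1" "k < p j" "t < h j"
  shows "B (Suc j) ! (offs j k + t) = B j ! t"
  using nth_concat_map_upt[of k "p j" t "\<lambda>i. B j @ replicate (s j i) 1"] assms
  by (simp add: B_Suc length_B offs_def nth_append)

lemma B_Suc_nth_spacer:
  assumes "j \<ge> 1" "k < p j" "h j \<le> t" "t < h j + s j k"
  shows "B (Suc j) ! (offs j k + t) = 1"
  using nth_concat_map_upt[of k "p j" t "\<lambda>i. B j @ replicate (s j i) 1"] assms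
  by (simp add: B_Suc length_B offs_def nth_append)

lemma B_nth_0: "j \<ge> 1 \<Longrightarrow> B j ! 0 = 0"
proof (induction j rule: dec_induct)
  case (step j)
  have "B (Suc j) ! (offs j 0 + 0) = B j ! 0"
    using step p_ge_2[of j] h_pos[of j] by (intro B_Suc_nth_block) auto
  then show ?case using step by (simp add: offs_def)
qed simp

lemma offs_find: "y < offs j m \<Longrightarrow> \<exists>k<m. offs j k \<le> y \<and> y < offs j (Suc k)"
proof (induction m)
  case (Suc m)
  then show ?case by (cases "y < offs j m") (auto simp: not_less intro: less_SucI)
qed (simp add: offs_def)

lemma offs_Suc: "offs j (Suc k) = offs j k + h j + s j k"
  by (simp add: offs_def)

text \<open>\<open>blk m j i\<close>: the construction places a copy of \<open>B j\<close> at position \<open>i\<close> of \<open>B m\<close>.\<close>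
inductive blk :: "nat \<Rightarrow> nat \<Rightarrow> nat \<Rightarrow> bool" for m where
  top: "blk m m 0"
| step: "blk m (Suc j) i \<Longrightarrow> 1 \<le> j \<Longrightarrow> k < p j \<Longrightarrow> blk m j (i + offs j k)"

lemma blk_bounds: "blk m j i \<Longrightarrow> m \<ge> 1 \<Longrightarrow> 1 \<le> j \<and> j \<le> m \<and> i + h j \<le> h m"
proof (induction rule: blk.induct)
  case (step j i k)
  have "offs j k + h j \<le> offs j (Suc k)" by (simp add: offs_Suc)
  also have "\<dots> \<le> h (Suc j)" unfolding h_Suc[OF \<open>1 \<le> j\<close>] using step by (intro offs_mono) simp
  finally show ?case using step by simp
qed simp

lemma blk_nth: "blk m j i \<Longrightarrow> m \<ge> 1 \<Longrightarrow> t < h j \<Longrightarrow> B m ! (i + t) = B j ! t"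
proof (induction arbitrary: t rule: blk.induct)
  case (step j i k)
  have "offs j k + t < offs j (Suc k)" using step by (simp add: offs_Suc)
  also have "\<dots> \<le> h (Suc j)" unfolding h_Suc[OF \<open>1 \<le> j\<close>] using step by (intro offs_mono) simp
  finally have "B m ! (i + (offs j k + t)) = B (Suc j) ! (offs j k + t)" using step by simp
  then show ?case using B_Suc_nth_block[of j k t] step by (simp add: add.assoc)
qed simp

text \<open>Copies with the same parent are ordered by \<open>offs\<close>. Otherwise the parents
  are disjoint by induction, and each copy stays inside its parent.\<close>

lemma blk_separated:
  "blk m j i \<Longrightarrow> m \<ge> 1 \<Longrightarrow> blk m j i' \<Longrightarrow> i \<noteq> i' \<Longrightarrow> i + h j \<le> i' \<or> i' + h j \<le> i"
proof (induction arbitrary: i' rule: blk.induct)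
  case top
  then show ?case using blk_bounds[of m m i'] by auto
next
  case (step j i k)
  have "j < m" using blk_bounds[OF step.hyps(1)] step.prems by simp
  from \<open>blk m j i'\<close> show ?case
  proof (cases rule: blk.cases)
    case top
    then show ?thesis using \<open>j < m\<close> by simp
  next
    case (step i0 k')
    have le: "offs j k + h j \<le> h (Suc j)" "offs j k' + h j \<le> h (Suc j)"
      using offs_mono[of "Suc k" "p j" j] offs_mono[of "Suc k'" "p j" j] \<open>k < p j\<close> \<open>k' < p j\<close> h_Suc[OF \<open>1 \<le> j\<close>]
      by (simp_all add: offs_Suc)
    show ?thesis
    proof (cases "i = i0")
      case False
      then have "i + h (Suc j) \<le> i0 \<or> i0 + h (Suc j) \<le> i"
        using \<open>blk m (Suc j) i0\<close> \<open>m \<ge> 1\<close> \<open>\<And>i'. m \<ge> 1 \<Longrightarrow> blk m (Suc j) i' \<Longrightarrow> i \<noteq> i' \<Longrightarrow> _ i'\<close> by blast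
      then show ?thesis using le step by linarith
    next
      case True
      then have "k < k' \<or> k' < k" using \<open>i + offs j k \<noteq> i'\<close> step by (metis nat_neq_iff)
      then have "offs j (Suc k) \<le> offs j k' \<or> offs j (Suc k') \<le> offs j k"
        using offs_mono[of "Suc k" k' j] offs_mono[of "Suc k'" k j] by auto
      then show ?thesis using step True by (auto simp: offs_Suc)
    qed
  qed
qed

definition cov :: "nat \<Rightarrow> nat \<Rightarrow> nat \<Rightarrow> bool" where
  "cov m j y \<longleftrightarrow> (\<exists>i. blk m j i \<and> i \<le> y \<and> y < i + h j)"

text \<open>A position lost between the levels \<open>Suc j\<close> and \<open>j\<close> is a spacer
  inserted by the construction after a copy of \<open>B j\<close>. This allows spacers to be counted
  level by level.\<close>

lemma cov_Suc_cases:
  assumes "cov m (Suc j) y" "1 \<le> j" "\<not> cov m j y"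
  obtains i k where "blk m (Suc j) i" "i \<le> y" "y < i + h (Suc j)" "k < p j" "blk m j (i + offs j k)"
    "i + offs j k + h j \<le> y" "y < i + offs j k + h j + s j k"
proof -
  obtain i where i: "blk m (Suc j) i" "i \<le> y" "y < i + h (Suc j)" using assms(1) by (auto simp: cov_def)
  have "y - i < offs j (p j)" using i h_Suc[OF \<open>1 \<le> j\<close>] by linarith
  then obtain k where k: "k < p j" "offs j k \<le> y - i" "y - i < offs j (Suc k)" using offs_find by blast
  have b: "blk m j (i + offs j k)" using i(1) assms(2) k(1) by (rule blk.step)
  have "i + offs j k \<le> y" using k i by linarith
  then have "\<not> y < i + offs j k + h j" using b assms(3) by (auto simp: cov_def)
  then show ?thesis using that[of i k] i k b by (auto simp: offs_Suc)
qed

lemma not_cov_nth: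
  assumes "1 \<le> j" "j \<le> m" "y < h m" "\<not> cov m j y"
  shows "B m ! y = 1"
  using assms(2,1,4)
proof (induction j rule: inc_induct)
  case base
  then show ?case using assms(3) blk.top[of m] by (auto simp: cov_def)
next
  case (step j)
  show ?case
  proof (cases "cov m (Suc j) y")
    case True
    then obtain i k where ik: "blk m (Suc j) i" "i \<le> y" "y < i + h (Suc j)" "k < p j"
      "i + offs j k + h j \<le> y" "y < i + offs j k + h j + s j k"
      using cov_Suc_cases step by metis
    have "B m ! (i + (y - i)) = B (Suc j) ! (y - i)" using ik step by (intro blk_nth) auto
    also have "y - i = offs j k + (y - i - offs j k)" using ik by simp
    also have "B (Suc j) ! \<dots> = 1" using ik step by (intro B_Suc_nth_spacer) auto
    finally show ?thesis using ik by simp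
  next
    case False
    then show ?thesis using step by simp
  qed
qed

lemma finite_blk: "m \<ge> 1 \<Longrightarrow> finite {i. blk m j i \<and> P i}"
  by (rule finite_subset[of _ "{..h m}"]) (use blk_bounds in force)+

section \<open>Windows of points of the symbolic model\<close>

lemma subword_B_Suc: "1 \<le> m \<Longrightarrow> subword W (B m) \<Longrightarrow> subword W (B (Suc m))"
proof -
  assume m: "1 \<le> m" and "subword W (B m)"
  then obtain u v where uv: "B m = u @ W @ v" by (auto simp: subword_def)
  obtain q where "p m = Suc q" using p_ge_2[OF m] by (cases "p m") auto
  then have "[0..<p m] = 0 # [1..<p m]" by (simp add: upt_conv_Cons)
  then have "B (Suc m) = B m @ (replicate (s m 0) 1 @ concat (map (\<lambda>i. B m @ replicate (s m i) 1) [1..<p m]))"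
    using m by (simp add: B_Suc)
  then show ?thesis unfolding subword_def uv by (metis append.assoc)
qed

lemma subword_B_mono:
  assumes "m \<le> m'" "1 \<le> m" "subword W (B m)"
  shows "subword W (B m')"
  using assms by (induction m' rule: dec_induct) (auto intro: subword_B_Suc)

text \<open>Counting along an orbit thus takes place inside a single finite block, and no block
  decomposition of the bi-infinite sequence is required. The level can be raised at will because
  \<open>B m\<close> is a prefix of \<open>B (Suc m)\<close>.\<close>

lemma Omega_window:
  assumes "x \<in> rk_Omega p s" "1 \<le> m0"
  obtains m e where "m0 \<le> m" "e + L \<le> h m" "\<And>t. t < L \<Longrightarrow> x (a + int t) = B m ! (e + t)"
proof -
  obtain m1 where m1: "m1 \<ge> 1" "subword (map x [a..a + int L - 1]) (B m1)"
    using assms(1) unfolding rk_Omega_def by blast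
  define m where "m = max m0 m1"
  have "subword (map x [a..a + int L - 1]) (B m)"
    by (rule subword_B_mono[OF _ m1]) (simp add: m_def)
  then obtain u v where uv: "B m = u @ map x [a..a + int L - 1] @ v" by (auto simp: subword_def)
  have "length (B m) = h m" using assms(2) by (intro length_B) (auto simp: m_def)
  then have "length u + L \<le> h m" using uv by simp
  moreover have "x (a + int t) = B m ! (length u + t)" if "t < L" for t
    using that uv by (simp add: nth_append nth_upto)
  ultimately show ?thesis by (intro that[of m "length u"]) (auto simp: m_def)
qed

lemma Omega_shift: "x \<in> rk_Omega p s \<Longrightarrow> (\<lambda>k. x (k + a)) \<in> rk_Omega p s"
proof -
  assume x: "x \<in> rk_Omega p s"
  have "map (\<lambda>k. x (k + a)) [b..c] = map x [b + a..c + a]" for b c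
    by (rule nth_equalityI) (auto simp: nth_upto add_ac)
  then show ?thesis using x by (auto simp: rk_Omega_def)
qed

lemma rk_shift_Omega: "x \<in> rk_Omega p s \<Longrightarrow> (rk_shift ^^ n) x \<in> rk_Omega p s"
  unfolding rk_shift_funpow by (rule Omega_shift)

text \<open>Only positions whose whole \<open>w\<close>-neighbourhood lies inside the block are
  counted, so membership in a \<open>w\<close>-local set never depends on values read outside
  \<open>B n\<close>.\<close>

definition blk_count :: "nat \<Rightarrow> (int \<Rightarrow> nat) set \<Rightarrow> nat \<Rightarrow> nat" where
  "blk_count w C n = card {j\<in>{w..<h n - w}. (\<lambda>t. B n ! nat (int j + t)) \<in> C}"

text \<open>At a visit to \<open>C\<close> some symbol within distance \<open>w\<close> differs from
  1, so the time is within \<open>w\<close> of a copy of \<open>B n\<close>. Inside a copy the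
  visits are counted by \<open>blk_count\<close>, the 4 w positions near its two ends are given
  away, and separation bounds the number of copies. Spacers only lower that number, so no
  information on them enters.\<close>

lemma count_le_blk_count:
  assumes x: "x \<in> rk_Omega p s" and C: "local_set w C" and ones: "(\<lambda>_. 1) \<notin> C" and n: "n \<ge> 1"
  shows "real (card {k. k < N \<and> (rk_shift ^^ k) x \<in> C})
    \<le> (real (N + 2 * w) / real (h n) + 4) * real (blk_count w C n + 4 * w)"
proof -
  obtain m e where m: "n \<le> m" "e + (N + 2 * w) \<le> h m"
    and xe: "\<And>t. t < N + 2 * w \<Longrightarrow> x (- int w + int t) = B m ! (e + t)"
    using Omega_window[OF x n, of "N + 2 * w" "- int w"] by metis
  have m1: "m \<ge> 1" using m n by simp
  have hn: "h n > 0" using n by (rule h_pos)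
  define Q where "Q = {j\<in>{w..<h n - w}. (\<lambda>t. B n ! nat (int j + t)) \<in> C}"
  define S where "S = {i. blk m n i \<and> (e + w \<le> i + (h n + w) \<and> i < e + N + 2 * w)}"
  have finS: "finite S" unfolding S_def using m1 by (rule finite_blk)
  define V where "V i = (+) i ` Q \<union> {i - w..<i + w} \<union> {i + h n - w..<i + h n + w}" for i
  have "(\<lambda>k. e + w + k) ` {k. k < N \<and> (rk_shift ^^ k) x \<in> C} \<subseteq> (\<Union>i\<in>S. V i)"
  proof safe
    fix k assume k: "k < N" "(rk_shift ^^ k) x \<in> C"
    define y where "y = e + w + k"
    have xk: "(rk_shift ^^ k) x t = B m ! nat (int y + t)" if "\<bar>t\<bar> \<le> int w" for t
    proof -
      define t' where "t' = nat (int w + int k + t)"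
      have "t' < N + 2 * w" "int t' = int w + int k + t" using that k by (auto simp: t'_def)
      moreover have "nat (int y + t) = e + t'" using calculation by (simp add: y_def)
      ultimately show ?thesis using xe[of t'] by (simp add: rk_shift_funpow algebra_simps)
    qed
    have "\<exists>t. \<bar>t\<bar> \<le> int w \<and> (rk_shift ^^ k) x t \<noteq> 1"
      using C ones k(2) unfolding local_set_def by metis
    then obtain t where t: "\<bar>t\<bar> \<le> int w" "B m ! nat (int y + t) \<noteq> 1" using xk by auto
    define y' where "y' = nat (int y + t)"
    have y': "y' \<le> y + w" "y \<le> y' + w" using t by (auto simp: y'_def y_def)
    have "y' < h m" using y' k m by (simp add: y_def)
    then have "cov m n y'" using not_cov_nth[of n m y'] t n m by (auto simp: y'_def)
    then obtain i where i: "blk m n i" "i \<le> y'" "y' < i + h n" by (auto simp: cov_def)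
    have iS: "i \<in> S" using i y' k by (auto simp: S_def y_def)
    have "y \<in> V i"
    proof (cases "i + w \<le> y \<and> y + w < i + h n")
      case True
      define j where "j = y - i"
      have j: "y = i + j" "w \<le> j" "j + w < h n" using True by (auto simp: j_def)
      have "(\<lambda>t. B n ! nat (int j + t)) \<in> C"
      proof -
        have "\<forall>t. \<bar>t\<bar> \<le> int w \<longrightarrow> (rk_shift ^^ k) x t = B n ! nat (int j + t)"
        proof (intro allI impI)
          fix t assume that: "\<bar>t\<bar> \<le> int w"
          have "nat (int y + t) = i + nat (int j + t)" "nat (int j + t) < h n" using that j by auto
          then show "(rk_shift ^^ k) x t = B n ! nat (int j + t)"
            using xk[OF that] blk_nth[OF i(1) m1, of "nat (int j + t)"] by simp
        qed
        with C[unfolded local_set_def, rule_format, of "(rk_shift ^^ k) x" "\<lambda>t. B n ! nat (int j + t)"]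
        show ?thesis using k(2) by blast
      qed
      then have "j \<in> Q" using j by (auto simp: Q_def)
      then show ?thesis using j by (auto simp: V_def)
    next
      case False
      then show ?thesis using i y' by (auto simp: V_def)
    qed
    then show "e + w + k \<in> (\<Union>i\<in>S. V i)" using iS by (auto simp: y_def)
  qed
  moreover have finV: "finite (V i)" for i by (auto simp: V_def Q_def)
  ultimately have "card ((\<lambda>k. e + w + k) ` {k. k < N \<and> (rk_shift ^^ k) x \<in> C}) \<le> card (\<Union>i\<in>S. V i)"
    using finS by (intro card_mono) auto
  also have "\<dots> \<le> (\<Sum>i\<in>S. card (V i))" by (rule card_UN_le[OF finS])
  also have "\<dots> \<le> (\<Sum>i\<in>S. blk_count w C n + 4 * w)"
  proof (rule sum_mono)
    fix i
    have "card (V i) \<le> card ((+) i ` Q \<union> {i - w..<i + w}) + card {i + h n - w..<i + h n + w}"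
      unfolding V_def by (rule card_Un_le)
    moreover have "card ((+) i ` Q \<union> {i - w..<i + w}) \<le> card ((+) i ` Q) + card {i - w..<i + w}"
      by (rule card_Un_le)
    moreover have "card ((+) i ` Q) \<le> card Q" by (rule card_image_le) (auto simp: Q_def)
    moreover have "card {i - w..<i + w} \<le> 2 * w" "card {i + h n - w..<i + h n + w} \<le> 2 * w" by simp_all
    moreover have "card Q = blk_count w C n" by (simp add: blk_count_def Q_def)
    ultimately show "card (V i) \<le> blk_count w C n + 4 * w" by linarith
  qed
  also have "\<dots> = card S * (blk_count w C n + 4 * w)" by simp
  also have "card ((\<lambda>k. e + w + k) ` {k. k < N \<and> (rk_shift ^^ k) x \<in> C}) = card {k. k < N \<and> (rk_shift ^^ k) x \<in> C}"
    by (rule card_image) (auto simp: inj_on_def)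
  finally have "real (card {k. k < N \<and> (rk_shift ^^ k) x \<in> C}) \<le> real (card S) * real (blk_count w C n + 4 * w)"
    by (simp only: of_nat_mult[symmetric] of_nat_le_iff)
  also have "real (card S) \<le> (real (e + N + 2 * w) - real (e + w) + real (h n + w)) / real (h n) + 2"
    using hn by (intro card_separated_le) (auto simp: S_def dest: blk_separated[OF _ m1])
  also have "\<dots> \<le> real (N + 2 * w) / real (h n) + 4" using hn by (simp add: field_simps)
  finally show ?thesis by (simp add: mult_right_mono)
qed

section \<open>Counting spacers in a window\<close>

lemma card_cover_le:
  assumes "finite S" "\<And>k. k \<le> (N::nat) \<Longrightarrow> P k \<Longrightarrow> \<exists>i\<in>S. c + k \<in> V i" "\<And>i. i \<in> S \<Longrightarrow> finite (V i) \<and> card (V i) \<le> v"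
  shows "card {k. k \<le> N \<and> P k} \<le> card S * v"
proof -
  have "card {k. k \<le> N \<and> P k} = card ((+) c ` {k. k \<le> N \<and> P k})"
    by (rule card_image[symmetric]) (auto simp: inj_on_def)
  also have "\<dots> \<le> card (\<Union>i\<in>S. V i)" using assms by (intro card_mono) auto
  also have "\<dots> \<le> (\<Sum>i\<in>S. card (V i))" by (rule card_UN_le[OF assms(1)])
  also have "\<dots> \<le> (\<Sum>i\<in>S. v)" using assms by (intro sum_mono) auto
  finally show ?thesis by simp
qed

text \<open>Counted per copy of \<open>B (Suc j)\<close> that meets the window; this is efficient
  when \<open>h (Suc j)\<close> is at most N.\<close>

lemma card_spacers_le:
  assumes j: "1 \<le> j" and m: "m \<ge> 1"
  shows "real (card {k. k \<le> N \<and> cov m (Suc j) (c + k) \<and> \<not> cov m j (c + k)})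
    \<le> (real N / real (h (Suc j)) + 4) * real (\<Sum>i<p j. s j i)"
proof -
  define S where "S = {i. blk m (Suc j) i \<and> (c \<le> i + h (Suc j) \<and> i < c + N + 1)}"
  define V where "V i = (\<lambda>(k, t). i + offs j k + h j + t) ` (SIGMA k:{..<p j}. {..<s j k})" for i
  have hp: "h (Suc j) > 0" by (rule h_pos) simp
  have "card {k. k \<le> N \<and> cov m (Suc j) (c + k) \<and> \<not> cov m j (c + k)} \<le> card S * (\<Sum>i<p j. s j i)"
  proof (rule card_cover_le[where V = V])
    show "finite S" unfolding S_def by (rule finite_blk[OF m])
    fix k assume k: "k \<le> N" "cov m (Suc j) (c + k) \<and> \<not> cov m j (c + k)"
    then obtain i q where iq: "blk m (Suc j) i" "i \<le> c + k" "c + k < i + h (Suc j)" "q < p j"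
      "i + offs j q + h j \<le> c + k" "c + k < i + offs j q + h j + s j q"
      using cov_Suc_cases[of m j "c + k"] j by metis
    have "i \<in> S" using iq k by (auto simp: S_def)
    moreover have "c + k \<in> V i"
      unfolding V_def using iq by (intro image_eqI[of _ _ "(q, c + k - (i + offs j q + h j))"]) auto
    ultimately show "\<exists>i\<in>S. c + k \<in> V i" by blast
  next
    fix i
    have "card (V i) \<le> card (SIGMA k:{..<p j}. {..<s j k})" unfolding V_def by (rule card_image_le) auto
    then show "finite (V i) \<and> card (V i) \<le> (\<Sum>i<p j. s j i)" by (auto simp: V_def card_SigmaI)
  qed
  then have "real (card {k. k \<le> N \<and> cov m (Suc j) (c + k) \<and> \<not> cov m j (c + k)}) \<le> real (card S) * real (\<Sum>i<p j. s j i)"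
    by (simp only: of_nat_mult[symmetric] of_nat_le_iff)
  also have "real (card S) \<le> (real (c + N + 1) - real c + real (h (Suc j))) / real (h (Suc j)) + 2"
    using hp by (intro card_separated_le) (auto simp: S_def dest: blk_separated[OF _ m])
  also have "\<dots> \<le> real N / real (h (Suc j)) + 4" using hp by (simp add: field_simps)
  finally show ?thesis by (simp only: mult_right_mono of_nat_0_le_iff)
qed

text \<open>For the top level of a window, where \<open>h (Suc j)\<close> exceeds N and counting all
  spacers of a partly visible copy of \<open>B (Suc j)\<close> would be too crude. Here the count is
  per copy of \<open>B j\<close>, each followed by at most \<open>t\<close> spacers.\<close>

lemma card_spacers_le_max:
  assumes j: "1 \<le> j" and m: "m \<ge> 1" and t: "\<And>k. k < p j \<Longrightarrow> s j k \<le> t"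
  shows "real (card {k. k \<le> N \<and> cov m (Suc j) (c + k) \<and> \<not> cov m j (c + k)})
    \<le> (real N / real (h j) + 4 + real t / real (h j)) * real t"
proof -
  define S where "S = {i. blk m j i \<and> (c \<le> i + (h j + t) \<and> i < c + N + 1)}"
  define V where "V i = {i + h j..<i + h j + t}" for i
  have hp: "h j > 0" using j by (rule h_pos)
  have "card {k. k \<le> N \<and> cov m (Suc j) (c + k) \<and> \<not> cov m j (c + k)} \<le> card S * t"
  proof (rule card_cover_le[where V = V])
    show "finite S" unfolding S_def by (rule finite_blk[OF m])
    fix k assume k: "k \<le> N" "cov m (Suc j) (c + k) \<and> \<not> cov m j (c + k)"
    then obtain i q where iq: "q < p j" "blk m j (i + offs j q)"
      "i + offs j q + h j \<le> c + k" "c + k < i + offs j q + h j + s j q"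
      using cov_Suc_cases[of m j "c + k"] j by metis
    have "i + offs j q \<in> S" using iq k t[OF iq(1)] by (auto simp: S_def)
    moreover have "c + k \<in> V (i + offs j q)" using iq t[OF iq(1)] by (auto simp: V_def)
    ultimately show "\<exists>i\<in>S. c + k \<in> V i" by blast
  qed (auto simp: V_def)
  then have "real (card {k. k \<le> N \<and> cov m (Suc j) (c + k) \<and> \<not> cov m j (c + k)}) \<le> real (card S) * real t"
    by (simp only: of_nat_mult[symmetric] of_nat_le_iff)
  also have "real (card S) \<le> (real (c + N + 1) - real c + real (h j + t)) / real (h j) + 2"
    using hp by (intro card_separated_le) (auto simp: S_def dest: blk_separated[OF _ m])
  also have "\<dots> \<le> real N / real (h j) + 4 + real t / real (h j)" using hp by (simp add: field_simps)
  finally show ?thesis by (simp add: mult_right_mono)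
qed

text \<open>At most one run of spacers of level greater than \<open>l\<close> meets a window shorter than \<open>h (Suc l)\<close>:
  two of them would be separated by a whole block. This run is the exceptional interval.\<close>
lemma window_exceptional_run:
  assumes x: "x \<in> rk_Omega p s" and l: "1 \<le> l" "h l \<le> N" "N < h (Suc l)"
    and t: "\<And>k. k < p l \<Longrightarrow> s l k \<le> t"
  obtains u v where "u \<le> v" "v \<le> Suc N" "\<And>k. u \<le> k \<Longrightarrow> k < v \<Longrightarrow> x (int k) = 1"
    "\<And>n. 1 \<le> n \<Longrightarrow> n \<le> l \<Longrightarrow>
      real (card {k. k \<le> N \<and> \<not> (u \<le> k \<and> k < v) \<and> (\<forall>i\<le>h n. x (int k - int i) = 1)})
       \<le> real (h n) + 5 * real N * (\<Sum>j=n..<l. real (\<Sum>i<p j. s j i) / real (h (Suc j)))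
         + (real N / real (h l) + 4 + real t / real (h l)) * real t"
proof -
  obtain m c where m: "Suc l \<le> m" "c + Suc N \<le> h m" and xc: "\<And>k. k < Suc N \<Longrightarrow> x (int k) = B m ! (c + k)"
    using Omega_window[OF x, of "Suc l" "Suc N" 0] by auto
  have m1: "m \<ge> 1" using m by simp
  define U where "U j = {k. k \<le> N \<and> \<not> cov m j (c + k)}" for j
  have Uone: "x (int k) = 1" if "k \<in> U j" "1 \<le> j" "j \<le> m" for k j
    using that xc[of k] not_cov_nth[of j m "c + k"] m by (auto simp: U_def)
  \<comment> \<open>A copy of \<open>B (Suc l)\<close> between two uncovered positions of the window
    would have length less than N, but \<open>h (Suc l)\<close> exceeds N.\<close>
  have convex: "k \<in> U (Suc l)" if "a \<in> U (Suc l)" "b \<in> U (Suc l)" "a \<le> k" "k \<le> b" for a b k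
  proof (rule ccontr)
    assume "k \<notin> U (Suc l)"
    then have "cov m (Suc l) (c + k)" using that by (auto simp: U_def)
    then obtain i where i: "blk m (Suc l) i" "i \<le> c + k" "c + k < i + h (Suc l)" by (auto simp: cov_def)
    have "\<not> (i \<le> c + a \<and> c + a < i + h (Suc l))" "\<not> (i \<le> c + b \<and> c + b < i + h (Suc l))"
      using that i by (auto simp: U_def cov_def)
    then have "c + a < i" "i + h (Suc l) \<le> c + b" using i that by linarith+
    then show False using l that by (simp add: U_def)
  qed
  have "\<exists>u v. u \<le> v \<and> v \<le> Suc N \<and> U (Suc l) = {u..<v}"
  proof (cases "U (Suc l) = {}")
    case False
    have fin: "finite (U (Suc l))" by (simp add: U_def)
    define a b where "a = Min (U (Suc l))" and "b = Max (U (Suc l))"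
    have ab: "a \<in> U (Suc l)" "b \<in> U (Suc l)" using fin False by (auto simp: a_def b_def)
    have "U (Suc l) = {a..<Suc b}"
    proof (intro equalityI subsetI)
      fix k assume "k \<in> U (Suc l)"
      then show "k \<in> {a..<Suc b}" using fin by (auto simp: a_def b_def less_Suc_eq_le)
    qed (use convex[OF ab] in auto)
    moreover have "a \<le> Suc b" using ab fin by (auto simp: a_def intro: le_SucI)
    moreover have "Suc b \<le> Suc N" using ab by (simp add: U_def)
    ultimately show ?thesis by blast
  qed (auto intro!: exI[of _ 0])
  then obtain u v where uv: "u \<le> v" "v \<le> Suc N" "U (Suc l) = {u..<v}" by blast
  show ?thesis
  proof (rule that[OF uv(1,2)])
    show "x (int k) = 1" if "u \<le> k" "k < v" for k
      using that uv(3) m by (intro Uone[of k "Suc l"]) auto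
    fix n assume n: "1 \<le> n" "n \<le> l"
    define D where "D j = {k. k \<le> N \<and> cov m (Suc j) (c + k) \<and> \<not> cov m j (c + k)}" for j
    define A where "A = {k. k \<le> N \<and> \<not> (u \<le> k \<and> k < v) \<and> (\<forall>i\<le>h n. x (int k - int i) = 1)}"
    have down: "k \<in> (\<Union>j\<in>{n..l}. D j)" if k: "k \<in> U n" "k \<notin> U (Suc l)" for k
    proof -
      have "\<exists>j. n \<le> j \<and> j < Suc l \<and> k \<in> U j \<and> k \<notin> U (Suc j)"
      proof (rule ccontr)
        assume neg: "\<not> ?thesis"
        have "k \<in> U j" if "n \<le> j" "j \<le> Suc l" for j
          using that
        proof (induction j rule: dec_induct)
          case (step j)
          then show ?case using neg by auto
        qed (use k in simp)
        then show False using k n by simp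
      qed
      then show ?thesis by (auto simp: U_def D_def)
    qed
    \<comment> \<open>If a copy of \<open>B n\<close> covered k, its initial 0 would be among the
      preceding \<open>h n\<close> positions, which are all 1. So k is uncovered at level n and,
      being outside the run, a spacer of some level from n to l. The first \<open>h n\<close>
      positions are given away, since looking back from them may leave the window.\<close>
    have "A \<subseteq> {..<h n} \<union> (\<Union>j\<in>{n..l}. D j)"
    proof
      fix k assume k: "k \<in> A"
      show "k \<in> {..<h n} \<union> (\<Union>j\<in>{n..l}. D j)"
      proof (cases "k < h n")
        case False
        have "k \<in> U n"
        proof (rule ccontr)
          assume "k \<notin> U n"
          then obtain i where i: "blk m n i" "i \<le> c + k" "c + k < i + h n" using k by (auto simp: U_def cov_def A_def)
          define k' where "k' = i - c"
          have k': "i = c + k'" "k' \<le> k" "k - k' \<le> h n" using i False by (auto simp: k'_def)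
          have "x (int k - int (k - k')) = 1" using k k' unfolding A_def by blast
          moreover have "int k - int (k - k') = int k'" using k' by simp
          moreover have "x (int k') = B m ! (i + 0)" using xc[of k'] k' k by (simp add: A_def)
          moreover have "B m ! (i + 0) = B n ! 0" using i m1 n h_pos by (intro blk_nth) auto
          ultimately show False using B_nth_0[of n] n by simp
        qed
        moreover have "k \<notin> U (Suc l)" using k uv by (auto simp: A_def)
        ultimately show ?thesis using down by blast
      qed simp
    qed
    then have "card A \<le> card ({..<h n} \<union> (\<Union>j\<in>{n..l}. D j))" by (intro card_mono) (auto simp: D_def)
    also have "\<dots> \<le> h n + card (\<Union>j\<in>{n..l}. D j)" using card_Un_le[of "{..<h n}"] by simp
    also have "card (\<Union>j\<in>{n..l}. D j) \<le> (\<Sum>j\<in>{n..l}. card (D j))" by (rule card_UN_le) simp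
    also have "(\<Sum>j\<in>{n..l}. card (D j)) = (\<Sum>j=n..<l. card (D j)) + card (D l)"
    proof -
      have "{n..l} = insert l {n..<l}" using n by auto
      then show ?thesis by simp
    qed
    finally have "real (card A) \<le> real (h n) + (\<Sum>j=n..<l. real (card (D j))) + real (card (D l))"
      by (simp only: of_nat_add[symmetric] of_nat_sum[symmetric] of_nat_le_iff) simp
    also have "real (card (D l)) \<le> (real N / real (h l) + 4 + real t / real (h l)) * real t"
      unfolding D_def using l(1) m1 t by (rule card_spacers_le_max)
    also have "(\<Sum>j=n..<l. real (card (D j))) \<le> (\<Sum>j=n..<l. 5 * real N * (real (\<Sum>i<p j. s j i) / real (h (Suc j))))"
    proof (rule sum_mono)
      fix j assume j: "j \<in> {n..<l}"
      have hp: "h (Suc j) > 0" by (rule h_pos) simp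
      have "h (Suc j) \<le> N" using h_mono[of "Suc j" l] j l by auto
      \<comment> \<open>Below level l a copy of \<open>B (Suc j)\<close> is no longer than the
        window, so the boundary term 4 is absorbed; hence the factor 5.\<close>
      then have "4 \<le> 4 * (real N / real (h (Suc j)))" using hp by (simp add: field_simps)
      then have le: "real N / real (h (Suc j)) + 4 \<le> 5 * (real N / real (h (Suc j)))" by linarith
      have "real (card (D j)) \<le> (real N / real (h (Suc j)) + 4) * real (\<Sum>i<p j. s j i)"
        unfolding D_def using j n m1 by (intro card_spacers_le) auto
      also have "\<dots> \<le> 5 * (real N / real (h (Suc j))) * real (\<Sum>i<p j. s j i)" by (intro mult_right_mono le of_nat_0_le_iff)
      finally show "real (card (D j)) \<le> 5 * real N * (real (\<Sum>i<p j. s j i) / real (h (Suc j)))" by simp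
    qed
    also have "\<dots> = 5 * real N * (\<Sum>j=n..<l. real (\<Sum>i<p j. s j i) / real (h (Suc j)))"
      by (simp only: sum_distrib_left)
    finally show "real (card {k. k \<le> N \<and> \<not> (u \<le> k \<and> k < v) \<and> (\<forall>i\<le>h n. x (int k - int i) = 1)})
       \<le> real (h n) + 5 * real N * (\<Sum>j=n..<l. real (\<Sum>i<p j. s j i) / real (h (Suc j)))
         + (real N / real (h l) + 4 + real t / real (h l)) * real t"
      by (simp add: A_def add_mono)
  qed
qed

end

section \<open>Limits of empirical measures and weak mixing\<close>

text \<open>By Tychonoff the values lie in a compact cube. A finer filter replaces a diagonal
  subsequence, since the index type may be uncountable.\<close>

lemma cluster_filter:
  fixes \<phi> :: "'n \<Rightarrow> 'i \<Rightarrow> real"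
  assumes F: "F \<noteq> bot" and bd: "\<And>N i. \<phi> N i \<in> {0..1}"
  obtains G x where "G \<le> F" "G \<noteq> bot" "\<And>i. ((\<lambda>N. \<phi> N i) \<longlongrightarrow> x i) G"
proof -
  define K :: "('i \<Rightarrow> real) set" where "K = (\<Pi>\<^sub>E i\<in>UNIV. {0..1})"
  have "compactin (product_topology (\<lambda>i::'i. euclidean) UNIV) K"
    unfolding K_def by (subst compactin_PiE) (auto simp: compactin_euclidean_iff)
  then have "compact K" by (simp add: euclidean_product_topology compactin_euclidean_iff)
  moreover have "filtermap \<phi> F \<noteq> bot" using F by (simp add: filtermap_bot_iff)
  moreover have "eventually (\<lambda>x. x \<in> K) (filtermap \<phi> F)"
    using bd by (auto simp: eventually_filtermap K_def PiE_def extensional_def)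
  ultimately obtain x where x: "inf (nhds x) (filtermap \<phi> F) \<noteq> bot"
    unfolding compact_filter by blast
  define G where "G = inf (filtercomap \<phi> (nhds x)) F"
  have "G \<noteq> bot"
  proof
    assume "G = bot"
    then have "eventually (\<lambda>_. False) G" by simp
    then obtain P Q where PQ: "eventually P (filtercomap \<phi> (nhds x))" "eventually Q F" "\<And>N. P N \<Longrightarrow> Q N \<Longrightarrow> False"
      unfolding G_def eventually_inf by auto
    then obtain P' where P': "eventually P' (nhds x)" "\<And>N. P' (\<phi> N) \<Longrightarrow> P N"
      by (auto simp: eventually_filtercomap)
    have "eventually (\<lambda>y. \<not> P' y) (filtermap \<phi> F)"
      unfolding eventually_filtermap using PQ(2) by eventually_elim (use PQ(3) P'(2) in blast)
    then have "eventually (\<lambda>_. False) (inf (nhds x) (filtermap \<phi> F))"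
      unfolding eventually_inf using P'(1) by blast
    then show False using x by (simp add: trivial_limit_def)
  qed
  moreover have "G \<le> F" by (simp add: G_def)
  moreover have "((\<lambda>N. \<phi> N i) \<longlongrightarrow> x i) G" for i
  proof -
    have "filterlim \<phi> (nhds x) G"
      unfolding G_def by (rule filterlim_mono[OF filterlim_filtercomap order_refl inf_le1])
    moreover have "((\<lambda>y. y i) \<longlongrightarrow> x i) (nhds x)"
    proof (rule topological_tendstoI)
      fix W :: "real set" assume W: "open W" "x i \<in> W"
      have "open ((\<lambda>y::'i \<Rightarrow> real. y i) -` W)" using W(1) continuous_on_product_coordinates by (rule open_vimage)
      then show "eventually (\<lambda>y. y i \<in> W) (nhds x)" unfolding eventually_nhds using W(2) by (metis vimage_eq)
    qed
    ultimately show ?thesis by (rule filterlim_compose[rotated])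
  qed
  ultimately show ?thesis using that by blast
qed

text \<open>Finite additivity passes to the limit, and on an algebra of compact closed sets
  countable additivity is automatic: by compactness a decreasing sequence with empty intersection is
  eventually empty. Caratheodory's theorem then extends the limit.\<close>

lemma limit_measure:
  fixes X :: "'a::topological_space set" and \<mu> :: "'n \<Rightarrow> 'a set \<Rightarrow> real"
  assumes A: "algebra X \<A>" and comp: "\<And>A. A \<in> \<A> \<Longrightarrow> compact A \<and> closed A" and F: "F \<noteq> bot"
    and nonneg: "\<And>N A. 0 \<le> \<mu> N A"
    and add: "\<And>N A B. A \<inter> B = {} \<Longrightarrow> \<mu> N (A \<union> B) = \<mu> N A + \<mu> N B"
    and total: "\<And>N. \<mu> N X = 1"
  obtains G L where "G \<le> F" "G \<noteq> bot" "prob_space L" "space L = X" "sets L = sigma_sets X \<A>"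
    "\<And>A. A \<in> \<A> \<Longrightarrow> ((\<lambda>N. \<mu> N A) \<longlongrightarrow> measure L A) G"
proof -
  interpret algebra X \<A> by (rule A)
  have le1: "\<mu> N A \<le> 1" if "A \<in> \<A>" for N A
  proof -
    have "A \<subseteq> X" using that space_closed by auto
    then have "A \<union> (X - A) = X" by auto
    then have "\<mu> N A + \<mu> N (X - A) = 1" using add[of A "X - A" N] total[of N] by simp
    then show ?thesis using nonneg[of N "X - A"] by linarith
  qed
  define \<phi> where "\<phi> N A = (if A \<in> \<A> then \<mu> N A else 0)" for N A
  have "\<phi> N A \<in> {0..1}" for N A using nonneg le1 by (auto simp: \<phi>_def)
  then obtain G x where G: "G \<le> F" "G \<noteq> bot" and x: "\<And>A. ((\<lambda>N. \<phi> N A) \<longlongrightarrow> x A) G"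
    using cluster_filter[OF F] by metis
  have lim: "((\<lambda>N. \<mu> N A) \<longlongrightarrow> x A) G" if "A \<in> \<A>" for A
    using x[of A] that by (simp add: \<phi>_def)
  have x0: "x A \<ge> 0" if "A \<in> \<A>" for A
    using tendsto_lowerbound[OF lim[OF that] _ G(2), of 0] nonneg by simp
  have xadd: "x (A \<union> B) = x A + x B" if "A \<in> \<A>" "B \<in> \<A>" "A \<inter> B = {}" for A B
  proof -
    have "((\<lambda>N. \<mu> N (A \<union> B)) \<longlongrightarrow> x A + x B) G"
      unfolding add[OF that(3)] by (intro tendsto_add lim that)
    then show ?thesis using lim[of "A \<union> B"] that G(2) by (intro tendsto_unique[OF G(2)]) auto
  qed
  have "\<mu> N {} = 0" for N using add[of "{}" "{}" N] by simp
  then have xe: "x {} = 0" using lim[of "{}"] G(2) by (simp add: tendsto_const_iff)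
  have xX: "x X = 1" using lim[of X] G(2) total by (simp add: tendsto_const_iff)
  have "\<exists>m :: 'a set \<Rightarrow> ennreal. (\<forall>A\<in>\<A>. m A = ennreal (x A)) \<and> measure_space X (sigma_sets X \<A>) m"
  proof (rule caratheodory_empty_continuous)
    show "positive \<A> (\<lambda>A. ennreal (x A))" using xe by (simp add: positive_def)
    show "additive \<A> (\<lambda>A. ennreal (x A))" using xadd x0 by (auto simp: additive_def)
    show "(\<lambda>i. ennreal (x (A i))) \<longlonglongrightarrow> 0" if A: "range A \<subseteq> \<A>" "decseq A" "(\<Inter>i. A i) = {}" for A :: "nat \<Rightarrow> 'a set"
    proof -
      have "\<exists>i. A i = {}"
      proof (rule ccontr)
        assume ne: "\<not> ?thesis"
        have "A 0 \<inter> \<Inter>(range A) \<noteq> {}"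
        proof (rule compact_imp_fip)
          show "compact (A 0)" using A comp by auto
          show "closed T" if "T \<in> range A" for T using that A comp by auto
          fix F' assume F': "finite F'" "F' \<subseteq> range A"
          then obtain I where I: "finite I" "F' = A ` I" by (meson finite_subset_image)
          define k where "k = Max (insert 0 I)"
          have "A k \<subseteq> A i" if "i \<in> insert 0 I" for i
          proof -
            have "i \<le> k" using that I(1) by (simp add: k_def)
            with A(2) show ?thesis by (rule decseqD)
          qed
          then have "A k \<subseteq> A 0 \<inter> \<Inter>F'" using I by auto
          then show "A 0 \<inter> \<Inter>F' \<noteq> {}" using ne by blast
        qed
        then show False using A(3) by auto
      qed
      then obtain i where i: "A i = {}" by auto
      have "A j = {}" if "j \<ge> i" for j using decseqD[OF A(2) that] i by auto
      then have "\<forall>\<^sub>F j in sequentially. ennreal (x (A j)) = 0"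
        using xe by (auto intro!: eventually_sequentiallyI[of i])
      then show ?thesis by (rule tendsto_eventually)
    qed
  qed auto
  then obtain m :: "'a set \<Rightarrow> ennreal" where m: "\<And>A. A \<in> \<A> \<Longrightarrow> m A = ennreal (x A)" "measure_space X (sigma_sets X \<A>) m"
    by blast
  define L where "L = measure_of X (sigma_sets X \<A>) m"
  have "sigma_sets X \<A> \<subseteq> Pow X" using sigma_sets_into_sp[OF space_closed] by auto
  then have sp: "space L = X" and st: "sets L = sigma_sets X \<A>"
    by (simp_all add: L_def space_measure_of sets_measure_of sigma_sets_sigma_sets_eq[OF space_closed])
  have em: "emeasure L A = m A" if "A \<in> sigma_sets X \<A>" for A
    unfolding L_def using m(2) that by (intro emeasure_measure_of_sigma) (auto simp: measure_space_def)
  have meas: "measure L A = x A" if "A \<in> \<A>" for A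
    using em[of A] m(1)[OF that] that x0[OF that] by (simp add: measure_def sigma_sets.Basic)
  have "prob_space L"
    by (rule prob_spaceI) (use em[of X] m(1)[of X] xX sp in \<open>simp add: sigma_sets.Basic\<close>)
  then show ?thesis using that[of G L] G sp st lim meas by auto
qed

section \<open>Weak mixing and measures invariant under a power of the map\<close>

lemma invariant_funpow:
  assumes "invariant_measure M S"
  shows "invariant_measure M (S ^^ n)"
proof -
  have S: "S \<in> M \<rightarrow>\<^sub>M M" "distr M M S = M" using assms by (auto simp: invariant_measure_def)
  have meas: "(S ^^ n) \<in> M \<rightarrow>\<^sub>M M" for n by (rule measurable_compose_n[OF S(1)])
  have "distr M M (S ^^ n) = M"
  proof (induction n)
    case (Suc n)
    have "distr M M (S \<circ> (S ^^ n)) = distr (distr M M (S ^^ n)) M S"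
      by (rule distr_distr[symmetric, OF S(1) meas])
    then show ?case using Suc S(2) by (simp only: funpow.simps)
  qed (simp add: distr_id id_def)
  then show ?thesis using meas by (simp add: invariant_measure_def)
qed

lemma invariant_measure_vimage:
  assumes "invariant_measure M S" "A \<in> sets M"
  shows "measure M (S -` A \<inter> space M) = measure M A"
  using assms measure_distr[of S M M A] by (simp add: invariant_measure_def)

text \<open>For fixed n every distance between n and n' occurs at most twice.\<close>

lemma sum_sum_dist_le:
  fixes c :: "nat \<Rightarrow> real"
  assumes "\<And>k. c k \<ge> 0"
  shows "(\<Sum>n<R. \<Sum>n'<R. c (if n \<le> n' then n' - n else n - n')) \<le> 2 * real R * (\<Sum>k<R. c k)"
proof -
  have "(\<Sum>n'<R. c (if n \<le> n' then n' - n else n - n')) \<le> 2 * (\<Sum>k<R. c k)" if n: "n < R" for n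
  proof -
    have "{..<R} = {..<n} \<union> {n..<R}" using n by auto
    then have "(\<Sum>n'<R. c (if n \<le> n' then n' - n else n - n')) =
       (\<Sum>n'<n. c (if n \<le> n' then n' - n else n - n')) + (\<Sum>n'=n..<R. c (if n \<le> n' then n' - n else n - n'))"
      by (simp add: sum.union_disjoint ivl_disj_int)
    also have "(\<Sum>n'<n. c (if n \<le> n' then n' - n else n - n')) = (\<Sum>k\<in>(\<lambda>n'. n - n') ` {..<n}. c k)"
      by (subst sum.reindex) (auto simp: inj_on_def)
    also have "\<dots> \<le> (\<Sum>k<R. c k)"
    proof (cases "n = 0")
      case False
      then show ?thesis using assms n by (intro sum_mono2) auto
    qed (use assms in \<open>simp add: sum_nonneg\<close>)
    also have "(\<Sum>n'=n..<R. c (if n \<le> n' then n' - n else n - n')) = (\<Sum>k\<in>(\<lambda>n'. n' - n) ` {n..<R}. c k)"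
      by (subst sum.reindex) (auto simp: inj_on_def)
    also have "\<dots> \<le> (\<Sum>k<R. c k)" using assms by (intro sum_mono2) auto
    finally show ?thesis by simp
  qed
  then have "(\<Sum>n<R. \<Sum>n'<R. c (if n \<le> n' then n' - n else n - n')) \<le> (\<Sum>n<R. 2 * (\<Sum>k<R. c k))"
    by (intro sum_mono) auto
  then show ?thesis by simp
qed

text \<open>If the average of \<open>\<nu>\<close> over \<open>q\<close> consecutive times agrees with a weakly mixing \<open>M\<close> on the
  correlations of \<open>A\<close>, then \<open>\<nu> A = M A\<close>: the variance of the ergodic sums of \<open>A\<close> along multiples
  of \<open>q\<close> is at most \<open>q\<close> times larger for \<open>\<nu>\<close> than for \<open>M\<close>.\<close>
lemma weakly_mixing_determines:
  assumes M: "prob_space M" "invariant_measure M S" and wm: "weakly_mixing M S"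
    and \<nu>: "prob_space \<nu>" "sets \<nu> = sets M" and q: "q \<ge> 1" and A: "A \<in> sets M"
    and inv: "\<And>n. measure \<nu> ((S ^^ (q * n)) -` A \<inter> space M) = measure \<nu> A"
    and avg1: "\<And>n. (\<Sum>i<q. measure \<nu> ((S ^^ i) -` ((S ^^ (q * n)) -` A) \<inter> space M)) = real q * measure M ((S ^^ (q * n)) -` A \<inter> space M)"
    and avg2: "\<And>n n'. (\<Sum>i<q. measure \<nu> ((S ^^ i) -` ((S ^^ (q * n)) -` A \<inter> (S ^^ (q * n')) -` A) \<inter> space M))
       = real q * measure M ((S ^^ (q * n)) -` A \<inter> (S ^^ (q * n')) -` A \<inter> space M)"
  shows "measure \<nu> A = measure M A"
proof -
  interpret M: prob_space M by (rule M)
  interpret \<nu>: prob_space \<nu> by (rule \<nu>)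
  define \<alpha> where "\<alpha> = measure M A"
  define c where "c k = \<bar>measure M (((S ^^ k) -` A \<inter> space M) \<inter> A) - \<alpha> * \<alpha>\<bar>" for k
  have sp: "space \<nu> = space M" using \<nu>(2) by (rule sets_eq_imp_space_eq)
  have Sm: "(S ^^ n) \<in> M \<rightarrow>\<^sub>M M" for n using invariant_funpow[OF M(2)] by (simp add: invariant_measure_def)
  then have S\<nu>: "(S ^^ n) \<in> \<nu> \<rightarrow>\<^sub>M M" for n using \<nu>(2) by (simp cong: measurable_cong_sets)
  have inv_meas: "measure M ((S ^^ n) -` B \<inter> space M) = measure M B" if "B \<in> sets M" for n B
    using invariant_funpow[OF M(2)] that by (rule invariant_measure_vimage)
  have space_in: "(S ^^ n) x \<in> space M" if "x \<in> space M" for n x using measurable_space[OF Sm that] .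
  define g where "g n x = indicator A ((S ^^ (q * n)) x) - \<alpha>" for n x
  have g_meas: "(\<lambda>x. g n ((S ^^ i) x)) \<in> borel_measurable \<nu>" for n i
    unfolding g_def using A S\<nu> Sm by (intro borel_measurable_diff borel_measurable_const
      measurable_compose[OF S\<nu>] measurable_compose[OF Sm] borel_measurable_indicator)
  have g_bd: "\<bar>g n x\<bar> \<le> 1" for n x using M.prob_le_1[of A] measure_nonneg[of M A]
    by (auto simp: g_def \<alpha>_def indicator_def)
  have corr: "(\<integral>x. g n ((S ^^ i) x) * g n' ((S ^^ i) x) \<partial>\<nu>) =
     measure \<nu> ((S ^^ i) -` ((S ^^ (q * n)) -` A \<inter> (S ^^ (q * n')) -` A) \<inter> space M)
     - \<alpha> * measure \<nu> ((S ^^ i) -` ((S ^^ (q * n)) -` A) \<inter> space M)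
     - \<alpha> * measure \<nu> ((S ^^ i) -` ((S ^^ (q * n')) -` A) \<inter> space M) + \<alpha> * \<alpha>" for n n' i
  proof -
    define E where "E n = (S ^^ i) -` ((S ^^ (q * n)) -` A) \<inter> space M" for n
    have E: "E n \<in> sets \<nu>" for n
    proof -
      have "(S ^^ (q * n)) -` A \<inter> space M \<in> sets M" using measurable_sets[OF Sm A] .
      then have "(S ^^ i) -` ((S ^^ (q * n)) -` A \<inter> space M) \<inter> space M \<in> sets M" using measurable_sets[OF Sm] by blast
      moreover have "(S ^^ i) -` ((S ^^ (q * n)) -` A \<inter> space M) \<inter> space M = E n" using space_in by (auto simp: E_def)
      ultimately show ?thesis using \<nu>(2) by simp
    qed
    have EE: "E n \<inter> E n' = (S ^^ i) -` ((S ^^ (q * n)) -` A \<inter> (S ^^ (q * n')) -` A) \<inter> space M" by (auto simp: E_def)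
    have "(\<integral>x. g n ((S ^^ i) x) * g n' ((S ^^ i) x) \<partial>\<nu>) =
        (\<integral>x. indicator (E n \<inter> E n') x - \<alpha> * indicator (E n) x - \<alpha> * indicator (E n') x + \<alpha> * \<alpha> \<partial>\<nu>)"
      by (intro Bochner_Integration.integral_cong) (auto simp: g_def E_def sp indicator_def algebra_simps)
    also have "\<dots> = measure \<nu> (E n \<inter> E n') - \<alpha> * measure \<nu> (E n) - \<alpha> * measure \<nu> (E n') + \<alpha> * \<alpha>"
      using E \<nu>.prob_space by (simp add: \<nu>.emeasure_eq_measure sets.Int)
    finally show ?thesis unfolding EE by (simp add: E_def)
  qed
  \<comment> \<open>By \<open>avg1\<close> and \<open>avg2\<close> the sum over i becomes a
    covariance for \<open>M\<close>, and by invariance this depends only on the distance of n and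
    n'.\<close>
  have sumcorr: "(\<Sum>i<q. \<integral>x. g n ((S ^^ i) x) * g n' ((S ^^ i) x) \<partial>\<nu>) \<le> real q * c (q * (if n \<le> n' then n' - n else n - n'))" for n n'
  proof -
    have le: "measure M ((S ^^ (q * a)) -` A \<inter> (S ^^ (q * b)) -` A \<inter> space M) - \<alpha> * \<alpha> \<le> c (q * (b - a))" if "a \<le> b" for a b
    proof -
      have "(S ^^ (q * b)) x = (S ^^ (q * (b - a))) ((S ^^ (q * a)) x)" for x
        using that by (metis add.commute comp_apply diff_mult_distrib2 funpow_add le_add_diff_inverse mult_le_mono2)
      then have eqset: "(S ^^ (q * a)) -` A \<inter> (S ^^ (q * b)) -` A \<inter> space M =
          (S ^^ (q * a)) -` (((S ^^ (q * (b - a))) -` A \<inter> space M) \<inter> A) \<inter> space M"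
        using space_in by auto
      have mem: "((S ^^ (q * (b - a))) -` A \<inter> space M) \<inter> A \<in> sets M" using measurable_sets[OF Sm A] A by blast
      have "measure M ((S ^^ (q * a)) -` A \<inter> (S ^^ (q * b)) -` A \<inter> space M) = measure M (((S ^^ (q * (b - a))) -` A \<inter> space M) \<inter> A)"
        unfolding eqset by (rule inv_meas[OF mem])
      then show ?thesis by (simp add: c_def)
    qed
    have "(\<Sum>i<q. \<integral>x. g n ((S ^^ i) x) * g n' ((S ^^ i) x) \<partial>\<nu>) =
        real q * measure M ((S ^^ (q * n)) -` A \<inter> (S ^^ (q * n')) -` A \<inter> space M)
        - \<alpha> * (real q * measure M ((S ^^ (q * n)) -` A \<inter> space M)) - \<alpha> * (real q * measure M ((S ^^ (q * n')) -` A \<inter> space M)) + real q * (\<alpha> * \<alpha>)"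
      unfolding corr sum.distrib sum_subtractf sum_distrib_left[symmetric] avg1 avg2 by simp
    also have "\<dots> = real q * (measure M ((S ^^ (q * n)) -` A \<inter> (S ^^ (q * n')) -` A \<inter> space M) - \<alpha> * \<alpha>)"
      using inv_meas[OF A] by (simp add: \<alpha>_def algebra_simps)
    also have "\<dots> \<le> real q * c (q * (if n \<le> n' then n' - n else n - n'))"
      using le[of n n'] le[of n' n] by (intro mult_left_mono) (auto simp: Int_commute)
    finally show ?thesis .
  qed
  define V where "V R x = (\<Sum>n<R. g n x)" for R x
  have Vm: "(\<lambda>x. V R ((S ^^ i) x)) \<in> borel_measurable \<nu>" for R i
    unfolding V_def using g_meas by (intro borel_measurable_sum)
  have Vbd: "\<bar>V R x\<bar> \<le> real R" for R x
  proof -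
    have "\<bar>V R x\<bar> \<le> (\<Sum>n<R. 1)" unfolding V_def by (rule order_trans[OF sum_abs sum_mono]) (rule g_bd)
    then show ?thesis by simp
  qed
  have bound: "(measure \<nu> A - \<alpha>)\<^sup>2 \<le> 2 * real q * real q * ((\<Sum>k<q * R. c k) / real (q * R))" if R: "R > 0" for R
  proof -
    have Vint: "integrable \<nu> (V R)" "integrable \<nu> (\<lambda>x. (V R ((S ^^ i) x))\<^sup>2)" for i
    proof -
      show "integrable \<nu> (V R)"
        by (rule \<nu>.integrable_const_bound[where B = "real R"]) (use Vbd Vm[of R 0] in auto)
      show "integrable \<nu> (\<lambda>x. (V R ((S ^^ i) x))\<^sup>2)"
      proof (rule \<nu>.integrable_const_bound[where B = "(real R)\<^sup>2"])
        show "AE x in \<nu>. norm ((V R ((S ^^ i) x))\<^sup>2) \<le> (real R)\<^sup>2"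
          using Vbd by (intro AE_I2) (simp add: power2_le_iff_abs_le)
        show "(\<lambda>x. (V R ((S ^^ i) x))\<^sup>2) \<in> borel_measurable \<nu>" using Vm[of R i] by measurable
      qed
    qed
    have gint: "integrable \<nu> (\<lambda>x. g n ((S ^^ i) x) * g n' ((S ^^ i) x))" for n n' i
      by (rule \<nu>.integrable_const_bound[where B = 1])
        (use g_meas g_bd in \<open>auto simp: abs_mult intro!: mult_le_one borel_measurable_times\<close>)
    have gint1: "integrable \<nu> (g n)" for n
      by (rule \<nu>.integrable_const_bound[where B = 1]) (use g_meas[of n 0] g_bd in auto)
    have "(\<integral>x. V R x \<partial>\<nu>) = (\<Sum>n<R. \<integral>x. g n x \<partial>\<nu>)" unfolding V_def using gint1 by (intro Bochner_Integration.integral_sum)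
    also have "\<dots> = (\<Sum>n<R. measure \<nu> A - \<alpha>)"
    proof (rule sum.cong[OF refl])
      fix n
      have E: "(S ^^ (q * n)) -` A \<inter> space M \<in> sets \<nu>" using measurable_sets[OF Sm A] \<nu>(2) by simp
      have "(\<integral>x. g n x \<partial>\<nu>) = (\<integral>x. indicator ((S ^^ (q * n)) -` A \<inter> space M) x - \<alpha> \<partial>\<nu>)"
        by (intro Bochner_Integration.integral_cong) (auto simp: g_def sp indicator_def)
      also have "\<dots> = measure \<nu> ((S ^^ (q * n)) -` A \<inter> space M) - \<alpha>"
        using E \<nu>.prob_space by (simp add: \<nu>.emeasure_eq_measure)
      finally show "(\<integral>x. g n x \<partial>\<nu>) = measure \<nu> A - \<alpha>" using inv by simp
    qed
    finally have EV: "(\<integral>x. V R x \<partial>\<nu>) = real R * (measure \<nu> A - \<alpha>)" by simp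
    have "(\<integral>x. V R x \<partial>\<nu>)\<^sup>2 \<le> (\<integral>x. (V R x)\<^sup>2 \<partial>\<nu>)"
      using \<nu>.variance_eq[of "V R"] Vint(1) Vint(2)[of 0] \<nu>.variance_positive[of "V R"] by simp
    also have "\<dots> = (\<integral>x. (V R ((S ^^ 0) x))\<^sup>2 \<partial>\<nu>)" by simp
    \<comment> \<open>Adding the other translates can only increase the integral of a square, and it
      brings in the sum over q times, which is what \<open>avg1\<close> and \<open>avg2\<close> know
      about.\<close>
    also have "\<dots> \<le> (\<Sum>i<q. \<integral>x. (V R ((S ^^ i) x))\<^sup>2 \<partial>\<nu>)"
      using q by (intro member_le_sum) auto
    also have "\<dots> = (\<Sum>i<q. \<Sum>n<R. \<Sum>n'<R. \<integral>x. g n ((S ^^ i) x) * g n' ((S ^^ i) x) \<partial>\<nu>)"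
      unfolding V_def power2_eq_square sum_product using gint by (simp add: Bochner_Integration.integral_sum)
    also have "\<dots> = (\<Sum>n<R. \<Sum>n'<R. \<Sum>i<q. \<integral>x. g n ((S ^^ i) x) * g n' ((S ^^ i) x) \<partial>\<nu>)"
      by (subst sum.swap, rule sum.cong[OF refl], rule sum.swap)
    also have "\<dots> \<le> (\<Sum>n<R. \<Sum>n'<R. real q * c (q * (if n \<le> n' then n' - n else n - n')))"
      by (intro sum_mono sumcorr)
    also have "\<dots> = real q * (\<Sum>n<R. \<Sum>n'<R. c (q * (if n \<le> n' then n' - n else n - n')))"
      by (simp only: sum_distrib_left)
    also have "\<dots> \<le> real q * (2 * real R * (\<Sum>k<R. c (q * k)))"
      using sum_sum_dist_le[of "\<lambda>k. c (q * k)" R] by (intro mult_left_mono) (auto simp: c_def)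
    \<comment> \<open>The terms are nonnegative, so weak mixing of \<open>S\<close> already controls
      the correlations of its q-th power.\<close>
    also have "(\<Sum>k<R. c (q * k)) \<le> (\<Sum>k<q * R. c k)"
    proof -
      have "(\<Sum>k<R. c (q * k)) = (\<Sum>k\<in>(*) q ` {..<R}. c k)" using q by (subst sum.reindex) (auto simp: inj_on_def)
      also have "\<dots> \<le> (\<Sum>k<q * R. c k)" using q by (intro sum_mono2) (auto simp: c_def)
      finally show ?thesis .
    qed
    finally have "(real R)\<^sup>2 * (measure \<nu> A - \<alpha>)\<^sup>2 \<le> real q * (2 * real R * (\<Sum>k<q * R. c k))"
      using q R unfolding EV by (simp add: power_mult_distrib)
    also have "\<dots> = (real R)\<^sup>2 * (2 * real q * real q * ((\<Sum>k<q * R. c k) / real (q * R)))"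
      using q R by (simp add: power2_eq_square field_simps)
    finally show ?thesis using R by (subst (asm) mult_le_cancel_left_pos) auto
  qed
  have "(\<lambda>N. (\<Sum>k<N. c k) / real N) \<longlonglongrightarrow> 0"
    using wm A unfolding weakly_mixing_def c_def \<alpha>_def by blast
  then have "(\<lambda>R. (\<Sum>k<q * R. c k) / real (q * R)) \<longlonglongrightarrow> 0"
    by (rule filterlim_compose) (use q in \<open>auto intro!: filterlim_subseq strict_monoI\<close>)
  then have "(\<lambda>R. 2 * real q * real q * ((\<Sum>k<q * R. c k) / real (q * R))) \<longlonglongrightarrow> 2 * real q * real q * 0"
    by (intro tendsto_intros)
  then have "(measure \<nu> A - \<alpha>)\<^sup>2 \<le> 2 * real q * real q * 0"
    by (rule LIMSEQ_le_const, intro exI[of _ 1] allI impI, intro bound) simp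
  then show ?thesis by (simp add: \<alpha>_def)
qed

section \<open>Local sets\<close>

lemma local_set_mono: "local_set w C \<Longrightarrow> w \<le> w' \<Longrightarrow> local_set w' C"
  unfolding local_set_def by (meson le_trans nat_int_comparison(3) of_nat_mono order_trans)

lemma local_set_Compl: "local_set w C \<Longrightarrow> local_set w (- C)"
  unfolding local_set_def by blast

lemma local_set_Int: "local_set w C \<Longrightarrow> local_set w D \<Longrightarrow> local_set w (C \<inter> D)"
  unfolding local_set_def by blast

lemma local_set_Diff: "local_set w C \<Longrightarrow> local_set w D \<Longrightarrow> local_set w (C - D)"
  unfolding local_set_def by blast

lemma local_set_UNIV: "local_set w UNIV"
  unfolding local_set_def by blast

lemma local_set_shift:
  assumes "local_set w C"
  shows "local_set (w + n) ((rk_shift ^^ n) -` C)"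
  unfolding local_set_def
proof (intro allI impI)
  fix x y :: "int \<Rightarrow> nat" assume xy: "\<forall>t. \<bar>t\<bar> \<le> int (w + n) \<longrightarrow> x t = y t"
  have "\<forall>t. \<bar>t\<bar> \<le> int w \<longrightarrow> (rk_shift ^^ n) x t = (rk_shift ^^ n) y t"
    using xy by (auto simp: rk_shift_funpow)
  then have "(rk_shift ^^ n) x \<in> C \<longleftrightarrow> (rk_shift ^^ n) y \<in> C"
    using assms unfolding local_set_def by blast
  then show "x \<in> (rk_shift ^^ n) -` C \<longleftrightarrow> y \<in> (rk_shift ^^ n) -` C" by simp
qed

definition nbh :: "nat \<Rightarrow> (int \<Rightarrow> nat) \<Rightarrow> (int \<Rightarrow> nat) set" where
  "nbh w x = {y. \<forall>t. \<bar>t\<bar> \<le> int w \<longrightarrow> y t = x t}"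

lemma open_nbh: "open (nbh w x)"
proof -
  have "nbh w x = (\<Inter>t\<in>{- int w..int w}. (\<lambda>y. y t) -` {x t})"
    by (auto simp: nbh_def abs_le_iff)
  moreover have "open ((\<lambda>y::int \<Rightarrow> nat. y t) -` {x t})" for t
  proof (rule open_vimage)
    show "open {x t}" by (rule Topological_Spaces.open_discrete)
    show "continuous_on UNIV (\<lambda>y::int \<Rightarrow> nat. y t)" by (rule continuous_on_product_coordinates)
  qed
  ultimately show ?thesis by (simp add: open_INT)
qed

lemma nbh_subset: "local_set w C \<Longrightarrow> x \<in> C \<Longrightarrow> nbh w x \<subseteq> C"
  unfolding local_set_def nbh_def by blast

lemma local_set_nbh: "local_set w (nbh w x)"
  unfolding local_set_def nbh_def by auto

lemma nbh_refl: "x \<in> nbh w x" by (simp add: nbh_def)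

lemma open_local_set: "local_set w C \<Longrightarrow> open C"
  unfolding open_subopen[of C]
proof
  fix x assume "local_set w C" "x \<in> C"
  then show "\<exists>T. open T \<and> x \<in> T \<and> T \<subseteq> C"
    by (intro exI[of _ "nbh w x"] conjI open_nbh nbh_refl nbh_subset)
qed

lemma closed_local_set: "local_set w C \<Longrightarrow> closed C"
  using open_local_set[OF local_set_Compl] by (simp add: closed_def)

lemma closed_Omega: "closed (rk_Omega p s)"
proof -
  define E where "E a b = {x. (\<forall>k\<in>{a..b}. x k \<in> {0, 1}) \<and> (\<exists>m\<ge>1. subword (map x [a..b]) (rk_B p s m))}" for a b
  have "rk_Omega p s = (\<Inter>a. \<Inter>b. E a b)"
  proof (intro equalityI subsetI)
    fix x assume x: "x \<in> (\<Inter>a. \<Inter>b. E a b)"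
    then have "x k \<in> {0, 1}" for k by (simp add: E_def) (metis atLeastAtMost_iff order_refl)
    then show "x \<in> rk_Omega p s" using x by (simp add: rk_Omega_def E_def)
  qed (auto simp: rk_Omega_def E_def)
  moreover have clE: "closed (E a b)" for a b
  proof (rule closed_local_set)
    show "local_set (nat (max \<bar>a\<bar> \<bar>b\<bar>)) (E a b)"
      unfolding local_set_def
    proof (intro allI impI)
      fix x y :: "int \<Rightarrow> nat" assume xy: "\<forall>t. \<bar>t\<bar> \<le> int (nat (max \<bar>a\<bar> \<bar>b\<bar>)) \<longrightarrow> x t = y t"
      have eq: "x t = y t" if "t \<in> {a..b}" for t
      proof -
        have "\<bar>t\<bar> \<le> max \<bar>a\<bar> \<bar>b\<bar>" using that by (auto simp: max_def abs_if)
        moreover have "int (nat (max \<bar>a\<bar> \<bar>b\<bar>)) = max \<bar>a\<bar> \<bar>b\<bar>" by (simp add: le_max_iff_disj)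
        ultimately show ?thesis using xy by metis
      qed
      then have eqm: "map x [a..b] = map y [a..b]" by auto
      show "x \<in> E a b \<longleftrightarrow> y \<in> E a b" unfolding E_def mem_Collect_eq eqm using eq by simp
    qed
  qed
  have "closed (\<Inter>a. \<Inter>b. E a b)" by (intro closed_INT ballI clE)
  ultimately show ?thesis by (simp only:)
qed

lemma compact_Omega: "compact (rk_Omega p s)"
proof -
  define K :: "(int \<Rightarrow> nat) set" where "K = (\<Pi>\<^sub>E i\<in>UNIV. {0, 1})"
  have "compactin (product_topology (\<lambda>i::int. euclidean) UNIV) K"
    unfolding K_def by (subst compactin_PiE) (auto simp: compactin_euclidean_iff)
  then have "compact K" by (simp add: euclidean_product_topology compactin_euclidean_iff)
  moreover have "rk_Omega p s \<subseteq> K" unfolding K_def rk_Omega_def PiE_iff extensional_def by blast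
  then have "rk_Omega p s = K \<inter> rk_Omega p s" by blast
  ultimately show ?thesis using closed_Omega compact_Int_closed by metis
qed

lemma local_set_borel: "local_set w C \<Longrightarrow> C \<in> sets borel"
  using open_local_set by simp

lemma sets_restrict_borel_local:
  "sets (restrict_space borel X) = sigma_sets X {C \<inter> X | C w. local_set w C}"
proof -
  let ?E = "{C \<inter> X | C w. local_set w C}"
  define G where "G = {{f\<in>(\<Pi>\<^sub>E i\<in>UNIV. space (borel::nat measure)). f i \<in> A} | i A. i \<in> (UNIV::int set) \<and> A \<in> sets (borel::nat measure)}"
  have borel_eq: "sets (borel :: (int \<Rightarrow> nat) measure) = sigma_sets UNIV G"
    using sets_PiM_equal_borel[where 'a=int and 'b=nat] sets_PiM_single[of "UNIV::int set" "\<lambda>_. borel::nat measure"]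
    unfolding G_def by simp
  have "A \<inter> X \<in> sigma_sets X ?E" if "A \<in> sigma_sets UNIV G" for A
    using that
  proof induction
    case (Basic A)
    then obtain i B where A: "A = {f. f i \<in> B}" by (auto simp: G_def PiE_def extensional_def)
    have "local_set (nat \<bar>i\<bar>) A" unfolding A local_set_def by auto
    then show ?case by (intro sigma_sets.Basic) auto
  next
    case Empty
    then show ?case by (simp add: sigma_sets.Empty)
  next
    case (Compl A)
    have "(UNIV - A) \<inter> X = X - (A \<inter> X)" by auto
    then show ?case using sigma_sets.Compl[OF Compl.IH] by simp
  next
    case (Union A)
    have "(\<Union>i. A i) \<inter> X = (\<Union>i. A i \<inter> X)" by auto
    then show ?case using sigma_sets.Union[of "\<lambda>i. A i \<inter> X"] Union by simp
  qed
  then have "sets (restrict_space borel X) \<subseteq> sigma_sets X ?E"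
    unfolding sets_restrict_space borel_eq by (auto simp: Int_commute)
  moreover have "sigma_sets X ?E \<subseteq> sets (restrict_space borel X)"
  proof -
    have "?E \<subseteq> sets (restrict_space borel X)"
      using local_set_borel by (auto simp: sets_restrict_space)
    then have "sigma_sets (space (restrict_space borel X)) ?E \<subseteq> sets (restrict_space borel X)"
      by (rule sets.sigma_sets_subset)
    then show ?thesis by (simp add: space_restrict_space)
  qed
  ultimately show ?thesis by blast
qed

text \<open>The sets of pairs decided by the coordinates in [-w, w]. Unlike rectangles of local sets
  they form an algebra, as \<open>limit_measure\<close> requires.\<close>

definition local_pair :: "nat \<Rightarrow> ((int \<Rightarrow> nat) \<times> (int \<Rightarrow> nat)) set \<Rightarrow> bool" where
  "local_pair w D \<longleftrightarrow> (\<forall>x y. (x, y) \<in> D \<longrightarrow> nbh w x \<times> nbh w y \<subseteq> D)"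

lemma nbh_mono: "w \<le> w' \<Longrightarrow> nbh w' x \<subseteq> nbh w x"
  by (auto simp: nbh_def)

lemma nbh_sym: "y \<in> nbh w x \<longleftrightarrow> x \<in> nbh w y"
  by (auto simp: nbh_def)

lemma local_pair_mono: "local_pair w D \<Longrightarrow> w \<le> w' \<Longrightarrow> local_pair w' D"
  unfolding local_pair_def using nbh_mono by blast

lemma local_pair_Compl: "local_pair w D \<Longrightarrow> local_pair w (- D)"
  unfolding local_pair_def using nbh_sym by blast

lemma local_pair_Un: "local_pair w D \<Longrightarrow> local_pair w D' \<Longrightarrow> local_pair w (D \<union> D')"
  unfolding local_pair_def by blast

lemma local_pair_Times: "local_set w C \<Longrightarrow> local_set w D \<Longrightarrow> local_pair w (C \<times> D)"
  unfolding local_pair_def using nbh_subset by blast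

lemma local_pair_shift:
  assumes "local_pair w D"
  shows "local_pair (w + q + r) ((\<lambda>(x, y). ((rk_shift ^^ q) x, (rk_shift ^^ r) y)) -` D)"
proof -
  have sh: "(rk_shift ^^ q) y \<in> nbh w ((rk_shift ^^ q) x)" if "y \<in> nbh (w + q + r) x" for x y q r
    using that by (auto simp: nbh_def rk_shift_funpow)
  have sh': "(rk_shift ^^ r) y \<in> nbh w ((rk_shift ^^ r) x)" if "y \<in> nbh (w + q + r) x" for x y
    using sh[of y r q x] that by (simp add: add_ac)
  show ?thesis unfolding local_pair_def using assms[unfolded local_pair_def] sh sh' by fast
qed

lemma open_local_pair: "local_pair w D \<Longrightarrow> open D"
  unfolding open_subopen[of D]
proof
  fix z assume D: "local_pair w D" "z \<in> D"
  have "open (nbh w (fst z) \<times> nbh w (snd z))" by (intro open_Times open_nbh)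
  moreover have "z \<in> nbh w (fst z) \<times> nbh w (snd z)" by (simp add: mem_Times_iff nbh_refl)
  moreover have "nbh w (fst z) \<times> nbh w (snd z) \<subseteq> D" using D unfolding local_pair_def by (metis prod.collapse)
  ultimately show "\<exists>T. open T \<and> z \<in> T \<and> T \<subseteq> D" by blast
qed

lemma closed_local_pair: "local_pair w D \<Longrightarrow> closed D"
  using open_local_pair[OF local_pair_Compl] by (simp add: closed_def)

lemma finite_nbh:
  assumes "X \<subseteq> {x. \<forall>k. x k \<in> {0, 1}}"
  shows "finite ((\<lambda>x. nbh w x) ` X)"
proof -
  define W where "W = {- int w..int w}"
  have X01: "x k = 0 \<or> x k = 1" if "x \<in> X" for x k using assms that by auto
  have "finite ((\<lambda>x. restrict x W) ` X)"
  proof (rule finite_subset)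
    show "(\<lambda>x. restrict x W) ` X \<subseteq> (\<Pi>\<^sub>E k\<in>W. {0, 1})"
    proof (intro image_subsetI)
      fix x assume "x \<in> X"
      then show "restrict x W \<in> (\<Pi>\<^sub>E k\<in>W. {0, 1})" using X01[of x] unfolding restrict_PiE_iff by blast
    qed
    show "finite (\<Pi>\<^sub>E k\<in>W. {0, 1::nat})" by (intro finite_PiE) (auto simp: W_def)
  qed
  moreover have "nbh w x = {y. \<forall>t\<in>W. y t = (restrict x W) t}" for x
    by (auto simp: nbh_def W_def abs_le_iff)
  then have "(\<lambda>x. nbh w x) ` X = (\<lambda>f. {y. \<forall>t\<in>W. y t = f t}) ` ((\<lambda>x. restrict x W) ` X)"
    by (simp add: image_image)
  ultimately show ?thesis by simp
qed

text \<open>Over {0, 1} there are only finitely many cylinders of radius \<open>w\<close>, so a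
  local set of pairs meets X \<times> X in a finite union of measurable rectangles.\<close>

lemma sets_pair_local:
  assumes X: "X \<subseteq> {x. \<forall>k. x k \<in> {0, 1}}"
    and M: "sets M = sets (restrict_space borel X)"
  shows "sets (M \<Otimes>\<^sub>M M) = sigma_sets (X \<times> X) {D \<inter> (X \<times> X) | D w. local_pair w D}"
proof -
  let ?E = "{C \<inter> X | C w. local_set w C}" and ?D = "{D \<inter> (X \<times> X) | D w. local_pair w D}"
  have sp: "space M = X" using sets_eq_imp_space_eq[OF M] by (simp add: space_restrict_space)
  have gen: "sets M = sigma_sets (space M) ?E" unfolding M sp by (rule sets_restrict_borel_local)
  have XE: "X \<in> ?E" using local_set_UNIV by blast
  have "sets (M \<Otimes>\<^sub>M M) = sets (sigma (space M \<times> space M) {a \<times> b | a b. a \<in> ?E \<and> b \<in> ?E})"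
    by (rule sets_pair_eq[where Ca = "{X}" and Cb = "{X}"]) (use gen XE sp in auto)
  also have "\<dots> = sigma_sets (X \<times> X) {a \<times> b | a b. a \<in> ?E \<and> b \<in> ?E}"
    unfolding sp by (rule sets_measure_of) auto
  finally have eq: "sets (M \<Otimes>\<^sub>M M) = sigma_sets (X \<times> X) {a \<times> b | a b. a \<in> ?E \<and> b \<in> ?E}" .
  have "{a \<times> b | a b. a \<in> ?E \<and> b \<in> ?E} \<subseteq> ?D"
  proof safe
    fix C w D w' assume "local_set w C" "local_set w' D"
    then have "local_pair (max w w') (C \<times> D)"
      by (intro local_pair_Times) (auto elim: local_set_mono)
    moreover have "(C \<inter> X) \<times> (D \<inter> X) = (C \<times> D) \<inter> (X \<times> X)" by auto
    ultimately show "\<exists>Da w. (C \<inter> X) \<times> (D \<inter> X) = Da \<inter> X \<times> X \<and> local_pair w Da" by blast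
  qed
  then have "sets (M \<Otimes>\<^sub>M M) \<subseteq> sigma_sets (X \<times> X) ?D" unfolding eq by (rule sigma_sets_mono')
  moreover have "sigma_sets (X \<times> X) ?D \<subseteq> sets (M \<Otimes>\<^sub>M M)"
  proof -
    have "?D \<subseteq> sets (M \<Otimes>\<^sub>M M)"
    proof safe
      fix D w assume D: "local_pair w D"
      define F where "F = {(U, V). U \<in> nbh w ` X \<and> V \<in> nbh w ` X \<and> U \<times> V \<subseteq> D}"
      have "finite F" by (rule finite_subset[of _ "nbh w ` X \<times> nbh w ` X"]) (use finite_nbh[OF X] in \<open>auto simp: F_def\<close>)
      have "D \<inter> X \<times> X = (\<Union>(U, V)\<in>F. (U \<inter> X) \<times> (V \<inter> X))"
      proof (intro equalityI subsetI)
        fix z assume z: "z \<in> D \<inter> X \<times> X"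
        then obtain x y where xy: "z = (x, y)" "(x, y) \<in> D" "x \<in> X" "y \<in> X" by auto
        then have "(nbh w x, nbh w y) \<in> F" using D by (auto simp: F_def local_pair_def)
        then show "z \<in> (\<Union>(U, V)\<in>F. (U \<inter> X) \<times> (V \<inter> X))" using xy nbh_refl[of x w] nbh_refl[of y w]
          by (intro UN_I[of "(nbh w x, nbh w y)"]) auto
      qed (auto simp: F_def)
      also have "\<dots> \<in> sets (M \<Otimes>\<^sub>M M)"
      proof (rule sets.finite_UN[OF \<open>finite F\<close>])
        fix UV assume "UV \<in> F"
        then obtain x y where "UV = (nbh w x, nbh w y)" by (auto simp: F_def)
        moreover have "nbh w z \<inter> X \<in> sets M" for z
          unfolding gen sp using local_set_nbh by (intro sigma_sets.Basic) blast
        ultimately show "(case UV of (U, V) \<Rightarrow> (U \<inter> X) \<times> (V \<inter> X)) \<in> sets (M \<Otimes>\<^sub>M M)" by auto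
      qed
      finally show "D \<inter> X \<times> X \<in> sets (M \<Otimes>\<^sub>M M)" .
    qed
    then have "sigma_sets (space (M \<Otimes>\<^sub>M M)) ?D \<subseteq> sets (M \<Otimes>\<^sub>M M)" by (rule sets.sigma_sets_subset)
    then show ?thesis by (simp add: space_pair_measure sp)
  qed
  ultimately show ?thesis by blast
qed

section \<open>Frequencies along orbits\<close>

text \<open>The complement of a basic neighbourhood of the all-ones point. Block counting controls
  frequencies only inside such sets.\<close>

definition nonones :: "nat \<Rightarrow> (int \<Rightarrow> nat) set" where
  "nonones K = {x. \<exists>t. \<bar>t\<bar> \<le> int K \<and> x t \<noteq> 1}"

lemma local_set_nonones: "local_set K (nonones K)"
  unfolding local_set_def nonones_def by auto

lemma ones_notin_nonones: "(\<lambda>_. 1) \<notin> nonones K"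
  by (simp add: nonones_def)

lemma subset_nonones:
  assumes "local_set w C" "(\<lambda>_. 1) \<notin> C" "w \<le> K"
  shows "C \<subseteq> nonones K"
proof
  fix x assume x: "x \<in> C"
  show "x \<in> nonones K"
  proof (rule ccontr)
    assume "x \<notin> nonones K"
    then have "\<forall>t. \<bar>t\<bar> \<le> int w \<longrightarrow> x t = 1" using assms(3) by (auto simp: nonones_def)
    then show False using assms(1)[unfolded local_set_def, rule_format, of x "\<lambda>_. 1"] assms(2) x by blast
  qed
qed

locale rank_one_system = rank_one +
  fixes M :: "(int \<Rightarrow> nat) measure"
  assumes params: "rank_one_params p s"
    and reas: "reasonable p s"
    and M_sets: "sets M = sets (restrict_space borel (rk_Omega p s))"
    and M_prob: "prob_space M"
    and M_inv: "invariant_measure M rk_shift"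
    and M_nonatomic: "\<forall>x\<in>rk_Omega p s. emeasure M {x} = 0"
begin

sublocale prob_space M by (rule M_prob)

abbreviation "\<Omega> \<equiv> rk_Omega p s"
abbreviation "T \<equiv> rk_shift"

text \<open>The trace on \<Omega> is measured, because local sets live in the ambient space.\<close>

definition Mm :: "(int \<Rightarrow> nat) set \<Rightarrow> real" where "Mm C = measure M (C \<inter> \<Omega>)"

lemma space_M: "space M = \<Omega>"
  using sets_eq_imp_space_eq[OF M_sets] by (simp add: space_restrict_space)

lemma local_in_M: "local_set w C \<Longrightarrow> C \<inter> \<Omega> \<in> sets M"
  unfolding M_sets using local_set_borel[of w C] by (auto simp: sets_restrict_space)

lemma vimage_Omega: "(T ^^ n) -` (C \<inter> \<Omega>) \<inter> \<Omega> = (T ^^ n) -` C \<inter> \<Omega>"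
  using rk_shift_Omega by auto

lemma Mm_shift: "local_set w C \<Longrightarrow> Mm ((T ^^ n) -` C) = Mm C"
  using invariant_measure_vimage[OF invariant_funpow[OF M_inv] local_in_M, of w C n]
  unfolding space_M vimage_Omega by (simp add: Mm_def)

lemma Mm_Compl: "local_set w C \<Longrightarrow> Mm (- C) = 1 - Mm C"
  using prob_compl[OF local_in_M, of w C] by (simp add: Mm_def space_M Diff_eq Int_commute Compl_Int Int_Un_distrib)

lemma Mm_nonneg: "Mm C \<ge> 0" and Mm_le_1: "Mm C \<le> 1"
  by (simp_all add: Mm_def)

lemma Mm_Diff: "local_set w C \<Longrightarrow> local_set w D \<Longrightarrow> C \<subseteq> D \<Longrightarrow> Mm (D - C) = Mm D - Mm C"
  using finite_measure_Diff[OF local_in_M local_in_M, of w D w C]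
  by (simp add: Mm_def Diff_Int_distrib2) blast

text \<open>The bound of \<open>count_le_blk_count\<close> holds along every orbit. Integrated
  against the invariant \<open>M\<close> and divided by N, it gives the claim as N tends to
  infinity.\<close>

lemma Mm_le_blk_count:
  assumes C: "local_set w C" and ones: "(\<lambda>_. 1) \<notin> C" and n: "n \<ge> 1"
  shows "Mm C \<le> real (blk_count w C n + 4 * w) / real (h n)"
proof -
  define v where "v = real (blk_count w C n + 4 * w)"
  have hn: "real (h n) > 0" using h_pos[OF n] by simp
  have *: "real N * Mm C \<le> (real (N + 2 * w) / real (h n) + 4) * v" for N
  proof -
    have meas: "(T ^^ k) -` C \<inter> \<Omega> \<in> sets M" for k by (rule local_in_M[OF local_set_shift[OF C]])
    have "real N * Mm C = (\<Sum>k<N. Mm ((T ^^ k) -` C))" using Mm_shift[OF C] by simp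
    also have "\<dots> = (\<Sum>k<N. \<integral>x. indicator ((T ^^ k) -` C \<inter> \<Omega>) x \<partial>M)"
      using meas by (simp add: Mm_def)
    also have "\<dots> = (\<integral>x. (\<Sum>k<N. indicator ((T ^^ k) -` C \<inter> \<Omega>) x) \<partial>M)"
      by (rule Bochner_Integration.integral_sum[symmetric]) (use meas in \<open>auto simp: emeasure_eq_measure\<close>)
    also have "\<dots> \<le> (real (N + 2 * w) / real (h n) + 4) * v"
    proof (rule integral_le_const)
      show "integrable M (\<lambda>x. \<Sum>k<N. indicator ((T ^^ k) -` C \<inter> \<Omega>) x :: real)"
        by (intro Bochner_Integration.integrable_sum) (use meas in \<open>auto simp: emeasure_eq_measure\<close>)
      show "AE x in M. (\<Sum>k<N. indicator ((T ^^ k) -` C \<inter> \<Omega>) x) \<le> (real (N + 2 * w) / real (h n) + 4) * v"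
      proof (rule AE_I2)
        fix x assume "x \<in> space M"
        then have x: "x \<in> \<Omega>" by (simp add: space_M)
        have "(\<Sum>k<N. indicator ((T ^^ k) -` C \<inter> \<Omega>) x) = real (card {k. k < N \<and> (T ^^ k) x \<in> C})"
        proof -
          have "{k. k < N \<and> (T ^^ k) x \<in> C} = {..<N} \<inter> {k. (T ^^ k) x \<in> C}" by auto
          then show ?thesis using x by (simp add: indicator_def of_bool_def sum.If_cases)
        qed
        then show "(\<Sum>k<N. indicator ((T ^^ k) -` C \<inter> \<Omega>) x) \<le> (real (N + 2 * w) / real (h n) + 4) * v"
          unfolding v_def using count_le_blk_count[OF x C ones n, of N] by simp
      qed
    qed
    finally show ?thesis .
  qed
  have "(\<lambda>N. (1 / real (h n) + 2 * real w / real (h n) / real N + 4 / real N) * v) \<longlonglongrightarrow> (1 / real (h n) + 0 + 0) * v"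
    by (intro tendsto_intros lim_const_over_n)
  moreover have "\<forall>N\<ge>1. Mm C \<le> (1 / real (h n) + 2 * real w / real (h n) / real N + 4 / real N) * v"
  proof (intro allI impI)
    fix N :: nat assume N: "1 \<le> N"
    have "Mm C \<le> (real (N + 2 * w) / real (h n) + 4) * v / real N"
      using *[of N] N by (simp add: pos_le_divide_eq mult.commute)
    also have "\<dots> = (1 / real (h n) + 2 * real w / real (h n) / real N + 4 / real N) * v"
      using N hn by (simp add: field_simps)
    finally show "Mm C \<le> (1 / real (h n) + 2 * real w / real (h n) / real N + 4 / real N) * v" .
  qed
  ultimately have "Mm C \<le> (1 / real (h n) + 0 + 0) * v" by (intro LIMSEQ_le_const) auto
  then show ?thesis by (simp add: v_def)
qed

text \<open>The sets \<open>nonones K\<close> exhaust everything but the all-ones point, which has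
  mass 0. This is where non-atomicity enters.\<close>

lemma Mm_nonones_tendsto: "(\<lambda>K. Mm (nonones K)) \<longlonglongrightarrow> 1"
proof -
  let ?o = "(\<lambda>_. 1) :: int \<Rightarrow> nat"
  have "(\<lambda>K. measure M (nonones K \<inter> \<Omega>)) \<longlonglongrightarrow> measure M (\<Union>K. nonones K \<inter> \<Omega>)"
  proof (rule finite_Lim_measure_incseq)
    show "range (\<lambda>K. nonones K \<inter> \<Omega>) \<subseteq> sets M" using local_in_M[OF local_set_nonones] by auto
    show "incseq (\<lambda>K. nonones K \<inter> \<Omega>)" 
      using subset_nonones[OF local_set_nonones ones_notin_nonones] by (intro incseq_SucI) (meson Int_mono le_SucI order_refl)
  qed
  moreover have "(\<Union>K. nonones K \<inter> \<Omega>) = space M - ({?o} \<inter> \<Omega>)"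
  proof -
    have "x \<in> (\<Union>K. nonones K)" if xo: "x \<noteq> ?o" for x
    proof -
      obtain t where "x t \<noteq> 1" using xo by (metis ext)
      then have "x \<in> nonones (nat \<bar>t\<bar>)" by (auto simp: nonones_def)
      then show ?thesis by blast
    qed
    then show ?thesis using ones_notin_nonones by (auto simp: space_M)
  qed
  moreover have "measure M (space M - ({?o} \<inter> \<Omega>)) = 1"
  proof -
    have "{?o} = (\<Inter>K. - nonones K)"
    proof (intro equalityI subsetI)
      fix x :: "int \<Rightarrow> nat" assume x: "x \<in> (\<Inter>K. - nonones K)"
      have "x t = 1" for t
      proof -
        have "x \<notin> nonones (nat \<bar>t\<bar>)" using x by blast
        then show ?thesis by (auto simp: nonones_def)
      qed
      then show "x \<in> {?o}" by auto
    qed (use ones_notin_nonones in auto)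
    moreover have "closed (\<Inter>K. - nonones K)"
      by (intro closed_INT ballI closed_local_set[OF local_set_Compl[OF local_set_nonones]])
    ultimately have "closed {?o}" by (simp only:)
    then have "{?o} \<inter> \<Omega> \<in> sets M" unfolding M_sets sets_restrict_space
      by (intro image_eqI[of _ _ "{?o}"] borel_closed) auto
    moreover have "measure M ({?o} \<inter> \<Omega>) = 0"
    proof (cases "?o \<in> \<Omega>")
      case True
      then have "{?o} \<inter> \<Omega> = {?o}" by auto
      then show ?thesis using M_nonatomic True by (simp add: measure_def)
    qed simp
    ultimately show ?thesis using prob_compl[of "{?o} \<inter> \<Omega>"] by simp
  qed
  ultimately show ?thesis by (simp add: Mm_def)
qed

section \<open>Frequencies in blocks converge to the measure\<close>

lemma h_at_top: "filterlim (\<lambda>n. real (h n)) at_top sequentially"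
proof (rule filterlim_at_top_mono[OF filterlim_real_sequentially])
  show "\<forall>\<^sub>F n in sequentially. real n \<le> real (h n)"
    using h_ge by (intro eventually_sequentiallyI[of 1]) simp
qed

lemma const_over_h: "(\<lambda>n. a / real (h n)) \<longlonglongrightarrow> 0"
  by (rule real_tendsto_divide_at_top[OF tendsto_const h_at_top])

text \<open>\<open>Mm_le_blk_count\<close> for \<open>C\<close> is one half of the claim. The other
  half is the same bound for \<open>nonones K - C\<close>: the two sets are disjoint, so up to
  boundary terms their counts add up to at most the length of the block, while their measures add up
  to nearly 1.\<close>

lemma blk_count_tendsto:
  assumes C: "local_set w C" and ones: "(\<lambda>_. 1) \<notin> C"
  shows "(\<lambda>n. real (blk_count w C n) / real (h n)) \<longlonglongrightarrow> Mm C"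
proof (rule tendstoI)
  fix e :: real assume e: "e > 0"
  have "\<forall>\<^sub>F K in sequentially. Mm (nonones K) > 1 - e / 2"
    using Mm_nonones_tendsto e by (intro order_tendstoD) auto
  then have "\<forall>\<^sub>F K in sequentially. Mm (nonones K) > 1 - e / 2 \<and> K \<ge> w"
    using eventually_ge_at_top by (rule eventually_conj)
  then obtain K where K: "Mm (nonones K) > 1 - e / 2" "K \<ge> w"
    using eventually_happens'[OF sequentially_bot] by blast
  have "\<forall>\<^sub>F n in sequentially. 4 * real w / real (h n) < e" "\<forall>\<^sub>F n in sequentially. 6 * real K / real (h n) < e / 2"
    using e by (auto intro!: order_tendstoD[OF const_over_h])
  moreover have "\<forall>\<^sub>F n in sequentially. n \<ge> (1::nat)" by (rule eventually_ge_at_top)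
  ultimately show "\<forall>\<^sub>F n in sequentially. dist (real (blk_count w C n) / real (h n)) (Mm C) < e"
  proof eventually_elim
    case (elim n)
    then have n: "n \<ge> 1" by simp
    have hn: "real (h n) > 0" using h_pos[OF n] by simp
    have "Mm C \<le> real (blk_count w C n) / real (h n) + 4 * real w / real (h n)"
      using Mm_le_blk_count[OF C ones n] by (simp add: add_divide_distrib)
    then have lower: "Mm C - e < real (blk_count w C n) / real (h n)" using elim by linarith
    define D where "D = nonones K - C"
    have CK: "local_set K C" using C K(2) by (rule local_set_mono)
    have D: "local_set K D" "(\<lambda>_. 1) \<notin> D"
      using local_set_Diff[OF local_set_nonones CK] ones_notin_nonones by (auto simp: D_def)
    have MD: "Mm D = Mm (nonones K) - Mm C"
      unfolding D_def using CK local_set_nonones subset_nonones[OF C ones K(2)] by (rule Mm_Diff)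
    have sum: "blk_count w C n + blk_count K D n \<le> h n + 2 * K"
    proof -
      let ?P = "\<lambda>j. (\<lambda>t. B n ! nat (int j + t))"
      define X where "X = {j\<in>{w..<h n - w}. ?P j \<in> C}"
      define Y where "Y = {j\<in>{K..<h n - K}. ?P j \<in> D}"
      have "card X \<le> card ({j\<in>{K..<h n - K}. ?P j \<in> C} \<union> ({..<K} \<union> {h n - K..<h n}))"
        by (rule card_mono) (auto simp: X_def)
      also have "\<dots> \<le> card {j\<in>{K..<h n - K}. ?P j \<in> C} + (card {..<K} + card {h n - K..<h n})"
        by (meson add_left_mono card_Un_le le_trans)
      also have "\<dots> \<le> card {j\<in>{K..<h n - K}. ?P j \<in> C} + 2 * K" by simp
      finally have X: "card X \<le> card {j\<in>{K..<h n - K}. ?P j \<in> C} + 2 * K" .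
      have "card {j\<in>{K..<h n - K}. ?P j \<in> C} + card Y = card ({j\<in>{K..<h n - K}. ?P j \<in> C} \<union> Y)"
        by (rule card_Un_disjoint[symmetric]) (auto simp: Y_def D_def)
      also have "\<dots> \<le> card {..<h n}" by (rule card_mono) (auto simp: Y_def)
      finally have "card {j\<in>{K..<h n - K}. ?P j \<in> C} + card Y \<le> h n" by simp
      then show ?thesis unfolding blk_count_def X_def[symmetric] Y_def[symmetric] using X by linarith
    qed
    have "Mm D \<le> real (blk_count K D n + 4 * K) / real (h n)" using D n by (rule Mm_le_blk_count)
    also have "\<dots> \<le> (real (h n) + 6 * real K - real (blk_count w C n)) / real (h n)"
      using sum hn by (intro divide_right_mono) linarith+
    also have "\<dots> = 1 + 6 * real K / real (h n) - real (blk_count w C n) / real (h n)"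
      using hn by (simp add: field_simps)
    finally have "real (blk_count w C n) / real (h n) < Mm C + e" using MD K elim by linarith
    with lower show ?case by (simp add: dist_real_def abs_less_iff)
  qed
qed

text \<open>Uniform in the point and in the length, because the intervals that avoid the exceptional
  run begin and end anywhere. For short lengths the error is absorbed by e N.\<close>

lemma count_upper:
  assumes C: "local_set w C" and ones: "(\<lambda>_. 1) \<notin> C" and e: "e > 0"
  shows "\<forall>\<^sub>F N in sequentially. \<forall>x\<in>\<Omega>. \<forall>L\<le>Suc N. real (card {k. k < L \<and> (T ^^ k) x \<in> C}) \<le> real L * Mm C + e * real N"
proof -
  have "\<forall>\<^sub>F n in sequentially. real (blk_count w C n) / real (h n) < Mm C + e / 8"
    using blk_count_tendsto[OF C ones] e by (intro order_tendstoD) auto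
  moreover have "\<forall>\<^sub>F n in sequentially. 4 * real w / real (h n) < e / 8"
    using e by (intro order_tendstoD[OF const_over_h]) auto
  moreover have "\<forall>\<^sub>F n in sequentially. n \<ge> (1::nat)" by (rule eventually_ge_at_top)
  ultimately have "\<forall>\<^sub>F n in sequentially. real (blk_count w C n) / real (h n) < Mm C + e / 8 \<and> 4 * real w / real (h n) < e / 8 \<and> n \<ge> 1"
    by eventually_elim auto
  then obtain n where n: "real (blk_count w C n) / real (h n) < Mm C + e / 8" "4 * real w / real (h n) < e / 8" "n \<ge> 1"
    using eventually_happens'[OF sequentially_bot] by blast
  define v where "v = real (blk_count w C n + 4 * w)"
  define c where "c = (2 * real w / real (h n) + 4) * v"
  have v: "v / real (h n) \<le> Mm C + e / 4" using n by (simp add: v_def add_divide_distrib)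
  have "\<forall>\<^sub>F N in sequentially. c / real N < e / 4" using e by (intro order_tendstoD[OF lim_const_over_n]) auto
  moreover have "\<forall>\<^sub>F N in sequentially. N \<ge> (1::nat)" by (rule eventually_ge_at_top)
  ultimately show ?thesis
  proof eventually_elim
    case (elim N)
    show ?case
    proof (intro ballI allI impI)
      fix x L assume x: "x \<in> \<Omega>" and L: "L \<le> Suc N"
      have "real (card {k. k < L \<and> (T ^^ k) x \<in> C}) \<le> (real (L + 2 * w) / real (h n) + 4) * v"
        unfolding v_def by (rule count_le_blk_count[OF x C ones n(3)])
      also have "\<dots> = real L * (v / real (h n)) + c" by (simp add: c_def algebra_simps add_divide_distrib)
      also have "\<dots> \<le> real L * (Mm C + e / 4) + c" using v by (intro add_right_mono mult_left_mono) auto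
      also have "\<dots> = real L * Mm C + real L * (e / 4) + c" by (simp add: algebra_simps)
      also have "real L * (e / 4) \<le> (2 * real N) * (e / 4)" using L elim e by (intro mult_right_mono) auto
      also have "c \<le> real N * (e / 4)" using elim by (simp add: field_simps)
      finally have "real (card {k. k < L \<and> (T ^^ k) x \<in> C}) \<le> real L * Mm C + 3 / 4 * (e * real N)"
        by (simp add: algebra_simps)
      moreover have "e * real N \<ge> 0" using e by simp
      ultimately show "real (card {k. k < L \<and> (T ^^ k) x \<in> C}) \<le> real L * Mm C + e * real N" by linarith
    qed
  qed
qed

section \<open>The exceptional run of a window\<close>

lemma ex_level:
  assumes "N \<ge> 1"
  shows "\<exists>l\<ge>1. h l \<le> N \<and> N < h (Suc l)"
proof -
  let ?S = "{l. 1 \<le> l \<and> h l \<le> N}"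
  have fin: "finite ?S" 
  proof (rule finite_subset)
    show "?S \<subseteq> {..N}"
    proof
      fix l assume "l \<in> ?S"
      then have "l \<le> h l" "h l \<le> N" using h_ge[of l] by auto
      then show "l \<in> {..N}" by simp
    qed
  qed simp
  have "1 \<in> ?S" using assms by simp
  then have max: "Max ?S \<in> ?S" using fin Max_in by blast
  have "Suc (Max ?S) \<notin> ?S" using Max_ge[OF fin, of "Suc (Max ?S)"] by (metis Suc_n_not_le_n)
  then have "N < h (Suc (Max ?S))" by simp
  then show ?thesis using max by blast
qed

text \<open>Of the three terms in \<open>window_exceptional_run\<close>, the first is o(N), the
  second is small by the tail of the convergent series of spacer proportions, and the third by
  \<open>reasonable\<close>, since the level of the window tends to infinity with N.\<close>

lemma exceptional_run:
  assumes \<omega>: "\<omega> \<in> \<Omega>"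
  obtains u v where "\<And>N. N \<ge> 1 \<Longrightarrow> u N \<le> v N \<and> v N \<le> Suc N"
    "\<And>N k. N \<ge> 1 \<Longrightarrow> u N \<le> k \<Longrightarrow> k < v N \<Longrightarrow> \<omega> (int k) = 1"
    "\<And>e. e > 0 \<Longrightarrow> \<exists>n0\<ge>1. \<forall>n\<ge>n0. \<forall>\<^sub>F N in sequentially.
      real (card {k. k \<le> N \<and> \<not> (u N \<le> k \<and> k < v N) \<and> (\<forall>i\<le>h n. \<omega> (int k - int i) = 1)}) \<le> e * real N"
proof -
  define t where "t l = Max (s l ` {..<p l})" for l
  define r where "r j = real (\<Sum>i<p j. s j i) / real (h (Suc j))" for j
  define \<tau> where "\<tau> l = real (t l) / real (h l)" for l
  have \<tau>: "\<tau> \<longlonglongrightarrow> 0" using reas by (simp add: reasonable_def \<tau>_def[abs_def] t_def)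
  have "summable (\<lambda>n. r (Suc n))" using params by (simp add: rank_one_params_def r_def)
  then have r: "summable r" by (simp add: summable_Suc_iff)
  have r0: "r j \<ge> 0" for j unfolding r_def by (intro divide_nonneg_nonneg of_nat_0_le_iff)
  have t: "s l k \<le> t l" if "k < p l" for l k unfolding t_def using that by (intro Max_ge) auto
  define lev where "lev N = (SOME l. 1 \<le> l \<and> h l \<le> N \<and> N < h (Suc l))" for N
  have lev: "1 \<le> lev N" "h (lev N) \<le> N" "N < h (Suc (lev N))" if "N \<ge> 1" for N
    using someI_ex[OF ex_level[OF that]] by (auto simp: lev_def)
  have lev_ge: "lev N \<ge> l" if "N \<ge> h l" "l \<ge> 1" for N l
  proof (rule ccontr)
    assume "\<not> l \<le> lev N"
    have N: "N \<ge> 1" using h_pos[OF that(2)] that(1) by simp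
    have "h (Suc (lev N)) \<le> h l" using \<open>\<not> l \<le> lev N\<close> by (intro h_mono) auto
    then show False using lev(3)[OF N] that by simp
  qed
  have ex: "\<exists>uv. fst uv \<le> snd uv \<and> snd uv \<le> Suc N \<and> (\<forall>k. fst uv \<le> k \<longrightarrow> k < snd uv \<longrightarrow> \<omega> (int k) = 1) \<and>
     (\<forall>n. 1 \<le> n \<longrightarrow> n \<le> lev N \<longrightarrow>
      real (card {k. k \<le> N \<and> \<not> (fst uv \<le> k \<and> k < snd uv) \<and> (\<forall>i\<le>h n. \<omega> (int k - int i) = 1)})
       \<le> real (h n) + 5 * real N * (\<Sum>j=n..<lev N. r j)
         + (real N / real (h (lev N)) + 4 + real (t (lev N)) / real (h (lev N))) * real (t (lev N)))" if N: "N \<ge> 1" for N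
  proof (rule window_exceptional_run[OF \<omega> lev[OF N] t], goal_cases)
    case (2 u v)
    then show ?case by (intro exI[of _ "(u, v)"]) (simp add: r_def)
  qed simp
  \<comment> \<open>The run is chosen once for each N, with the bounds for all n at the same time,
    so that it depends neither on n nor on the accuracy e.\<close>
  define uv where "uv N = (SOME uv. fst uv \<le> snd uv \<and> snd uv \<le> Suc N \<and> (\<forall>k. fst uv \<le> k \<longrightarrow> k < snd uv \<longrightarrow> \<omega> (int k) = 1) \<and>
     (\<forall>n. 1 \<le> n \<longrightarrow> n \<le> lev N \<longrightarrow>
      real (card {k. k \<le> N \<and> \<not> (fst uv \<le> k \<and> k < snd uv) \<and> (\<forall>i\<le>h n. \<omega> (int k - int i) = 1)})
       \<le> real (h n) + 5 * real N * (\<Sum>j=n..<lev N. r j)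
         + (real N / real (h (lev N)) + 4 + real (t (lev N)) / real (h (lev N))) * real (t (lev N))))" for N
  define u where "u N = fst (uv N)" for N
  define v where "v N = snd (uv N)" for N
  note uv = someI_ex[OF ex, folded uv_def, folded u_def v_def]
  have last: "\<exists>n0\<ge>1. \<forall>n\<ge>n0. \<forall>\<^sub>F N in sequentially.
      real (card {k. k \<le> N \<and> \<not> (u N \<le> k \<and> k < v N) \<and> (\<forall>i\<le>h n. \<omega> (int k - int i) = 1)}) \<le> e * real N" if e: "e > 0" for e
  proof -
    \<comment> \<open>The fractions e/15 here and e/18 below make the terms with factors 5 and 6 at
      most e N / 3 each.\<close>
    obtain n1 where n1: "\<And>n l. n \<ge> n1 \<Longrightarrow> norm (sum r {n..<l}) < e / 15"
      using r e unfolding summable_Cauchy by (metis divide_pos_pos zero_less_numeral)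
    have "\<forall>\<^sub>F l in sequentially. \<tau> l < min 1 (e / 18)" using \<tau> e by (intro order_tendstoD) auto
    then obtain l1 where l1: "\<And>l. l \<ge> l1 \<Longrightarrow> \<tau> l < min 1 (e / 18)" by (auto simp: eventually_sequentially)
    show ?thesis
    proof (intro exI[of _ "max 1 n1"] conjI allI impI)
      fix n assume n: "n \<ge> max 1 n1"
      have "\<forall>\<^sub>F N in sequentially. real (h n) / real N < e / 3" using e by (intro order_tendstoD[OF lim_const_over_n]) auto
      moreover have "\<forall>\<^sub>F N in sequentially. N \<ge> max 1 (max (h n) (h (max 1 l1)))" by (rule eventually_ge_at_top)
      ultimately show "\<forall>\<^sub>F N in sequentially. real (card {k. k \<le> N \<and> \<not> (u N \<le> k \<and> k < v N) \<and> (\<forall>i\<le>h n. \<omega> (int k - int i) = 1)}) \<le> e * real N"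
      proof eventually_elim
        case (elim N)
        define l where "l = lev N"
        have N: "N \<ge> 1" using elim by simp
        have nl: "n \<le> l" "l1 \<le> l" using lev_ge[of n N] lev_ge[of "max 1 l1" N] elim n by (auto simp: l_def)
        have hl: "real (h l) > 0" "real (h l) \<le> real N" using lev[OF N] h_pos by (auto simp: l_def)
        have tau: "\<tau> l < 1" "\<tau> l < e / 18" "\<tau> l \<ge> 0" using l1[OF nl(2)] by (auto simp: \<tau>_def)
        have tl: "real (t l) = \<tau> l * real (h l)" using hl by (simp add: \<tau>_def)
        have c3: "(real N / real (h l) + 4 + real (t l) / real (h l)) * real (t l) \<le> real N * (e / 3)"
        proof -
          have "(real N / real (h l) + 4 + real (t l) / real (h l)) * real (t l) = \<tau> l * real N + (4 + \<tau> l) * \<tau> l * real (h l)"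
            unfolding tl using hl by (simp add: field_simps)
          also have "(4 + \<tau> l) * \<tau> l * real (h l) \<le> 5 * \<tau> l * real N"
            using tau hl by (intro mult_mono) auto
          also have "\<tau> l * real N + 5 * \<tau> l * real N = (6 * \<tau> l) * real N" by (simp add: algebra_simps)
          also have "\<dots> \<le> (e / 3) * real N" using tau by (intro mult_right_mono) auto
          finally show ?thesis by (simp add: mult.commute)
        qed
        have "sum r {n..<l} \<le> e / 15" using n1[of n l] n r0 by (simp add: sum_nonneg)
        then have c2: "5 * real N * (\<Sum>j=n..<l. r j) \<le> 5 * real N * (e / 15)" by (intro mult_left_mono) auto
        have c1: "real (h n) \<le> real N * (e / 3)" using elim N by (simp add: field_simps)
        have "real (card {k. k \<le> N \<and> \<not> (u N \<le> k \<and> k < v N) \<and> (\<forall>i\<le>h n. \<omega> (int k - int i) = 1)})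
           \<le> real (h n) + 5 * real N * (\<Sum>j=n..<l. r j) + (real N / real (h l) + 4 + real (t l) / real (h l)) * real (t l)"
          using uv[OF N] n nl unfolding l_def by simp
        also have "\<dots> \<le> real N * (e / 3) + 5 * real N * (e / 15) + real N * (e / 3)"
          by (intro add_mono c1 c2 c3)
        finally show ?case by (simp add: field_simps)
      qed
    qed simp
  qed
  show ?thesis
    by (rule that[of u v]) (use uv last in auto)
qed

definition exceptional :: "(int \<Rightarrow> nat) \<Rightarrow> (nat \<Rightarrow> nat) \<Rightarrow> (nat \<Rightarrow> nat) \<Rightarrow> bool" where
  "exceptional \<omega> u v \<longleftrightarrow> (\<forall>N\<ge>1. u N \<le> v N \<and> v N \<le> Suc N) \<and>
    (\<forall>N\<ge>1. \<forall>k. u N \<le> k \<longrightarrow> k < v N \<longrightarrow> \<omega> (int k) = 1) \<and>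
    (\<forall>e>0. \<exists>n0\<ge>1. \<forall>n\<ge>n0. \<forall>\<^sub>F N in sequentially.
      real (card {k. k \<le> N \<and> \<not> (u N \<le> k \<and> k < v N) \<and> (\<forall>i\<le>h n. \<omega> (int k - int i) = 1)}) \<le> e * real N)"

lemma ex_exceptional:
  assumes "\<omega> \<in> \<Omega>"
  shows "\<exists>u v. exceptional \<omega> u v"
proof (rule exceptional_run[OF assms], goal_cases)
  case (1 u v)
  show ?case unfolding exceptional_def by (intro exI[of _ u] exI[of _ v] conjI allI impI 1)
qed

section \<open>Counts over subintervals of a window\<close>

definition cnt :: "(int \<Rightarrow> nat) \<Rightarrow> nat \<Rightarrow> nat \<Rightarrow> (int \<Rightarrow> nat) set \<Rightarrow> nat" where
  "cnt \<omega> a b C = card {k. a \<le> k \<and> k < b \<and> (T ^^ k) \<omega> \<in> C}"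

lemma cnt_shift: "cnt \<omega> a b C = card {k. k < b - a \<and> (T ^^ k) ((T ^^ a) \<omega>) \<in> C}"
proof -
  have "{k. a \<le> k \<and> k < b \<and> (T ^^ k) \<omega> \<in> C} = (\<lambda>k. k + a) ` {k. k < b - a \<and> (T ^^ k) ((T ^^ a) \<omega>) \<in> C}"
  proof (intro equalityI subsetI)
    fix k assume k: "k \<in> {k. a \<le> k \<and> k < b \<and> (T ^^ k) \<omega> \<in> C}"
    then have "(T ^^ k) \<omega> = (T ^^ (k - a)) ((T ^^ a) \<omega>)" by (simp add: rk_shift_funpow add.assoc)
    then show "k \<in> (\<lambda>k. k + a) ` {k. k < b - a \<and> (T ^^ k) ((T ^^ a) \<omega>) \<in> C}"
      using k by (intro image_eqI[of _ _ "k - a"]) auto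
  qed (auto simp: funpow_add)
  then show ?thesis unfolding cnt_def by (simp add: card_image inj_on_def)
qed

lemma cnt_Compl: "a \<le> b \<Longrightarrow> cnt \<omega> a b C + cnt \<omega> a b (- C) = b - a"
proof -
  assume "a \<le> b"
  have "cnt \<omega> a b C + cnt \<omega> a b (- C) = card ({k. a \<le> k \<and> k < b \<and> (T ^^ k) \<omega> \<in> C} \<union> {k. a \<le> k \<and> k < b \<and> (T ^^ k) \<omega> \<in> - C})"
    unfolding cnt_def by (rule card_Un_disjoint[symmetric]) auto
  also have "{k. a \<le> k \<and> k < b \<and> (T ^^ k) \<omega> \<in> C} \<union> {k. a \<le> k \<and> k < b \<and> (T ^^ k) \<omega> \<in> - C} = {a..<b}" by auto
  finally show ?thesis by simp
qed

lemma cnt_Diff: "C \<subseteq> D \<Longrightarrow> cnt \<omega> a b C + cnt \<omega> a b (D - C) = cnt \<omega> a b D"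
proof -
  assume CD: "C \<subseteq> D"
  have "cnt \<omega> a b C + cnt \<omega> a b (D - C) = card ({k. a \<le> k \<and> k < b \<and> (T ^^ k) \<omega> \<in> C} \<union> {k. a \<le> k \<and> k < b \<and> (T ^^ k) \<omega> \<in> D - C})"
    unfolding cnt_def by (rule card_Un_disjoint[symmetric]) auto
  also have "{k. a \<le> k \<and> k < b \<and> (T ^^ k) \<omega> \<in> C} \<union> {k. a \<le> k \<and> k < b \<and> (T ^^ k) \<omega> \<in> D - C} = {k. a \<le> k \<and> k < b \<and> (T ^^ k) \<omega> \<in> D}"
    using CD by auto
  finally show ?thesis by (simp add: cnt_def)
qed

lemma cnt_upper:
  assumes \<omega>: "\<omega> \<in> \<Omega>" and C: "local_set w C" and ones: "(\<lambda>_. 1) \<notin> C" and e: "e > 0"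
  shows "\<forall>\<^sub>F N in sequentially. \<forall>a b. a \<le> b \<longrightarrow> b \<le> Suc N \<longrightarrow> real (cnt \<omega> a b C) \<le> real (b - a) * Mm C + e * real N"
  using count_upper[OF C ones e]
proof eventually_elim
  case (elim N)
  show ?case
  proof (intro allI impI)
    fix a b assume "a \<le> b" "b \<le> Suc N"
    then have "b - a \<le> Suc N" by simp
    then show "real (cnt \<omega> a b C) \<le> real (b - a) * Mm C + e * real N"
      unfolding cnt_shift using elim rk_shift_Omega[OF \<omega>, of a] by blast
  qed
qed

text \<open>The upper bound is applied to \<open>nonones K - C\<close>. The times that remain have a
  \<open>K\<close>-neighbourhood consisting of ones; they lie in the exceptional run or in a set of
  at most e N / 2 elements.\<close>

lemma cnt_lower:
  assumes \<omega>: "\<omega> \<in> \<Omega>" and uv: "exceptional \<omega> u v" and C: "local_set w C" and ones: "(\<lambda>_. 1) \<notin> C" and e: "e > 0"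
  shows "\<forall>\<^sub>F N in sequentially. \<forall>a b. a \<le> b \<longrightarrow> b \<le> Suc N \<longrightarrow>
    real (cnt \<omega> a b C) \<ge> real (b - a) * Mm C - real (card ({a..<b} \<inter> {u N..<v N})) - e * real N"
proof -
  have third: "\<forall>e>0. \<exists>n0\<ge>1. \<forall>n\<ge>n0. \<forall>\<^sub>F N in sequentially.
      real (card {k. k \<le> N \<and> \<not> (u N \<le> k \<and> k < v N) \<and> (\<forall>i\<le>h n. \<omega> (int k - int i) = 1)}) \<le> e * real N"
    by (rule conjunct2[OF conjunct2[OF uv[unfolded exceptional_def]]])
  have "\<exists>n0\<ge>1. \<forall>n\<ge>n0. \<forall>\<^sub>F N in sequentially.
      real (card {k. k \<le> N \<and> \<not> (u N \<le> k \<and> k < v N) \<and> (\<forall>i\<le>h n. \<omega> (int k - int i) = 1)}) \<le> e / 2 * real N"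
    by (rule third[THEN spec, THEN mp]) (use e in simp)
  then obtain n0 where n0: "n0 \<ge> 1" "\<And>n. n \<ge> n0 \<Longrightarrow> \<forall>\<^sub>F N in sequentially.
      real (card {k. k \<le> N \<and> \<not> (u N \<le> k \<and> k < v N) \<and> (\<forall>i\<le>h n. \<omega> (int k - int i) = 1)}) \<le> e / 2 * real N"
    by blast
  define n where "n = max n0 w"
  \<comment> \<open>With this radius a time outside \<open>nonones K\<close> has at least
    \<open>h n\<close> ones just before it, the situation counted in
    \<open>exceptional\<close>.\<close>
  define K where "K = h n"
  have wK: "w \<le> K" using h_ge[of n] n0 unfolding K_def n_def by linarith
  define D where "D = nonones K - C"
  have CK: "local_set K C" using C wK by (rule local_set_mono)
  have D: "local_set K D" "(\<lambda>_. 1) \<notin> D"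
    using local_set_Diff[OF local_set_nonones CK] ones_notin_nonones by (auto simp: D_def)
  have sub: "C \<subseteq> nonones K" using C ones wK by (rule subset_nonones)
  have MD: "Mm D \<le> 1 - Mm C"
    using Mm_Diff[OF CK local_set_nonones sub] Mm_le_1[of "nonones K"] unfolding D_def by linarith
  have "\<forall>\<^sub>F N in sequentially. real (card {k. k \<le> N \<and> \<not> (u N \<le> k \<and> k < v N) \<and> (\<forall>i\<le>h n. \<omega> (int k - int i) = 1)}) \<le> e / 2 * real N"
    by (rule n0(2)) (simp add: n_def)
  moreover have "\<forall>\<^sub>F N in sequentially. \<forall>a b. a \<le> b \<longrightarrow> b \<le> Suc N \<longrightarrow> real (cnt \<omega> a b D) \<le> real (b - a) * Mm D + e / 2 * real N"
    using cnt_upper[OF \<omega> D, of "e / 2"] e by simp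
  ultimately show ?thesis
  proof eventually_elim
    case (elim N)
    show ?case
    proof (intro allI impI)
      fix a b :: nat assume ab: "a \<le> b" "b \<le> Suc N"
      define bad where "bad = {k. k \<le> N \<and> \<not> (u N \<le> k \<and> k < v N) \<and> (\<forall>i\<le>h n. \<omega> (int k - int i) = 1)}"
      have fin: "finite bad" by (rule finite_subset[of _ "{..N}"]) (auto simp: bad_def)
      have "{a..<b} \<subseteq> {k. a \<le> k \<and> k < b \<and> (T ^^ k) \<omega> \<in> nonones K} \<union> (({a..<b} \<inter> {u N..<v N}) \<union> bad)"
      proof
        fix k assume k: "k \<in> {a..<b}"
        show "k \<in> {k. a \<le> k \<and> k < b \<and> (T ^^ k) \<omega> \<in> nonones K} \<union> (({a..<b} \<inter> {u N..<v N}) \<union> bad)"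
        proof (cases "(T ^^ k) \<omega> \<in> nonones K \<or> k \<in> {u N..<v N}")
          case False
          then have all: "\<omega> (t + int k) = 1" if "\<bar>t\<bar> \<le> int K" for t using that by (auto simp: nonones_def rk_shift_funpow)
          have "\<omega> (int k - int i) = 1" if "i \<le> h n" for i
            using all[of "- int i"] that by (simp add: K_def)
          then have "k \<in> bad" using k ab False by (auto simp: bad_def)
          then show ?thesis by simp
        qed (use k in auto)
      qed
      then have "card {a..<b} \<le> card ({k. a \<le> k \<and> k < b \<and> (T ^^ k) \<omega> \<in> nonones K} \<union> (({a..<b} \<inter> {u N..<v N}) \<union> bad))"
        using fin by (intro card_mono) auto
      also have "\<dots> \<le> cnt \<omega> a b (nonones K) + card (({a..<b} \<inter> {u N..<v N}) \<union> bad)"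
        unfolding cnt_def by (rule card_Un_le)
      also have "card (({a..<b} \<inter> {u N..<v N}) \<union> bad) \<le> card ({a..<b} \<inter> {u N..<v N}) + card bad" by (rule card_Un_le)
      finally have 1: "real (b - a) \<le> real (cnt \<omega> a b (nonones K)) + real (card ({a..<b} \<inter> {u N..<v N})) + real (card bad)"
        by simp
      have 2: "real (cnt \<omega> a b C) + real (cnt \<omega> a b D) = real (cnt \<omega> a b (nonones K))"
        using cnt_Diff[OF sub, of \<omega> a b] unfolding D_def by (metis of_nat_add)
      have 3: "real (cnt \<omega> a b D) \<le> real (b - a) * Mm D + e / 2 * real N" using elim ab by blast
      have 4: "real (b - a) * Mm D \<le> real (b - a) * (1 - Mm C)" using MD by (intro mult_left_mono) auto
      have 5: "real (card bad) \<le> e / 2 * real N" using elim unfolding bad_def by blast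
      have 6: "real (b - a) * (1 - Mm C) = real (b - a) - real (b - a) * Mm C" by (simp add: algebra_simps)
      show "real (cnt \<omega> a b C) \<ge> real (b - a) * Mm C - real (card ({a..<b} \<inter> {u N..<v N})) - e * real N"
        using 1 2 3 4 5 6 by linarith
    qed
  qed
qed

text \<open>If \<open>C\<close> contains the all-ones point its complement does not, and the claim
  is symmetric under complements.\<close>

lemma cnt_approx:
  assumes \<omega>: "\<omega> \<in> \<Omega>" and uv: "exceptional \<omega> u v" and C: "local_set w C" and e: "e > 0"
  shows "\<forall>\<^sub>F N in sequentially. \<forall>a b. a \<le> b \<longrightarrow> b \<le> Suc N \<longrightarrow>
    \<bar>real (cnt \<omega> a b C) - real (b - a) * Mm C\<bar> \<le> real (card ({a..<b} \<inter> {u N..<v N})) + e * real N"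
proof -
  have ind: "\<forall>\<^sub>F N in sequentially. \<forall>a b. a \<le> b \<longrightarrow> b \<le> Suc N \<longrightarrow>
    \<bar>real (cnt \<omega> a b C) - real (b - a) * Mm C\<bar> \<le> real (card ({a..<b} \<inter> {u N..<v N})) + e * real N"
    if C: "local_set w C" and ones: "(\<lambda>_. 1) \<notin> C" for C
    using cnt_upper[OF \<omega> C ones e] cnt_lower[OF \<omega> uv C ones e]
  proof eventually_elim
    case (elim N)
    show ?case
    proof (intro allI impI)
      fix a b assume ab: "a \<le> b" "b \<le> Suc N"
      then have "real (cnt \<omega> a b C) \<le> real (b - a) * Mm C + e * real N"
        "real (cnt \<omega> a b C) \<ge> real (b - a) * Mm C - real (card ({a..<b} \<inter> {u N..<v N})) - e * real N"
        using elim by blast+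
      then show "\<bar>real (cnt \<omega> a b C) - real (b - a) * Mm C\<bar> \<le> real (card ({a..<b} \<inter> {u N..<v N})) + e * real N"
        by linarith
    qed
  qed
  show ?thesis
  proof (cases "(\<lambda>_. 1) \<in> C")
    case False
    then show ?thesis using ind[OF C] by blast
  next
    case True
    have "\<forall>\<^sub>F N in sequentially. \<forall>a b. a \<le> b \<longrightarrow> b \<le> Suc N \<longrightarrow>
      \<bar>real (cnt \<omega> a b (- C)) - real (b - a) * Mm (- C)\<bar> \<le> real (card ({a..<b} \<inter> {u N..<v N})) + e * real N"
      using True by (intro ind local_set_Compl C) auto
    then show ?thesis
    proof eventually_elim
      case (elim N)
      show ?case
      proof (intro allI impI)
        fix a b assume ab: "a \<le> b" "b \<le> Suc N"
        have "real (cnt \<omega> a b C) + real (cnt \<omega> a b (- C)) = real (b - a)" using cnt_Compl[OF ab(1)] by (metis of_nat_add)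
        moreover have "real (b - a) * Mm (- C) = real (b - a) - real (b - a) * Mm C"
          by (simp only: Mm_Compl[OF C] right_diff_distrib mult_1_right)
        moreover have "\<bar>real (cnt \<omega> a b (- C)) - real (b - a) * Mm (- C)\<bar> \<le> real (card ({a..<b} \<inter> {u N..<v N})) + e * real N"
          using elim ab by blast
        ultimately show "\<bar>real (cnt \<omega> a b C) - real (b - a) * Mm C\<bar> \<le> real (card ({a..<b} \<inter> {u N..<v N})) + e * real N"
          by linarith
      qed
    qed
  qed
qed

end

section \<open>Marginals of empirical joinings\<close>

lemma card_shift_diff:
  fixes P :: "nat \<Rightarrow> bool"
  shows "\<bar>real (card {m. a \<le> m \<and> m < b \<and> P (Suc m)}) - real (card {m. a \<le> m \<and> m < b \<and> P m})\<bar> \<le> 1"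
proof -
  let ?X = "{m. a \<le> m \<and> m < b \<and> P m}" and ?Y = "{m. a \<le> m \<and> m < b \<and> P (Suc m)}"
  have Y: "card ?Y = card (Suc ` ?Y)" by (simp add: card_image)
  have "card (Suc ` ?Y) \<le> card (insert b ?X)" by (rule card_mono) auto
  then have 1: "card ?Y \<le> Suc (card ?X)" using Y by (simp add: card_insert_if split: if_splits)
  have "card ?X \<le> card (insert a (Suc ` ?Y))"
  proof (rule card_mono)
    show "?X \<subseteq> insert a (Suc ` ?Y)"
    proof
      fix m assume m: "m \<in> ?X"
      show "m \<in> insert a (Suc ` ?Y)"
      proof (cases "m = a")
        case False
        then have "m = Suc (m - 1)" "m - 1 \<in> ?Y" using m by (auto simp: Suc_diff_le)
        then show ?thesis by blast
      qed simp
    qed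
  qed simp
  also have "\<dots> \<le> Suc (card (Suc ` ?Y))" by (rule card_insert_le_m1) auto
  finally have 2: "card ?X \<le> Suc (card ?Y)" using Y by simp
  show ?thesis using 1 2 by linarith
qed

text \<open>Any \<open>q\<close> consecutive integers contain a multiple of \<open>q\<close>. So
  when the multiples in an interval avoid the run, the interval itself meets the run in a bounded
  number of points, and the error term of \<open>cnt_approx\<close> stays harmless.\<close>

lemma card_gap_le:
  assumes "\<And>m. a \<le> m \<Longrightarrow> m < b \<Longrightarrow> \<not> (u \<le> q * m \<and> q * m < v)" and q: "q \<ge> 1"
  shows "card ({q * a..<q * b} \<inter> {u..<v}) \<le> (q::nat)"
proof -
  define S where "S = {q * a..<q * b} \<inter> {u..<v}"
  have fin: "finite S" by (simp add: S_def)
  have "card S \<le> q"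
  proof (cases "S = {}")
    case False
    define k where "k = Min S"
    have k: "k \<in> S" unfolding k_def using False fin by (rule Min_in[rotated])
    have "S \<subseteq> {k..<k + q}"
    proof
      fix k' assume k': "k' \<in> S"
      then have "k \<le> k'" unfolding k_def using fin by (intro Min_le)
      moreover have "k' < k + q"
      proof (rule ccontr)
        assume "\<not> k' < k + q"
        define m where "m = k' div q"
        have "q * m + k' mod q = k'" "k' mod q < q" using q by (simp_all add: m_def)
        then have m: "q * m \<le> k'" "k \<le> q * m" using \<open>\<not> k' < k + q\<close> by linarith+
        have "q * a \<le> k" "u \<le> k" "k' < q * b" "k' < v" using k k' by (simp_all add: S_def)
        then have m': "q * a \<le> q * m" "q * m < q * b" "u \<le> q * m" "q * m < v" using m by linarith+
        have "0 < q" using q by simp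
        then have "a \<le> m" "m < b" using m'(1,2) by (simp_all only: nat_mult_le_cancel1 nat_mult_less_cancel1)
        then show False using assms(1)[of m] m' by blast
      qed
      ultimately show "k' \<in> {k..<k + q}" by simp
    qed
    then have "card S \<le> card {k..<k + q}" by (intro card_mono) auto
    then show ?thesis by simp
  qed simp
  then show ?thesis by (simp only: S_def)
qed

context rank_one_system
begin

text \<open>Each k is uniquely q m + i with i < q, so summing over the residues restores all
  consecutive times. Block counting controls only this total.\<close>

lemma sum_residues_cnt:
  assumes q: "q \<ge> 1"
  shows "(\<Sum>i<q. card {m. a \<le> m \<and> m < b \<and> (T ^^ (q * m)) \<omega> \<in> (T ^^ i) -` C}) = cnt \<omega> (q * a) (q * b) C"
proof -
  define R where "R i = {m. a \<le> m \<and> m < b \<and> (T ^^ (q * m + i)) \<omega> \<in> C}" for i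
  have R: "{m. a \<le> m \<and> m < b \<and> (T ^^ (q * m)) \<omega> \<in> (T ^^ i) -` C} = R i" for i
    by (auto simp: R_def rk_shift_funpow add_ac)
  have "(\<Sum>i<q. card (R i)) = card (SIGMA i:{..<q}. R i)" by (rule card_SigmaI[symmetric]) (auto simp: R_def)
  also have "\<dots> = card ((\<lambda>(i, m). q * m + i) ` (SIGMA i:{..<q}. R i))"
  proof (rule card_image[symmetric], rule inj_onI, clarsimp)
    fix i m i' m' assume iq: "i < q" "i' < q" and eq: "q * m + i = q * m' + i'"
    have "(q * m + i) div q = m" "(q * m' + i') div q = m'" using iq by simp_all
    then have "m = m'" using eq by metis
    then show "i = i' \<and> m = m'" using eq by simp
  qed
  also have "(\<lambda>(i, m). q * m + i) ` (SIGMA i:{..<q}. R i) = {k. q * a \<le> k \<and> k < q * b \<and> (T ^^ k) \<omega> \<in> C}"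
  proof (intro equalityI subsetI)
    fix k assume "k \<in> (\<lambda>(i, m). q * m + i) ` (SIGMA i:{..<q}. R i)"
    then obtain i m where im: "k = q * m + i" "i < q" "a \<le> m" "m < b" "(T ^^ k) \<omega> \<in> C" by (auto simp: R_def)
    have "q * a \<le> q * m" using im by simp
    moreover have "q * m + i < q * Suc m" using im by simp
    moreover have "q * Suc m \<le> q * b" using im by (intro mult_le_mono2) simp
    ultimately have "q * a \<le> k" "k < q * b" using im(1) by linarith+
    then show "k \<in> {k. q * a \<le> k \<and> k < q * b \<and> (T ^^ k) \<omega> \<in> C}" using im(5) by blast
  next
    fix k assume k: "k \<in> {k. q * a \<le> k \<and> k < q * b \<and> (T ^^ k) \<omega> \<in> C}"
    have "a \<le> k div q" using k q by (simp add: less_eq_div_iff_mult_less_eq mult.commute)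
    moreover have "k div q < b" using k q by (simp add: div_less_iff_less_mult mult.commute)
    moreover have "q * (k div q) + k mod q = k" by simp
    ultimately have "k mod q < q" "k div q \<in> R (k mod q)" using k q by (auto simp: R_def)
    then show "k \<in> (\<lambda>(i, m). q * m + i) ` (SIGMA i:{..<q}. R i)"
      by (intro image_eqI[of _ _ "(k mod q, k div q)"]) auto
  qed
  finally show ?thesis unfolding R cnt_def .
qed

text \<open>The traces of local sets form a generator closed under intersections.\<close>

lemma measure_eq_M:
  assumes \<nu>: "prob_space \<nu>" "sets \<nu> = sets M" and eq: "\<And>C w. local_set w C \<Longrightarrow> measure \<nu> (C \<inter> \<Omega>) = Mm C"
  shows "\<nu> = M"
proof -
  interpret \<nu>: prob_space \<nu> by (rule \<nu>)
  let ?E = "{C \<inter> \<Omega> | C w. local_set w C}"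
  have gen: "sets M = sigma_sets \<Omega> ?E" unfolding M_sets by (rule sets_restrict_borel_local)
  show ?thesis
  proof (rule measure_eqI_generator_eq[where E = ?E and \<Omega> = \<Omega> and A = "\<lambda>_. \<Omega>"])
    show "Int_stable ?E"
    proof (rule Int_stableI, safe)
      fix C w D w' assume "local_set w C" "local_set w' D"
      then have "local_set (max w w') (C \<inter> D)" by (intro local_set_Int) (auto elim: local_set_mono)
      moreover have "C \<inter> \<Omega> \<inter> (D \<inter> \<Omega>) = (C \<inter> D) \<inter> \<Omega>" by auto
      ultimately show "\<exists>Ca w. C \<inter> \<Omega> \<inter> (D \<inter> \<Omega>) = Ca \<inter> \<Omega> \<and> local_set w Ca" by blast
    qed
    show "?E \<subseteq> Pow \<Omega>" by auto
    show "emeasure \<nu> X = emeasure M X" if "X \<in> ?E" for X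
      using that eq by (auto simp: \<nu>.emeasure_eq_measure emeasure_eq_measure Mm_def)
    show "sets \<nu> = sigma_sets \<Omega> ?E" "sets M = sigma_sets \<Omega> ?E" using gen \<nu>(2) by auto
    show "range (\<lambda>_. \<Omega>) \<subseteq> ?E" using local_set_UNIV by blast
    show "emeasure \<nu> \<Omega> \<noteq> \<infinity>" by (simp add: \<nu>.emeasure_eq_measure)
  qed auto
qed

text \<open>The limit \<nu> is invariant under T^q, since shifting the interval by one changes a
  bounded number of terms. By \<open>sum_residues_cnt\<close> and \<open>cnt_approx\<close> the
  average of its translates by T^i, i < q, is \<open>M\<close>, and weak mixing then forces \<nu> =
  M. Lengths of at least e N are asked for so that errors of order o(N) disappear.\<close>

lemma orbit_marginal:
  assumes wm: "weakly_mixing M T" and \<omega>: "\<omega> \<in> \<Omega>" and uv: "exceptional \<omega> u v" and q: "q \<ge> 1"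
    and G: "G \<noteq> bot" "G \<le> sequentially" and e: "e > 0"
    and ab: "\<forall>\<^sub>F N in G. a N \<le> b N \<and> q * b N \<le> N \<and> (\<forall>m. a N \<le> m \<longrightarrow> m < b N \<longrightarrow> \<not> (u N \<le> q * m \<and> q * m < v N))
      \<and> e * real N \<le> real (b N - a N)"
    and \<nu>: "prob_space \<nu>" "sets \<nu> = sets M"
    and lim: "\<And>C w. local_set w C \<Longrightarrow>
      ((\<lambda>N. real (card {m. a N \<le> m \<and> m < b N \<and> (T ^^ (q * m)) \<omega> \<in> C}) / real (b N - a N)) \<longlongrightarrow> measure \<nu> (C \<inter> \<Omega>)) G"
  shows "\<nu> = M"
proof (rule measure_eq_M[OF \<nu>])
  define f where "f C N = real (card {m. a N \<le> m \<and> m < b N \<and> (T ^^ (q * m)) \<omega> \<in> C}) / real (b N - a N)" for C N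
  have lim': "(f C \<longlongrightarrow> measure \<nu> (C \<inter> \<Omega>)) G" if "local_set w C" for C w
    using lim[OF that] by (simp add: f_def[abs_def])
  have evN: "\<forall>\<^sub>F N in G. N \<ge> n" for n :: nat
    using G(2) eventually_ge_at_top by (rule filter_leD)
  have evd: "\<forall>\<^sub>F N in G. c / real (b N - a N) < \<epsilon> \<and> real (b N - a N) > 0" if "\<epsilon> > 0" "c \<ge> 0" for c \<epsilon>
    using ab evN[of "nat \<lceil>c / (e * \<epsilon>)\<rceil> + 1"]
  proof eventually_elim
    case (elim N)
    have "c / (e * \<epsilon>) \<le> real (nat \<lceil>c / (e * \<epsilon>)\<rceil>)" by linarith
    moreover have "real (nat \<lceil>c / (e * \<epsilon>)\<rceil> + 1) \<le> real N" using elim by (simp only: of_nat_le_iff)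
    ultimately have N: "c / (e * \<epsilon>) < real N" "real N > 0" by linarith+
    then have "c < e * real N * \<epsilon>" using e that by (simp add: field_simps)
    also have "\<dots> \<le> real (b N - a N) * \<epsilon>" using elim that by (intro mult_right_mono) auto
    finally have "c < real (b N - a N) * \<epsilon>" .
    moreover have "real (b N - a N) > 0" using elim N e by (smt (verit) mult_pos_pos)
    ultimately show ?case by (simp add: field_simps)
  qed
  have shift1: "measure \<nu> ((T ^^ q) -` C \<inter> \<Omega>) = measure \<nu> (C \<inter> \<Omega>)" if C: "local_set w C" for C w
  proof -
    have "((\<lambda>N. f ((T ^^ q) -` C) N - f C N) \<longlongrightarrow> 0) G"
    proof (rule tendstoI)
      fix \<epsilon> :: real assume \<epsilon>: "\<epsilon> > 0"
      show "\<forall>\<^sub>F N in G. dist (f ((T ^^ q) -` C) N - f C N) 0 < \<epsilon>"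
        using evd[OF \<epsilon>, of 1, simplified]
      proof eventually_elim
        case (elim N)
        have "(T ^^ (q * m)) \<omega> \<in> (T ^^ q) -` C \<longleftrightarrow> (T ^^ (q * Suc m)) \<omega> \<in> C" for m
          by (simp add: rk_shift_funpow algebra_simps)
        then have "\<bar>f ((T ^^ q) -` C) N - f C N\<bar> \<le> 1 / real (b N - a N)"
          unfolding f_def using card_shift_diff[of "a N" "b N" "\<lambda>m. (T ^^ (q * m)) \<omega> \<in> C"] elim
          by (simp add: diff_divide_distrib[symmetric] abs_divide divide_right_mono)
        then show ?case using elim unfolding dist_real_def diff_zero by linarith
      qed
    qed
    moreover have "((\<lambda>N. f ((T ^^ q) -` C) N - f C N) \<longlongrightarrow> measure \<nu> ((T ^^ q) -` C \<inter> \<Omega>) - measure \<nu> (C \<inter> \<Omega>)) G"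
      by (intro tendsto_diff lim'[OF C] lim'[OF local_set_shift[OF C]])
    ultimately show ?thesis using tendsto_unique[OF G(1)] by fastforce
  qed
  have shiftn: "measure \<nu> ((T ^^ (q * n)) -` C \<inter> \<Omega>) = measure \<nu> (C \<inter> \<Omega>)" if C: "local_set w C" for C w n
  proof (induction n)
    case (Suc n)
    have "(T ^^ (q * Suc n)) -` C = (T ^^ q) -` ((T ^^ (q * n)) -` C)"
      by (auto simp: rk_shift_funpow algebra_simps)
    then show ?case using shift1[OF local_set_shift[OF C, of "q * n"]] Suc by simp
  qed simp
  have avg: "(\<Sum>i<q. measure \<nu> ((T ^^ i) -` C \<inter> \<Omega>)) = real q * Mm C" if C: "local_set w C" for C w
  proof -
    have "((\<lambda>N. \<Sum>i<q. f ((T ^^ i) -` C) N) \<longlongrightarrow> (\<Sum>i<q. measure \<nu> ((T ^^ i) -` C \<inter> \<Omega>))) G"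
      by (intro tendsto_sum lim'[OF local_set_shift[OF C]])
    moreover have "((\<lambda>N. \<Sum>i<q. f ((T ^^ i) -` C) N) \<longlongrightarrow> real q * Mm C) G"
    proof (rule tendstoI)
      fix \<epsilon> :: real assume \<epsilon>: "\<epsilon> > 0"
      have "\<forall>\<^sub>F N in G. \<forall>a b. a \<le> b \<longrightarrow> b \<le> Suc N \<longrightarrow>
         \<bar>real (cnt \<omega> a b C) - real (b - a) * Mm C\<bar> \<le> real (card ({a..<b} \<inter> {u N..<v N})) + \<epsilon> * e / 2 * real N"
        using G(2) cnt_approx[OF \<omega> uv C, of "\<epsilon> * e / 2"] \<epsilon> e by (intro filter_leD[of G sequentially]) auto
      moreover have "\<forall>\<^sub>F N in G. real q / real (b N - a N) < \<epsilon> / 2 \<and> real (b N - a N) > 0"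
        using \<epsilon> by (intro evd) auto
      ultimately show "\<forall>\<^sub>F N in G. dist (\<Sum>i<q. f ((T ^^ i) -` C) N) (real q * Mm C) < \<epsilon>"
        using ab
      proof eventually_elim
        case (elim N)
        define d where "d = real (b N - a N)"
        have d: "d > 0" "real q / d < \<epsilon> / 2" "e * real N \<le> d" using elim by (auto simp: d_def)
        have "(\<Sum>i<q. f ((T ^^ i) -` C) N) = real (\<Sum>i<q. card {m. a N \<le> m \<and> m < b N \<and> (T ^^ (q * m)) \<omega> \<in> (T ^^ i) -` C}) / d"
          by (simp add: f_def d_def sum_divide_distrib)
        also have "\<dots> = real (cnt \<omega> (q * a N) (q * b N) C) / d" by (simp only: sum_residues_cnt[OF q])
        finally have s: "(\<Sum>i<q. f ((T ^^ i) -` C) N) = real (cnt \<omega> (q * a N) (q * b N) C) / d" .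
        have "card ({q * a N..<q * b N} \<inter> {u N..<v N}) \<le> q"
          using elim q by (intro card_gap_le) blast+
        moreover have "\<bar>real (cnt \<omega> (q * a N) (q * b N) C) - real (q * b N - q * a N) * Mm C\<bar>
            \<le> real (card ({q * a N..<q * b N} \<inter> {u N..<v N})) + \<epsilon> * e / 2 * real N"
          by (rule elim(1)[THEN spec, THEN spec, THEN mp, THEN mp]) (use elim in auto)
        moreover have "real (q * b N - q * a N) = real q * d"
          unfolding d_def by (metis diff_mult_distrib2 of_nat_mult)
        ultimately have "\<bar>real (cnt \<omega> (q * a N) (q * b N) C) - real q * d * Mm C\<bar> \<le> real q + \<epsilon> * e / 2 * real N"
          by (smt (verit) of_nat_mono)
        also have "\<epsilon> * e / 2 * real N \<le> \<epsilon> / 2 * d" using mult_left_mono[OF d(3), of "\<epsilon> / 2"] \<epsilon> by (simp add: mult_ac)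
        also have "real q + \<epsilon> / 2 * d < \<epsilon> * d" using d by (simp add: field_simps)
        finally have *: "\<bar>real (cnt \<omega> (q * a N) (q * b N) C) - real q * d * Mm C\<bar> < \<epsilon> * d" by simp
        have "(\<Sum>i<q. f ((T ^^ i) -` C) N) - real q * Mm C = (real (cnt \<omega> (q * a N) (q * b N) C) - real q * d * Mm C) / d"
          unfolding s using d(1) by (simp add: field_simps)
        then have "\<bar>(\<Sum>i<q. f ((T ^^ i) -` C) N) - real q * Mm C\<bar> < \<epsilon>"
          using * d(1) by (simp add: abs_divide pos_divide_less_eq)
        then show ?case by (simp add: dist_real_def)
      qed
    qed
    ultimately show ?thesis by (rule tendsto_unique[OF G(1)])
  qed
  fix C w assume C: "local_set w C"
  have vim: "(T ^^ i) -` (C' \<inter> \<Omega>) \<inter> \<Omega> = (T ^^ i) -` C' \<inter> \<Omega>" for i C' by (rule vimage_Omega)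
  have vim2: "(T ^^ i) -` ((T ^^ j) -` (C \<inter> \<Omega>)) \<inter> \<Omega> = (T ^^ i) -` ((T ^^ j) -` C) \<inter> \<Omega>" for i j
    using rk_shift_Omega by auto
  have vim3: "(T ^^ i) -` ((T ^^ j) -` (C \<inter> \<Omega>) \<inter> (T ^^ k) -` (C \<inter> \<Omega>)) \<inter> \<Omega> = (T ^^ i) -` ((T ^^ j) -` C \<inter> (T ^^ k) -` C) \<inter> \<Omega>" for i j k
    using rk_shift_Omega by auto
  have vim4: "(T ^^ j) -` (C \<inter> \<Omega>) \<inter> (T ^^ k) -` (C \<inter> \<Omega>) \<inter> \<Omega> = ((T ^^ j) -` C \<inter> (T ^^ k) -` C) \<inter> \<Omega>" for j k
    using rk_shift_Omega by auto
  have "measure \<nu> (C \<inter> \<Omega>) = measure M (C \<inter> \<Omega>)"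
  proof (rule weakly_mixing_determines[OF M_prob M_inv wm \<nu> q local_in_M[OF C]])
    show "measure \<nu> ((T ^^ (q * n)) -` (C \<inter> \<Omega>) \<inter> space M) = measure \<nu> (C \<inter> \<Omega>)" for n
      unfolding space_M vim by (rule shiftn[OF C])
    show "(\<Sum>i<q. measure \<nu> ((T ^^ i) -` ((T ^^ (q * n)) -` (C \<inter> \<Omega>)) \<inter> space M)) = real q * measure M ((T ^^ (q * n)) -` (C \<inter> \<Omega>) \<inter> space M)" for n
      unfolding space_M vim vim2 using avg[OF local_set_shift[OF C, of "q * n"]] by (simp add: Mm_def)
    show "(\<Sum>i<q. measure \<nu> ((T ^^ i) -` ((T ^^ (q * n)) -` (C \<inter> \<Omega>) \<inter> (T ^^ (q * n')) -` (C \<inter> \<Omega>)) \<inter> space M))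
       = real q * measure M ((T ^^ (q * n)) -` (C \<inter> \<Omega>) \<inter> (T ^^ (q * n')) -` (C \<inter> \<Omega>) \<inter> space M)" for n n'
    proof -
      have "local_set (w + q * n + q * n') ((T ^^ (q * n)) -` C \<inter> (T ^^ (q * n')) -` C)"
        by (intro local_set_Int local_set_mono[OF local_set_shift[OF C]]) auto
      from avg[OF this] show ?thesis unfolding space_M vim3 vim4 by (simp add: Mm_def)
    qed
  qed
  then show "measure \<nu> (C \<inter> \<Omega>) = Mm C" by (simp add: Mm_def)
qed

end

section \<open>Correlations along two primes\<close>

context rank_one_system
begin

abbreviation "pairs \<equiv> {D \<inter> (\<Omega> \<times> \<Omega>) | D w. local_pair w D}"

lemma Omega_01: "\<Omega> \<subseteq> {x. \<forall>k. x k \<in> {0, 1}}"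
  by (auto simp: rk_Omega_def)

lemma sets_pairs: "sets (M \<Otimes>\<^sub>M M) = sigma_sets (\<Omega> \<times> \<Omega>) pairs"
  using Omega_01 M_sets by (rule sets_pair_local)

lemma algebra_pairs: "algebra (\<Omega> \<times> \<Omega>) pairs"
  unfolding algebra_iff_Un
proof (intro conjI ballI)
  have "local_pair 0 {}" by (simp add: local_pair_def)
  then show "{} \<in> pairs" by blast
next
  fix A assume "A \<in> pairs"
  then obtain D w where D: "A = D \<inter> (\<Omega> \<times> \<Omega>)" "local_pair w D" by blast
  have "\<Omega> \<times> \<Omega> - A = (- D) \<inter> (\<Omega> \<times> \<Omega>)" using D by auto
  then show "\<Omega> \<times> \<Omega> - A \<in> pairs" using local_pair_Compl[OF D(2)] by blast
next
  fix A A' assume "A \<in> pairs" "A' \<in> pairs"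
  then obtain D w D' w' where D: "A = D \<inter> (\<Omega> \<times> \<Omega>)" "local_pair w D" "A' = D' \<inter> (\<Omega> \<times> \<Omega>)" "local_pair w' D'" by blast
  have "local_pair (max w w') (D \<union> D')"
    by (intro local_pair_Un local_pair_mono[OF D(2)] local_pair_mono[OF D(4)]) auto
  moreover have "A \<union> A' = (D \<union> D') \<inter> (\<Omega> \<times> \<Omega>)" using D by auto
  ultimately show "A \<union> A' \<in> pairs" by blast
qed auto

lemma pairs_compact: "A \<in> pairs \<Longrightarrow> compact A \<and> closed A"
proof -
  assume "A \<in> pairs"
  then obtain D w where D: "A = (\<Omega> \<times> \<Omega>) \<inter> D" "local_pair w D" by blast
  have "closed (\<Omega> \<times> \<Omega>)" by (intro closed_Times closed_Omega)
  then show ?thesis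
    unfolding D(1) using closed_local_pair[OF D(2)] compact_Times[OF compact_Omega compact_Omega, of p s p s]
    by (auto intro: closed_Int compact_Int_closed)
qed

lemma measurable_shift: "(T ^^ n) \<in> M \<rightarrow>\<^sub>M M"
  using invariant_funpow[OF M_inv] by (simp add: invariant_measure_def)

lemma measurable_shift_pair:
  "(\<lambda>(x, y). ((T ^^ q) x, (T ^^ r) y)) \<in> (M \<Otimes>\<^sub>M M) \<rightarrow>\<^sub>M (M \<Otimes>\<^sub>M M)"
  using measurable_shift by measurable

lemma pair_invariant:
  assumes L: "prob_space L" "sets L = sets (M \<Otimes>\<^sub>M M)"
    and inv: "\<And>D w. local_pair w D \<Longrightarrow>
      measure L ((\<lambda>(x, y). ((T ^^ q) x, (T ^^ r) y)) -` D \<inter> \<Omega> \<times> \<Omega>) = measure L (D \<inter> \<Omega> \<times> \<Omega>)"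
  shows "invariant_measure L (\<lambda>(x, y). ((T ^^ q) x, (T ^^ r) y))"
proof -
  interpret L: prob_space L by (rule L)
  let ?S = "\<lambda>(x, y). ((T ^^ q) x, (T ^^ r) y)"
  have spL: "space L = \<Omega> \<times> \<Omega>" using sets_eq_imp_space_eq[OF L(2)] by (simp add: space_pair_measure space_M)
  have S: "?S \<in> L \<rightarrow>\<^sub>M L" using measurable_shift_pair[of q r] by (simp cong: measurable_cong_sets add: L(2))
  interpret D: prob_space "distr L L ?S" by (rule L.prob_space_distr[OF S])
  interpret P: algebra "\<Omega> \<times> \<Omega>" pairs by (rule algebra_pairs)
  have "distr L L ?S = L"
  proof (rule measure_eqI_generator_eq[where E = pairs and \<Omega> = "\<Omega> \<times> \<Omega>" and A = "\<lambda>_. \<Omega> \<times> \<Omega>"])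
    show "Int_stable pairs" by (rule Int_stableI) (rule P.Int)
    show "pairs \<subseteq> Pow (\<Omega> \<times> \<Omega>)" by (rule P.space_closed)
    show "emeasure (distr L L ?S) X = emeasure L X" if X: "X \<in> pairs" for X
    proof -
      obtain D w where D: "X = D \<inter> (\<Omega> \<times> \<Omega>)" "local_pair w D" using X by blast
      have XL: "X \<in> sets L" unfolding L(2) sets_pairs using X by (rule sigma_sets.Basic)
      have "?S z \<in> \<Omega> \<times> \<Omega>" if "z \<in> \<Omega> \<times> \<Omega>" for z
        using that rk_shift_Omega by (cases z) simp
      then have eqS: "?S -` X \<inter> \<Omega> \<times> \<Omega> = ?S -` D \<inter> \<Omega> \<times> \<Omega>" unfolding D(1) by blast
      have "measure (distr L L ?S) X = measure L (?S -` X \<inter> space L)" by (rule measure_distr[OF S XL])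
      also have "\<dots> = measure L (?S -` D \<inter> \<Omega> \<times> \<Omega>)" unfolding spL eqS ..
      also have "\<dots> = measure L X" unfolding D(1) by (rule inv[OF D(2)])
      finally have "measure (distr L L ?S) X = measure L X" .
      then show ?thesis by (simp add: D.emeasure_eq_measure L.emeasure_eq_measure)
    qed
    show "sets (distr L L ?S) = sigma_sets (\<Omega> \<times> \<Omega>) pairs" "sets L = sigma_sets (\<Omega> \<times> \<Omega>) pairs"
      by (simp_all only: sets_distr L(2) sets_pairs)
    show "range (\<lambda>_. \<Omega> \<times> \<Omega>) \<subseteq> pairs" using P.top by blast
    show "emeasure (distr L L ?S) (\<Omega> \<times> \<Omega>) \<noteq> \<infinity>" by (simp add: D.emeasure_eq_measure)
  qed auto
  then show ?thesis using S by (simp add: invariant_measure_def)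
qed

text \<open>A cluster point of the empirical measures of the orbit of \<open>(\<omega>, \<omega>)\<close> along admissible intervals
  is a joining, hence the product measure.\<close>
lemma pair_correlation:
  assumes wm: "weakly_mixing M T" and disj: "disjoint_systems M (T ^^ q) M (T ^^ r)"
    and q: "q \<ge> 1" and r: "r \<ge> 1" and \<omega>: "\<omega> \<in> \<Omega>" and uv: "exceptional \<omega> u v"
    and A: "local_set w A" and C: "local_set w C" and e: "e > 0"
  shows "\<forall>\<^sub>F N in sequentially. \<forall>a b. a \<le> b \<and> q * b \<le> N \<and> r * b \<le> N \<and>
      (\<forall>m. a \<le> m \<longrightarrow> m < b \<longrightarrow> \<not> (u N \<le> q * m \<and> q * m < v N) \<and> \<not> (u N \<le> r * m \<and> r * m < v N)) \<longrightarrow>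
    \<bar>real (card {m. a \<le> m \<and> m < b \<and> (T ^^ (q * m)) \<omega> \<in> A \<and> (T ^^ (r * m)) \<omega> \<in> C}) - real (b - a) * (Mm A * Mm C)\<bar> \<le> e * real N"
proof (rule ccontr)
  define Adm where "Adm N a b \<longleftrightarrow> a \<le> b \<and> q * b \<le> N \<and> r * b \<le> N \<and>
      (\<forall>m. a \<le> m \<longrightarrow> m < b \<longrightarrow> \<not> (u N \<le> q * m \<and> q * m < v N) \<and> \<not> (u N \<le> r * m \<and> r * m < v N))" for N a b
  define dev where "dev a b = \<bar>real (card {m. a \<le> m \<and> m < b \<and> (T ^^ (q * m)) \<omega> \<in> A \<and> (T ^^ (r * m)) \<omega> \<in> C}) - real (b - a) * (Mm A * Mm C)\<bar>" for a b
  define bad where "bad N \<longleftrightarrow> (\<exists>a b. Adm N a b \<and> \<not> dev a b \<le> e * real N)" for N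
  assume neg: "\<not> ?thesis"
  have "\<not> (\<forall>\<^sub>F N in sequentially. \<not> bad N)"
  proof
    assume "\<forall>\<^sub>F N in sequentially. \<not> bad N"
    then have "\<forall>\<^sub>F N in sequentially. \<forall>a b. Adm N a b \<longrightarrow> dev a b \<le> e * real N"
      by eventually_elim (unfold bad_def, blast)
    then show False using neg unfolding Adm_def dev_def by (rule notE[rotated])
  qed
  \<comment> \<open>If the claim fails, bad windows occur for arbitrarily large N. The filter
    follows only these, so that one chosen bad interval per window can be taken to a limit.\<close>
  define F where "F = inf sequentially (principal {N. bad N})"
  have "F \<noteq> bot"
    using \<open>\<not> (\<forall>\<^sub>F N in sequentially. \<not> bad N)\<close> by (simp add: F_def trivial_limit_def eventually_inf_principal)
  define ab where "ab N = (SOME ab. Adm N (fst ab) (snd ab) \<and> \<not> dev (fst ab) (snd ab) \<le> e * real N)" for N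
  define a where "a N = fst (ab N)" for N
  define b where "b N = snd (ab N)" for N
  have ab: "Adm N (a N) (b N)" "dev (a N) (b N) > e * real N" if "bad N" for N
  proof -
    have "\<exists>ab. Adm N (fst ab) (snd ab) \<and> \<not> dev (fst ab) (snd ab) \<le> e * real N" using that by (simp add: bad_def)
    from someI_ex[OF this] show "Adm N (a N) (b N)" "dev (a N) (b N) > e * real N"
      by (auto simp: ab_def a_def b_def)
  qed
  define z where "z m = ((T ^^ (q * m)) \<omega>, (T ^^ (r * m)) \<omega>)" for m
  have zX: "z m \<in> \<Omega> \<times> \<Omega>" for m using rk_shift_Omega[OF \<omega>] by (simp add: z_def)
  define I where "I N D = {m. a N \<le> m \<and> m < b N \<and> z m \<in> D}" for N D
  \<comment> \<open>The deviation never exceeds the length of the interval, so bad intervals are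
    long, as \<open>orbit_marginal\<close> requires.\<close>
  have dle: "e * real N < real (b N - a N)" if "bad N" for N
  proof -
    have "card {m. a N \<le> m \<and> m < b N \<and> (T ^^ (q * m)) \<omega> \<in> A \<and> (T ^^ (r * m)) \<omega> \<in> C} \<le> card {a N..<b N}"
      by (rule card_mono) auto
    then have "real (card {m. a N \<le> m \<and> m < b N \<and> (T ^^ (q * m)) \<omega> \<in> A \<and> (T ^^ (r * m)) \<omega> \<in> C}) \<le> real (b N - a N)" by simp
    moreover have p: "0 \<le> Mm A * Mm C" "Mm A * Mm C \<le> 1" using Mm_nonneg Mm_le_1 by (auto intro: mult_le_one)
    have "0 \<le> real (b N - a N) * (Mm A * Mm C)" by (rule mult_nonneg_nonneg[OF of_nat_0_le_iff p(1)])
    moreover have "real (b N - a N) * (Mm A * Mm C) \<le> real (b N - a N) * 1"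
      by (rule mult_left_mono[OF p(2) of_nat_0_le_iff])
    ultimately have "dev (a N) (b N) \<le> real (b N - a N)" unfolding dev_def by linarith
    then show ?thesis using ab(2)[OF that] by linarith
  qed
  have dpos: "a N < b N" if "bad N" for N
    using dle[OF that] e by (metis diff_is_0_eq' le_less_linear mult_nonneg_nonneg of_nat_0 of_nat_0_le_iff less_imp_le not_le)
  \<comment> \<open>The empirical measure on the bad interval. At the other N a point mass serves as
    default, since \<open>limit_measure\<close> wants additivity and total mass 1 for every
    N.\<close>
  define \<mu> where "\<mu> N D = (if bad N then real (card (I N D)) / real (b N - a N) else of_bool (z 0 \<in> D))" for N D
  have finI: "finite (I N D)" for N D by (rule finite_subset[of _ "{a N..<b N}"]) (auto simp: I_def)
  obtain G L where G: "G \<le> F" "G \<noteq> bot" and L: "prob_space L" "space L = \<Omega> \<times> \<Omega>" "sets L = sigma_sets (\<Omega> \<times> \<Omega>) pairs"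
    and lim0: "\<And>D. D \<in> pairs \<Longrightarrow> ((\<lambda>N. \<mu> N D) \<longlongrightarrow> measure L D) G"
  proof (rule limit_measure[OF algebra_pairs pairs_compact \<open>F \<noteq> bot\<close>, of \<mu>])
    show "0 \<le> \<mu> N D" for N D by (simp add: \<mu>_def)
    show "\<mu> N (D \<union> D') = \<mu> N D + \<mu> N D'" if "D \<inter> D' = {}" for N D D'
    proof -
      have "I N (D \<union> D') = I N D \<union> I N D'" "I N D \<inter> I N D' = {}" using that by (auto simp: I_def)
      then have "card (I N (D \<union> D')) = card (I N D) + card (I N D')" using finI by (simp add: card_Un_disjoint)
      then show ?thesis using that by (auto simp: \<mu>_def add_divide_distrib)
    qed
    show "\<mu> N (\<Omega> \<times> \<Omega>) = 1" for N
    proof (cases "bad N")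
      case True
      have "I N (\<Omega> \<times> \<Omega>) = {a N..<b N}" using zX by (auto simp: I_def)
      then show ?thesis using dpos[OF True] True by (simp add: \<mu>_def)
    next
      case False
      then show ?thesis using zX[of 0] by (simp add: \<mu>_def)
    qed
  qed blast+
  interpret L: prob_space L by (rule L)
  have Lsets: "sets L = sets (M \<Otimes>\<^sub>M M)" using L(3) sets_pairs by simp
  have Gseq: "G \<le> sequentially" using G(1) by (simp add: F_def)
  have evbad: "\<forall>\<^sub>F N in G. bad N"
  proof -
    have "\<forall>\<^sub>F N in F. bad N" by (simp add: F_def eventually_inf_principal)
    then show ?thesis using G(1) by (rule filter_leD[rotated])
  qed
  have Iint: "I N (D \<inter> \<Omega> \<times> \<Omega>) = I N D" for N D unfolding I_def using zX by blast
  have lim: "((\<lambda>N. real (card (I N D)) / real (b N - a N)) \<longlongrightarrow> measure L (D \<inter> \<Omega> \<times> \<Omega>)) G" if "local_pair w' D" for D w'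
  proof -
    have "((\<lambda>N. \<mu> N (D \<inter> \<Omega> \<times> \<Omega>)) \<longlongrightarrow> measure L (D \<inter> \<Omega> \<times> \<Omega>)) G" using that by (intro lim0) blast
    moreover have "\<forall>\<^sub>F N in G. \<mu> N (D \<inter> \<Omega> \<times> \<Omega>) = real (card (I N D)) / real (b N - a N)"
      using evbad by eventually_elim (simp add: \<mu>_def Iint)
    ultimately show ?thesis by (rule Lim_transform_eventually)
  qed
  have dinf: "((\<lambda>N. 1 / real (b N - a N)) \<longlongrightarrow> 0) G"
  proof (rule Lim_null_comparison)
    have "(\<lambda>N. 1 / e / real N) \<longlonglongrightarrow> 0" by (rule lim_const_over_n)
    then show "((\<lambda>N. 1 / e / real N) \<longlongrightarrow> 0) G" using Gseq by (rule tendsto_mono[rotated])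
    have "\<forall>\<^sub>F N in G. N \<ge> (1::nat)" using Gseq eventually_ge_at_top by (rule filter_leD)
    then show "\<forall>\<^sub>F N in G. norm (1 / real (b N - a N)) \<le> 1 / e / real N"
      using evbad
    proof eventually_elim
      case (elim N)
      have "0 < e * real N" using e elim by simp
      then have "1 / real (b N - a N) \<le> 1 / (e * real N)" using dle[OF elim(2)] by (intro divide_left_mono) auto
      then show ?case by simp
    qed
  qed
  have inv: "invariant_measure L (\<lambda>(x, y). ((T ^^ q) x, (T ^^ r) y))"
  proof (rule pair_invariant[OF L(1) Lsets])
    fix D w' assume D: "local_pair w' D"
    let ?S = "\<lambda>(x, y). ((T ^^ q) x, (T ^^ r) y)"
    have "((\<lambda>N. real (card (I N (?S -` D))) / real (b N - a N) - real (card (I N D)) / real (b N - a N)) \<longlongrightarrow> 0) G"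
    proof (rule Lim_null_comparison[OF always_eventually dinf], rule allI)
      fix N
      have "?S (z m) = z (Suc m)" for m by (simp add: z_def rk_shift_funpow algebra_simps)
      then have IS: "I N (?S -` D) = {m. a N \<le> m \<and> m < b N \<and> z (Suc m) \<in> D}" by (auto simp: I_def)
      have "\<bar>real (card (I N (?S -` D))) - real (card (I N D))\<bar> \<le> 1"
        unfolding IS unfolding I_def by (rule card_shift_diff)
      then show "norm (real (card (I N (?S -` D))) / real (b N - a N) - real (card (I N D)) / real (b N - a N)) \<le> 1 / real (b N - a N)"
        by (simp only: diff_divide_distrib[symmetric] real_norm_def abs_divide abs_of_nat) (rule divide_right_mono, auto)
    qed
    moreover have "((\<lambda>N. real (card (I N (?S -` D))) / real (b N - a N) - real (card (I N D)) / real (b N - a N))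
        \<longlongrightarrow> measure L (?S -` D \<inter> \<Omega> \<times> \<Omega>) - measure L (D \<inter> \<Omega> \<times> \<Omega>)) G"
      by (intro tendsto_diff lim[OF D] lim[OF local_pair_shift[OF D]])
    ultimately have "0 = measure L (?S -` D \<inter> \<Omega> \<times> \<Omega>) - measure L (D \<inter> \<Omega> \<times> \<Omega>)"
      by (rule tendsto_unique[OF G(2)])
    then show "measure L (?S -` D \<inter> \<Omega> \<times> \<Omega>) = measure L (D \<inter> \<Omega> \<times> \<Omega>)" by simp
  qed
  have fstm: "fst \<in> L \<rightarrow>\<^sub>M M" and sndm: "snd \<in> L \<rightarrow>\<^sub>M M"
    by (simp_all cong: measurable_cong_sets add: Lsets)
  have m1: "distr L M fst = M"
  proof (rule orbit_marginal[OF wm \<omega> uv q G(2) Gseq e])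
    show "\<forall>\<^sub>F N in G. a N \<le> b N \<and> q * b N \<le> N \<and> (\<forall>m. a N \<le> m \<longrightarrow> m < b N \<longrightarrow> \<not> (u N \<le> q * m \<and> q * m < v N))
      \<and> e * real N \<le> real (b N - a N)"
      using evbad by eventually_elim (use ab(1) dle in \<open>auto simp: Adm_def intro: less_imp_le\<close>)
    show "prob_space (distr L M fst)" by (rule L.prob_space_distr[OF fstm])
    show "((\<lambda>N. real (card {m. a N \<le> m \<and> m < b N \<and> (T ^^ (q * m)) \<omega> \<in> D}) / real (b N - a N)) \<longlongrightarrow> measure (distr L M fst) (D \<inter> \<Omega>)) G"
      if D: "local_set w' D" for D w'
    proof -
      have "measure (distr L M fst) (D \<inter> \<Omega>) = measure L ((D \<times> UNIV) \<inter> \<Omega> \<times> \<Omega>)"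
        using measure_distr[OF fstm local_in_M[OF D]] by (simp add: L(2)) (rule arg_cong[where f = "measure L"], auto)
      moreover have "{m. a N \<le> m \<and> m < b N \<and> (T ^^ (q * m)) \<omega> \<in> D} = I N (D \<times> UNIV)" for N by (auto simp: I_def z_def)
      ultimately show ?thesis using lim[OF local_pair_Times[OF D local_set_UNIV]] by simp
    qed
  qed simp
  have m2: "distr L M snd = M"
  proof (rule orbit_marginal[OF wm \<omega> uv r G(2) Gseq e])
    show "\<forall>\<^sub>F N in G. a N \<le> b N \<and> r * b N \<le> N \<and> (\<forall>m. a N \<le> m \<longrightarrow> m < b N \<longrightarrow> \<not> (u N \<le> r * m \<and> r * m < v N))
      \<and> e * real N \<le> real (b N - a N)"
      using evbad by eventually_elim (use ab(1) dle in \<open>auto simp: Adm_def intro: less_imp_le\<close>)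
    show "prob_space (distr L M snd)" by (rule L.prob_space_distr[OF sndm])
    show "((\<lambda>N. real (card {m. a N \<le> m \<and> m < b N \<and> (T ^^ (r * m)) \<omega> \<in> D}) / real (b N - a N)) \<longlongrightarrow> measure (distr L M snd) (D \<inter> \<Omega>)) G"
      if D: "local_set w' D" for D w'
    proof -
      have "measure (distr L M snd) (D \<inter> \<Omega>) = measure L ((UNIV \<times> D) \<inter> \<Omega> \<times> \<Omega>)"
        using measure_distr[OF sndm local_in_M[OF D]] by (simp add: L(2)) (rule arg_cong[where f = "measure L"], auto)
      moreover have "{m. a N \<le> m \<and> m < b N \<and> (T ^^ (r * m)) \<omega> \<in> D} = I N (UNIV \<times> D)" for N by (auto simp: I_def z_def)
      ultimately show ?thesis using lim[OF local_pair_Times[OF local_set_UNIV D]] by simp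
    qed
  qed simp
  have "joining M (T ^^ q) M (T ^^ r) L"
    unfolding joining_def using Lsets L(1) inv m1 m2 by blast
  then have LM: "L = M \<Otimes>\<^sub>M M" using disj unfolding disjoint_systems_def by blast
  interpret MM: pair_prob_space M M ..
  have "measure L ((A \<times> C) \<inter> \<Omega> \<times> \<Omega>) = Mm A * Mm C"
  proof -
    have "(A \<times> C) \<inter> \<Omega> \<times> \<Omega> = (A \<inter> \<Omega>) \<times> (C \<inter> \<Omega>)" by auto
    then show ?thesis unfolding LM Mm_def
      by (simp only: measure_def emeasure_pair_measure_Times[OF local_in_M[OF A] local_in_M[OF C]] enn2real_mult)
  qed
  then have "((\<lambda>N. real (card (I N (A \<times> C))) / real (b N - a N)) \<longlongrightarrow> Mm A * Mm C) G"
    using lim[OF local_pair_Times[OF A C]] by simp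
  then have "\<forall>\<^sub>F N in G. dist (real (card (I N (A \<times> C))) / real (b N - a N)) (Mm A * Mm C) < e"
    using e by (rule tendstoD)
  then have "\<forall>\<^sub>F N in G. False"
    using evbad
  proof eventually_elim
    case (elim N)
    define d where "d = real (b N - a N)"
    have d: "d > 0" using dpos[OF elim(2)] by (simp add: d_def)
    have "b N \<le> q * b N" using q by simp
    then have "b N \<le> N" using ab(1)[OF elim(2)] unfolding Adm_def by linarith
    then have dN: "d \<le> real N" by (simp add: d_def)
    have "I N (A \<times> C) = {m. a N \<le> m \<and> m < b N \<and> (T ^^ (q * m)) \<omega> \<in> A \<and> (T ^^ (r * m)) \<omega> \<in> C}" by (auto simp: I_def z_def)
    then have "dev (a N) (b N) = \<bar>real (card (I N (A \<times> C))) - d * (Mm A * Mm C)\<bar>" by (simp add: dev_def d_def)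
    also have "\<dots> = d * \<bar>real (card (I N (A \<times> C))) / d - Mm A * Mm C\<bar>"
    proof -
      have "real (card (I N (A \<times> C))) - d * (Mm A * Mm C) = d * (real (card (I N (A \<times> C))) / d - Mm A * Mm C)"
        using d by (simp add: field_simps)
      then show ?thesis using d by (simp add: abs_mult)
    qed
    also have "\<dots> \<le> d * e" using elim(1) d by (intro mult_left_mono) (auto simp: dist_real_def d_def)
    also have "\<dots> \<le> real N * e" using dN e by (intro mult_right_mono) auto
    finally show False using ab(2)[OF elim(2)] by (simp add: mult.commute)
  qed
  then show False using G(2) by (simp add: trivial_limit_def)
qed

end

section \<open>Moebius orthogonality\<close>

text \<open>The clamping by min and max covers the cases where [c, d) is empty or sticks out of [x,
  y).\<close>

lemma sum_avoid_interval:
  fixes f :: "nat \<Rightarrow> real"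
  assumes "x \<le> y"
  shows "(\<Sum>m=x..<y. if c \<le> m \<and> m < d then 0 else f m) =
    (\<Sum>m=x..<max x (min y c). f m) + (\<Sum>m=min y (max x (max c d))..<y. f m)"
proof -
  have "(\<Sum>m=x..<y. if c \<le> m \<and> m < d then 0 else f m) = (\<Sum>m\<in>{m\<in>{x..<y}. \<not> (c \<le> m \<and> m < d)}. f m)"
    by (subst sum.inter_filter) (auto intro!: sum.cong)
  also have "{m\<in>{x..<y}. \<not> (c \<le> m \<and> m < d)} = {x..<max x (min y c)} \<union> {min y (max x (max c d))..<y}"
    using assms by (auto simp: max_def min_def)
  also have "sum f \<dots> = (\<Sum>m=x..<max x (min y c). f m) + (\<Sum>m=min y (max x (max c d))..<y. f m)"
    by (rule sum.union_disjoint) (auto simp: max_def min_def)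
  finally show ?thesis .
qed

text \<open>Each removal of an interval splits what is there into at most two pieces; applied twice
  this gives the factor 4.\<close>

lemma sum_avoid_two_intervals:
  fixes f :: "nat \<Rightarrow> real"
  assumes le: "lo \<le> hi"
    and bound: "\<And>x y. x \<le> y \<Longrightarrow> y \<le> hi \<Longrightarrow> (\<And>m. x \<le> m \<Longrightarrow> m < y \<Longrightarrow> \<not> (c \<le> m \<and> m < d) \<and> \<not> (c' \<le> m \<and> m < d')) \<Longrightarrow> \<bar>\<Sum>m=x..<y. f m\<bar> \<le> E"
  shows "\<bar>\<Sum>m=lo..<hi. if (c \<le> m \<and> m < d) \<or> (c' \<le> m \<and> m < d') then 0 else f m\<bar> \<le> 4 * E"
proof -
  define g where "g m = (if c' \<le> m \<and> m < d' then 0 else f m)" for m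
  have one: "\<bar>\<Sum>m=x..<y. g m\<bar> \<le> 2 * E" if xy: "x \<le> y" "y \<le> hi" "\<And>m. x \<le> m \<Longrightarrow> m < y \<Longrightarrow> \<not> (c \<le> m \<and> m < d)" for x y
  proof -
    have "\<bar>\<Sum>m=x..<max x (min y c'). f m\<bar> \<le> E" by (rule bound) (use xy in auto)
    moreover have "\<bar>\<Sum>m=min y (max x (max c' d'))..<y. f m\<bar> \<le> E" by (rule bound) (use xy in auto)
    ultimately show ?thesis unfolding g_def sum_avoid_interval[OF xy(1)] by linarith
  qed
  have "\<bar>\<Sum>m=lo..<max lo (min hi c). g m\<bar> \<le> 2 * E" by (rule one) (use le in auto)
  moreover have "\<bar>\<Sum>m=min hi (max lo (max c d))..<hi. g m\<bar> \<le> 2 * E" by (rule one) (use le in auto)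
  ultimately have "\<bar>\<Sum>m=lo..<hi. if c \<le> m \<and> m < d then 0 else g m\<bar> \<le> 4 * E"
    unfolding sum_avoid_interval[OF le] by linarith
  moreover have "(\<Sum>m=lo..<hi. if c \<le> m \<and> m < d then 0 else g m) = (\<Sum>m=lo..<hi. if (c \<le> m \<and> m < d) \<or> (c' \<le> m \<and> m < d') then 0 else f m)"
    by (intro sum.cong) (auto simp: g_def)
  ultimately show ?thesis by simp
qed

text \<open>Multiplication by \<open>q\<close> is monotone and unbounded, so the times m whose
  multiple hits the run again form an interval.\<close>

lemma multiples_interval:
  assumes q: "q \<ge> (1::nat)"
  obtains c d where "\<And>m. u \<le> q * m \<and> q * m < v \<longleftrightarrow> c \<le> m \<and> m < d"
proof -
  have L: "\<exists>c. \<forall>m. u \<le> q * m \<longleftrightarrow> c \<le> m" for u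
  proof -
    define c where "c = (LEAST m. u \<le> q * m)"
    have "u \<le> q * u" using q by simp
    then have c: "u \<le> q * c" unfolding c_def by (rule LeastI)
    have "u \<le> q * m \<longleftrightarrow> c \<le> m" for m
    proof
      assume "u \<le> q * m" then show "c \<le> m" unfolding c_def by (rule Least_le)
    next
      assume "c \<le> m"
      then have "q * c \<le> q * m" by simp
      then show "u \<le> q * m" using c by linarith
    qed
    then show ?thesis by blast
  qed
  obtain c where c: "\<And>m. u \<le> q * m \<longleftrightarrow> c \<le> m" using L by blast
  obtain d where d: "\<And>m. v \<le> q * m \<longleftrightarrow> d \<le> m" using L by blast
  show ?thesis by (rule that[of c d]) (use c d in \<open>auto simp: not_le[symmetric]\<close>)
qed

text \<open>Short sums are bounded by their length, which is negligible against N. Uniformity in k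
  is wanted because the exceptional run may end anywhere.\<close>

lemma mertens_uniform:
  assumes e: "e > 0"
  shows "\<forall>\<^sub>F N in sequentially. \<forall>k\<le>N. norm (\<Sum>n=1..k. moebius n) \<le> e * real N"
proof -
  have "\<forall>\<^sub>F N in sequentially. norm ((\<Sum>n=1..N. moebius n) / of_nat N) < e"
    using tendstoD[OF mertens_little_o e] by simp
  then obtain K where K: "\<And>N. N \<ge> K \<Longrightarrow> norm ((\<Sum>n=1..N. moebius n) / of_nat N) < e"
    by (auto simp: eventually_sequentially)
  have "\<forall>\<^sub>F N in sequentially. real K / real N < e" using e by (intro order_tendstoD[OF lim_const_over_n]) auto
  moreover have "\<forall>\<^sub>F N in sequentially. N \<ge> (1::nat)" by (rule eventually_ge_at_top)
  ultimately show ?thesis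
  proof eventually_elim
    case (elim N)
    show ?case
    proof (intro allI impI)
      fix k assume k: "k \<le> N"
      show "norm (\<Sum>n=1..k. moebius n) \<le> e * real N"
      proof (cases "k \<ge> K \<and> k \<ge> 1")
        case True
        then have "norm (\<Sum>n=1..k. moebius n) / real k < e" using K[of k] by (simp add: norm_divide)
        then have "norm (\<Sum>n=1..k. moebius n) \<le> e * real k" using True by (simp add: divide_less_eq)
        also have "\<dots> \<le> e * real N" using k e by simp
        finally show ?thesis .
      next
        case False
        have "norm (\<Sum>n=1..k. moebius n) \<le> (\<Sum>n=1..k. 1)" by (intro sum_norm_le norm_moebius_le)
        also have "\<dots> \<le> real K" using False by auto
        also have "\<dots> \<le> e * real N" using elim by (simp add: divide_less_eq)
        finally show ?thesis .
      qed
    qed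
  qed
qed

context rank_one_system
begin

text \<open>Expanding the product of centred indicators leads to counts for A \<times> A, A \<times>
  UNIV and UNIV \<times> A, all covered by \<open>pair_correlation\<close>. The m with q m or r m in
  the run form two intervals, on which the summand vanishes.\<close>

lemma local_correlation:
  assumes wm: "weakly_mixing M T" and disj: "disjoint_systems M (T ^^ q) M (T ^^ r)"
    and q: "q \<ge> 1" and r: "r \<ge> 1" and \<omega>: "\<omega> \<in> \<Omega>" and uv: "exceptional \<omega> u v" and A: "local_set w A"
  defines "a \<equiv> \<lambda>N n. if u N \<le> n \<and> n < v N then 0 else of_bool ((T ^^ n) \<omega> \<in> A) - Mm A"
  shows "(\<lambda>N. (\<Sum>m=1..N div max q r. a N (q * m) * a N (r * m)) / real N) \<longlonglongrightarrow> 0"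
proof (rule tendstoI)
  fix e :: real assume e: "e > 0"
  define \<alpha> where "\<alpha> = Mm A"
  have \<alpha>: "0 \<le> \<alpha>" "\<alpha> \<le> 1" using Mm_nonneg Mm_le_1 by (auto simp: \<alpha>_def)
  have abd: "\<bar>a N n\<bar> \<le> 1" for N n using \<alpha> by (auto simp: a_def \<alpha>_def of_bool_def)
  \<comment> \<open>Four pieces with three counts each, every count with error \<delta> N, give e N
    / 2.\<close>
  define \<delta> where "\<delta> = e / 24"
  have \<delta>: "\<delta> > 0" using e by (simp add: \<delta>_def)
  have MU: "Mm UNIV = 1" using prob_space by (simp add: Mm_def space_M[symmetric])
  define g where "g m = (of_bool ((T ^^ (q * m)) \<omega> \<in> A) - \<alpha>) * (of_bool ((T ^^ (r * m)) \<omega> \<in> A) - \<alpha>)" for m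
  define cd where "cd X Y x y = real (card {m. x \<le> m \<and> m < y \<and> (T ^^ (q * m)) \<omega> \<in> X \<and> (T ^^ (r * m)) \<omega> \<in> Y})" for X Y x y
  have gsum: "(\<Sum>m=x..<y. g m) = cd A A x y - \<alpha> * cd A UNIV x y - \<alpha> * cd UNIV A x y + \<alpha> * \<alpha> * real (y - x)" for x y
  proof -
    have cdsum: "cd X Y x y = (\<Sum>m=x..<y. of_bool ((T ^^ (q * m)) \<omega> \<in> X \<and> (T ^^ (r * m)) \<omega> \<in> Y))" for X Y
    proof -
      have seteq: "{m. x \<le> m \<and> m < y \<and> (T ^^ (q * m)) \<omega> \<in> X \<and> (T ^^ (r * m)) \<omega> \<in> Y} = {x..<y} \<inter> {m. (T ^^ (q * m)) \<omega> \<in> X \<and> (T ^^ (r * m)) \<omega> \<in> Y}" by auto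
      show ?thesis unfolding cd_def seteq of_bool_def sum.If_cases[OF finite_atLeastLessThan] by simp
    qed
    have "(\<Sum>m=x..<y. g m) = (\<Sum>m=x..<y. of_bool ((T ^^ (q * m)) \<omega> \<in> A \<and> (T ^^ (r * m)) \<omega> \<in> A)
       - \<alpha> * of_bool ((T ^^ (q * m)) \<omega> \<in> A \<and> (T ^^ (r * m)) \<omega> \<in> UNIV)
       - \<alpha> * of_bool ((T ^^ (q * m)) \<omega> \<in> UNIV \<and> (T ^^ (r * m)) \<omega> \<in> A) + \<alpha> * \<alpha>)"
      by (intro sum.cong refl) (simp add: g_def of_bool_def algebra_simps)
    also have "\<dots> = cd A A x y - \<alpha> * cd A UNIV x y - \<alpha> * cd UNIV A x y + real (y - x) * (\<alpha> * \<alpha>)"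
      unfolding cdsum sum_distrib_left by (simp only: sum.distrib sum_subtractf sum_constant card_atLeastLessThan)
    finally show ?thesis by (simp add: mult_ac)
  qed
  note pc = pair_correlation[OF wm disj q r \<omega> uv _ _ \<delta>, where w = w]
  have "\<forall>\<^sub>F N in sequentially. 1 / real N < e / 2" using e by (intro order_tendstoD[OF lim_const_over_n]) auto
  moreover have "\<forall>\<^sub>F N in sequentially. N \<ge> (1::nat)" by (rule eventually_ge_at_top)
  ultimately show "\<forall>\<^sub>F N in sequentially. dist ((\<Sum>m=1..N div max q r. a N (q * m) * a N (r * m)) / real N) 0 < e"
    using pc[OF A A] pc[OF A local_set_UNIV] pc[OF local_set_UNIV A]
  proof eventually_elim
    case (elim N)
    define n where "n = N div max q r"
    have Q: "max q r * n \<le> N" unfolding n_def by simp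
    then have qn: "q * n \<le> N" "r * n \<le> N" by (simp_all add: nat_mult_max_left)
    obtain c d where c: "\<And>m. u N \<le> q * m \<and> q * m < v N \<longleftrightarrow> c \<le> m \<and> m < d" using multiples_interval[OF q] by metis
    obtain c' d' where c': "\<And>m. u N \<le> r * m \<and> r * m < v N \<longleftrightarrow> c' \<le> m \<and> m < d'" using multiples_interval[OF r] by metis
    have bound: "\<bar>\<Sum>m=x..<y. g m\<bar> \<le> 3 * \<delta> * real N"
      if xy: "x \<le> y" "y \<le> n" "\<And>m. x \<le> m \<Longrightarrow> m < y \<Longrightarrow> \<not> (c \<le> m \<and> m < d) \<and> \<not> (c' \<le> m \<and> m < d')" for x y
    proof -
      have "q * y \<le> q * n" "r * y \<le> r * n" using xy(2) by simp_all
      then have adm: "x \<le> y \<and> q * y \<le> N \<and> r * y \<le> N \<and>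
        (\<forall>m. x \<le> m \<longrightarrow> m < y \<longrightarrow> \<not> (u N \<le> q * m \<and> q * m < v N) \<and> \<not> (u N \<le> r * m \<and> r * m < v N))"
        unfolding c c' using xy qn by (intro conjI) (linarith | blast)+
      have 1: "\<bar>cd A A x y - real (y - x) * (\<alpha> * \<alpha>)\<bar> \<le> \<delta> * real N"
        using elim(3)[THEN spec, THEN spec, THEN mp, OF adm] unfolding cd_def \<alpha>_def .
      have 2: "\<bar>cd A UNIV x y - real (y - x) * \<alpha>\<bar> \<le> \<delta> * real N"
        using elim(4)[THEN spec, THEN spec, THEN mp, OF adm] unfolding cd_def \<alpha>_def MU mult_1_right .
      have 3: "\<bar>cd UNIV A x y - real (y - x) * \<alpha>\<bar> \<le> \<delta> * real N"
        using elim(5)[THEN spec, THEN spec, THEN mp, OF adm] unfolding cd_def \<alpha>_def MU mult_1_left .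
      have shrink: "\<bar>\<alpha> * t\<bar> \<le> \<bar>t\<bar>" for t using \<alpha> by (simp add: abs_mult mult_left_le_one_le)
      have "(\<Sum>m=x..<y. g m) = (cd A A x y - real (y - x) * (\<alpha> * \<alpha>)) - \<alpha> * (cd A UNIV x y - real (y - x) * \<alpha>) - \<alpha> * (cd UNIV A x y - real (y - x) * \<alpha>)"
        unfolding gsum by (simp add: right_diff_distrib mult_ac)
      then show ?thesis using 1 2 3 shrink[of "cd A UNIV x y - real (y - x) * \<alpha>"] shrink[of "cd UNIV A x y - real (y - x) * \<alpha>"] by linarith
    qed
    have N0: "real N > 0" using elim by simp
    have ag: "a N (q * m) * a N (r * m) = (if (c \<le> m \<and> m < d) \<or> (c' \<le> m \<and> m < d') then 0 else g m)" for m
      unfolding a_def g_def c c' \<alpha>_def by simp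
    \<comment> \<open>The summand 1 pays for m = n: admissible intervals are half-open with right
      end at most n.\<close>
    have "\<bar>\<Sum>m=1..n. a N (q * m) * a N (r * m)\<bar> \<le> 4 * (3 * \<delta> * real N) + 1"
    proof (cases "n = 0")
      case False
      have "\<bar>\<Sum>m=1..<n. if (c \<le> m \<and> m < d) \<or> (c' \<le> m \<and> m < d') then 0 else g m\<bar> \<le> 4 * (3 * \<delta> * real N)"
        by (rule sum_avoid_two_intervals) (use False bound in auto)
      moreover have "{1..n} = insert n {1..<n}" using False by auto
      then have "(\<Sum>m=1..n. a N (q * m) * a N (r * m)) = a N (q * n) * a N (r * n) + (\<Sum>m=1..<n. if (c \<le> m \<and> m < d) \<or> (c' \<le> m \<and> m < d') then 0 else g m)"
        by (simp add: ag)
      moreover have "\<bar>a N (q * n) * a N (r * n)\<bar> \<le> 1" using abd by (simp add: abs_mult mult_le_one)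
      ultimately show ?thesis by linarith
    qed (use \<delta> in simp)
    also have "\<dots> = e / 2 * real N + 1" by (simp add: \<delta>_def)
    also have "\<dots> < e * real N" using elim(1) N0 by (simp add: field_simps)
    finally show ?case using N0 by (simp add: n_def dist_real_def abs_divide pos_divide_less_eq)
  qed
qed

text \<open>The indicator along the orbit is \<open>a N n\<close> plus the mean \<alpha> plus a
  correction on the run. The criterion handles the first part and \<open>mertens_little_o\<close>
  the second. On the run every time at distance at least \<open>w\<close> from its ends sees only
  ones, so the indicator is there the constant \<beta>, and the Moebius sum over an interval is a
  difference of two sums bounded by \<open>mertens_uniform\<close>.\<close>

lemma moebius_local_set:
  assumes wm: "weakly_mixing M T"
    and disj: "\<And>q r. prime (q::nat) \<Longrightarrow> prime r \<Longrightarrow> q \<noteq> r \<Longrightarrow> disjoint_systems M (T ^^ q) M (T ^^ r)"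
    and \<omega>: "\<omega> \<in> \<Omega>" and A: "local_set w A"
  shows "(\<lambda>N. (\<Sum>n=1..N. of_bool ((T ^^ n) \<omega> \<in> A) * moebius n) / of_nat N) \<longlonglongrightarrow> 0"
proof -
  obtain u v where uv: "exceptional \<omega> u v" using ex_exceptional[OF \<omega>] by blast
  define \<alpha> where "\<alpha> = Mm A"
  have \<alpha>: "0 \<le> \<alpha>" "\<alpha> \<le> 1" using Mm_nonneg Mm_le_1 by (auto simp: \<alpha>_def)
  define \<beta> :: real where "\<beta> = of_bool ((\<lambda>_. 1) \<in> A)"
  define a where "a = (\<lambda>N n. if u N \<le> n \<and> n < v N then 0 else of_bool ((T ^^ n) \<omega> \<in> A) - \<alpha>)"
  define J where "J N = {n\<in>{1..N}. u N \<le> n \<and> n < v N}" for N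
  have 1: "(\<lambda>N. (\<Sum>n=1..N. of_real (a N n) * moebius n) / of_nat N) \<longlonglongrightarrow> 0"
  proof (rule katai_bourgain_sarnak_ziegler)
    show "\<bar>a N n\<bar> \<le> 1" for N n using \<alpha> by (auto simp: a_def of_bool_def)
    fix q r :: nat assume qr: "prime q" "prime r" "q \<noteq> r"
    show "(\<lambda>N. (\<Sum>m=1..N div max q r. a N (q * m) * a N (r * m)) / real N) \<longlonglongrightarrow> 0"
      unfolding a_def \<alpha>_def
      by (rule local_correlation[OF wm disj[OF qr] prime_ge_1_nat[OF qr(1)] prime_ge_1_nat[OF qr(2)] \<omega> uv A])
  qed
  have 2: "(\<lambda>N. of_real \<alpha> * ((\<Sum>n=1..N. moebius n) / of_nat N)) \<longlonglongrightarrow> of_real \<alpha> * 0"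
    by (intro tendsto_intros mertens_little_o)
  have 3: "(\<lambda>N. (\<Sum>n\<in>J N. of_real (of_bool ((T ^^ n) \<omega> \<in> A) - \<alpha>) * moebius n) / of_nat N) \<longlonglongrightarrow> 0"
  proof (rule tendstoI)
    fix e :: real assume e: "e > 0"
    have "\<forall>\<^sub>F N in sequentially. \<forall>k\<le>N. norm (\<Sum>n=1..k. moebius n) \<le> e / 8 * real N"
      using e by (intro mertens_uniform) simp
    moreover have "\<forall>\<^sub>F N in sequentially. real (2 * w) / real N < e / 2" using e by (intro order_tendstoD[OF lim_const_over_n]) auto
    moreover have "\<forall>\<^sub>F N in sequentially. N \<ge> (1::nat)" by (rule eventually_ge_at_top)
    ultimately show "\<forall>\<^sub>F N in sequentially. dist ((\<Sum>n\<in>J N. of_real (of_bool ((T ^^ n) \<omega> \<in> A) - \<alpha>) * moebius n) / of_nat N) 0 < e"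
    proof eventually_elim
      case (elim N)
      have N0: "real N > 0" using elim by simp
      have uvN: "u N \<le> v N" "v N \<le> Suc N" "\<And>k. u N \<le> k \<Longrightarrow> k < v N \<Longrightarrow> \<omega> (int k) = 1"
        using uv elim unfolding exceptional_def by blast+
      have fJ: "finite (J N)" by (simp add: J_def)
      have mJ: "norm (\<Sum>n\<in>J N. moebius n) \<le> e / 4 * real N"
      proof (cases "J N = {}")
        case False
        have "u N < v N" using False by (auto simp: J_def)
        have eqJ: "J N = {1..v N - 1} - {1..u N - 1}" using uvN(1,2) \<open>u N < v N\<close> by (auto simp: J_def)
        have "{1..u N - 1} \<subseteq> {1..v N - 1}" using uvN(1) by auto
        then have "(\<Sum>n\<in>J N. moebius n) = (\<Sum>n=1..v N - 1. moebius n) - (\<Sum>n=1..u N - 1. moebius n)"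
          unfolding eqJ by (intro sum_diff) auto
        then have "norm (\<Sum>n\<in>J N. moebius n) \<le> norm (\<Sum>n=1..v N - 1. moebius n) + norm (\<Sum>n=1..u N - 1. moebius n)"
          by (simp only: norm_triangle_ineq4)
        also have "\<dots> \<le> e / 8 * real N + e / 8 * real N"
          using uvN(1,2) by (intro add_mono elim(1)[rule_format]) auto
        finally show ?thesis by simp
      qed (use e in simp)
      \<comment> \<open>The times near the ends of the run, whose \<open>w\<close>-neighbourhood may
        leave it.\<close>
      define X where "X = {n\<in>J N. n < u N + w} \<union> {n\<in>J N. v N \<le> n + w}"
      have cX: "card X \<le> 2 * w"
      proof -
        have "card X \<le> card ({u N..<u N + w} \<union> {v N - w..<v N})" unfolding X_def by (rule card_mono) (auto simp: J_def)
        also have "\<dots> \<le> card {u N..<u N + w} + card {v N - w..<v N}" by (rule card_Un_le)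
        also have "\<dots> \<le> 2 * w" by simp
        finally show ?thesis .
      qed
      have inner: "of_bool ((T ^^ n) \<omega> \<in> A) = \<beta>" if n: "n \<in> J N" "n \<notin> X" for n
      proof -
        have n': "u N + w \<le> n" "n + w < v N" using n by (auto simp: X_def)
        have "\<forall>t. \<bar>t\<bar> \<le> int w \<longrightarrow> (T ^^ n) \<omega> t = 1"
        proof (intro allI impI)
          fix t assume t: "\<bar>t\<bar> \<le> int w"
          define k where "k = nat (t + int n)"
          have "int k = t + int n" "u N \<le> k" "k < v N" using t n' by (auto simp: k_def)
          then show "(T ^^ n) \<omega> t = 1" using uvN(3)[of k] by (simp add: rk_shift_funpow)
        qed
        then have "(T ^^ n) \<omega> \<in> A \<longleftrightarrow> (\<lambda>_. 1) \<in> A"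
          using A[unfolded local_set_def, rule_format, of "(T ^^ n) \<omega>" "\<lambda>_. 1"] by blast
        then show ?thesis by (simp add: \<beta>_def)
      qed
      have split: "(\<Sum>n\<in>J N. of_real (of_bool ((T ^^ n) \<omega> \<in> A) - \<alpha>) * moebius n) =
        of_real (\<beta> - \<alpha>) * (\<Sum>n\<in>J N. moebius n) + (\<Sum>n\<in>J N. of_real (of_bool ((T ^^ n) \<omega> \<in> A) - \<beta>) * moebius n)"
        by (simp add: sum_distrib_left sum.distrib[symmetric] algebra_simps)
      have "norm (\<Sum>n\<in>J N. of_real (of_bool ((T ^^ n) \<omega> \<in> A) - \<beta>) * moebius n) \<le> (\<Sum>n\<in>J N. of_bool (n \<in> X))"
      proof (rule sum_norm_le)
        fix n assume n: "n \<in> J N"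
        show "norm (of_real (of_bool ((T ^^ n) \<omega> \<in> A) - \<beta>) * moebius n) \<le> of_bool (n \<in> X)"
        proof (cases "n \<in> X")
          case True
          have "\<bar>of_bool ((T ^^ n) \<omega> \<in> A) - \<beta>\<bar> \<le> 1" by (simp add: \<beta>_def of_bool_def)
          then have "\<bar>of_bool ((T ^^ n) \<omega> \<in> A) - \<beta>\<bar> * norm (moebius n) \<le> 1"
            using norm_moebius_le[of n] by (intro mult_le_one) auto
          then show ?thesis using True by (simp only: norm_mult norm_of_real) simp
        qed (use inner[OF n] in simp)
      qed
      also have "\<dots> \<le> real (2 * w)"
      proof -
        have "J N \<inter> {n. n \<in> X} = X" by (auto simp: X_def)
        then have "(\<Sum>n\<in>J N. of_bool (n \<in> X)) = real (card X)"
          unfolding of_bool_def sum.If_cases[OF fJ] by simp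
        then show ?thesis using cX by simp
      qed
      finally have s2: "norm (\<Sum>n\<in>J N. of_real (of_bool ((T ^^ n) \<omega> \<in> A) - \<beta>) * moebius n) \<le> real (2 * w)" .
      have "\<bar>\<beta> - \<alpha>\<bar> \<le> 1" using \<alpha> by (auto simp: \<beta>_def of_bool_def)
      then have s1: "norm (of_real (\<beta> - \<alpha>) * (\<Sum>n\<in>J N. moebius n)) \<le> 1 * (e / 4 * real N)"
        unfolding norm_mult norm_of_real using mJ by (intro mult_mono) auto
      have "norm (\<Sum>n\<in>J N. of_real (of_bool ((T ^^ n) \<omega> \<in> A) - \<alpha>) * moebius n) \<le> e / 4 * real N + real (2 * w)"
        unfolding split using norm_triangle_le[OF add_mono[OF s1 s2]] by simp
      also have "\<dots> < e * real N"
      proof -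
        have "real (2 * w) < e / 2 * real N" using elim(2) N0 by (simp add: pos_divide_less_eq)
        moreover have "e / 4 * real N + e / 2 * real N \<le> e * real N" using e by simp
        ultimately show ?thesis by linarith
      qed
      finally show ?case using N0 by (simp add: dist_norm norm_divide pos_divide_less_eq)
    qed
  qed
  have eq: "(\<Sum>n=1..N. of_real (a N n) * moebius n) / of_nat N + of_real \<alpha> * ((\<Sum>n=1..N. moebius n) / of_nat N)
      + (\<Sum>n\<in>J N. of_real (of_bool ((T ^^ n) \<omega> \<in> A) - \<alpha>) * moebius n) / of_nat N
      = (\<Sum>n=1..N. of_bool ((T ^^ n) \<omega> \<in> A) * moebius n) / of_nat N" for N
  proof -
    have "(\<Sum>n\<in>J N. of_real (of_bool ((T ^^ n) \<omega> \<in> A) - \<alpha>) * moebius n) =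
       (\<Sum>n=1..N. if u N \<le> n \<and> n < v N then of_real (of_bool ((T ^^ n) \<omega> \<in> A) - \<alpha>) * moebius n else 0)"
      unfolding J_def by (rule sum.inter_filter) simp
    then have "(\<Sum>n=1..N. of_real (a N n) * moebius n) + of_real \<alpha> * (\<Sum>n=1..N. moebius n)
      + (\<Sum>n\<in>J N. of_real (of_bool ((T ^^ n) \<omega> \<in> A) - \<alpha>) * moebius n) =
      (\<Sum>n=1..N. of_real (a N n) * moebius n + of_real \<alpha> * moebius n
         + (if u N \<le> n \<and> n < v N then of_real (of_bool ((T ^^ n) \<omega> \<in> A) - \<alpha>) * moebius n else 0))"
      by (simp only: sum.distrib sum_distrib_left)
    also have "\<dots> = (\<Sum>n=1..N. of_bool ((T ^^ n) \<omega> \<in> A) * moebius n)"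
      by (intro sum.cong refl) (auto simp: a_def of_bool_def algebra_simps)
    finally show ?thesis by (simp only: add_divide_distrib[symmetric] times_divide_eq_right)
  qed
  have "(\<lambda>N. (\<Sum>n=1..N. of_real (a N n) * moebius n) / of_nat N + of_real \<alpha> * ((\<Sum>n=1..N. moebius n) / of_nat N)
      + (\<Sum>n\<in>J N. of_real (of_bool ((T ^^ n) \<omega> \<in> A) - \<alpha>) * moebius n) / of_nat N) \<longlonglongrightarrow> 0 + of_real \<alpha> * 0 + 0"
    by (intro tendsto_add 1 2 3)
  then show ?thesis unfolding eq by simp
qed

section \<open>From local sets to continuous functions\<close>

lemma open_contains_nbh:
  assumes "open U" "x \<in> U"
  shows "\<exists>w. nbh w x \<subseteq> U"
proof -
  have "openin (product_topology (\<lambda>i::int. (euclidean :: nat topology)) UNIV) U"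
    using assms(1) by (simp add: open_fun_def)
  from product_topology_open_contains_basis[OF this assms(2)]
  obtain X where X: "x \<in> (\<Pi>\<^sub>E i\<in>UNIV. X i)" "finite {i. X i \<noteq> topspace (euclidean :: nat topology)}" "(\<Pi>\<^sub>E i\<in>UNIV. X i) \<subseteq> U"
    by blast
  define w where "w = Max (insert 0 ((\<lambda>i. nat \<bar>i\<bar>) ` {i. X i \<noteq> UNIV}))"
  have fin: "finite {i. X i \<noteq> UNIV}" using X(2) by simp
  have "nbh w x \<subseteq> (\<Pi>\<^sub>E i\<in>UNIV. X i)"
  proof
    fix y assume y: "y \<in> nbh w x"
    have "y i \<in> X i" for i
    proof (cases "X i = UNIV")
      case False
      then have "nat \<bar>i\<bar> \<le> w" unfolding w_def using fin by (intro Max_ge) auto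
      then have "y i = x i" using y by (simp add: nbh_def)
      then show ?thesis using X(1) by (simp add: PiE_iff)
    qed simp
    then show "y \<in> (\<Pi>\<^sub>E i\<in>UNIV. X i)" by (simp add: PiE_iff extensional_def)
  qed
  then show ?thesis using X(3) by blast
qed

lemma nbh_eq: "y \<in> nbh w x \<Longrightarrow> nbh w y = nbh w x"
  by (auto simp: nbh_def)

text \<open>Uniform continuity on a compact space, with cylinders in place of balls: \<Omega> is
  covered by finitely many cylinders, and the largest of their radii serves everywhere.\<close>

lemma uniformly_local:
  fixes f :: "(int \<Rightarrow> nat) \<Rightarrow> complex"
  assumes f: "continuous_on \<Omega> f" and e: "e > 0"
  shows "\<exists>w. \<forall>x\<in>\<Omega>. \<forall>y\<in>\<Omega> \<inter> nbh w x. norm (f x - f y) < e"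
proof -
  have "\<exists>w. \<forall>y\<in>\<Omega> \<inter> nbh w x. norm (f y - f x) < e / 2" if x: "x \<in> \<Omega>" for x
  proof -
    obtain V where V: "open V" "f -` ball (f x) (e / 2) \<inter> \<Omega> = V \<inter> \<Omega>"
      using f open_ball unfolding continuous_on_open_invariant by metis
    have "x \<in> f -` ball (f x) (e / 2) \<inter> \<Omega>" using x e by simp
    then have "x \<in> V" unfolding V(2) by blast
    then obtain w where "nbh w x \<subseteq> V" using open_contains_nbh[OF V(1)] by blast
    then have "norm (f y - f x) < e / 2" if "y \<in> \<Omega> \<inter> nbh w x" for y
    proof -
      have "y \<in> f -` ball (f x) (e / 2)" using V(2) that \<open>nbh w x \<subseteq> V\<close> by blast
      then show ?thesis by (simp add: dist_norm norm_minus_commute)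
    qed
    then show ?thesis by blast
  qed
  then obtain W where W: "\<And>x y. x \<in> \<Omega> \<Longrightarrow> y \<in> \<Omega> \<inter> nbh (W x) x \<Longrightarrow> norm (f y - f x) < e / 2" by metis
  have "\<Omega> \<subseteq> (\<Union>x\<in>\<Omega>. nbh (W x) x)" using nbh_refl by blast
  then obtain K where K: "K \<subseteq> \<Omega>" "finite K" "\<Omega> \<subseteq> (\<Union>x\<in>K. nbh (W x) x)"
    by (rule compactE_image[OF compact_Omega open_nbh])
  define w where "w = Max (insert 0 (W ` K))"
  show ?thesis
  proof (intro exI[of _ w] ballI)
    fix x y assume x: "x \<in> \<Omega>" and y: "y \<in> \<Omega> \<inter> nbh w x"
    obtain z where z: "z \<in> K" "x \<in> nbh (W z) z" using K(3) x by blast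
    have "W z \<le> w" unfolding w_def using K(2) z by (intro Max_ge) auto
    then have "y \<in> nbh (W z) x" using y nbh_mono by blast
    then have "y \<in> nbh (W z) z" using nbh_eq[OF z(2)] by simp
    then have "norm (f x - f z) < e / 2" "norm (f y - f z) < e / 2" using W[of z] z K(1) x y by blast+
    then show "norm (f x - f y) < e" using norm_triangle_ineq4[of "f x - f z" "f y - f z"] by simp
  qed
qed

end

theorem mainTheorem4:
  fixes p :: "nat \<Rightarrow> nat" and s :: "nat \<Rightarrow> nat \<Rightarrow> nat"
    and M :: "(int \<Rightarrow> nat) measure"
    and f :: "(int \<Rightarrow> nat) \<Rightarrow> complex" and \<omega> :: "int \<Rightarrow> nat"
  assumes params: "rank_one_params p s"
    and reas: "reasonable p s"
    and M_sets: "sets M = sets (restrict_space borel (rk_Omega p s))"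
    and M_prob: "prob_space M"
    and M_inv: "invariant_measure M rk_shift"
    and M_nonatomic: "\<forall>x\<in>rk_Omega p s. emeasure M {x} = 0"
    and wm: "weakly_mixing M rk_shift"
    and disj: "\<And>q r. prime (q::nat) \<Longrightarrow> prime r \<Longrightarrow> q \<noteq> r \<Longrightarrow>
                 disjoint_systems M (rk_shift ^^ q) M (rk_shift ^^ r)"
    and f_cont: "continuous_on (rk_Omega p s) f"
    and \<omega>_in: "\<omega> \<in> rk_Omega p s"
  shows "(\<lambda>N. (\<Sum>n=1..N. f ((rk_shift ^^ n) \<omega>) * moebius n) / of_nat N) \<longlonglongrightarrow> 0"
proof -
  interpret rank_one_system p s M
  proof (intro rank_one_system.intro rank_one.intro rank_one_system_axioms.intro)
    show "2 \<le> p n" if "1 \<le> n" for n using params that unfolding rank_one_params_def by blast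
  qed (fact params reas M_sets M_prob M_inv M_nonatomic)+
  show ?thesis
  proof (rule tendstoI)
    fix e :: real assume e: "e > 0"
    obtain w where w: "\<And>x y. x \<in> \<Omega> \<Longrightarrow> y \<in> \<Omega> \<inter> nbh w x \<Longrightarrow> norm (f x - f y) < e / 2"
      using uniformly_local[OF f_cont, of "e / 2"] e by auto
    \<comment> \<open>The cylinders of radius w partition \<Omega> into finitely many local sets.
      Replacing f by its value at one representative of each gives a combination of their
      indicators, at distance less than e/2 from f.\<close>
    define \<U> where "\<U> = nbh w ` \<Omega>"
    have fin: "finite \<U>" unfolding \<U>_def by (rule finite_nbh[OF Omega_01])
    define rep where "rep U = (SOME x. x \<in> \<Omega> \<inter> U)" for U
    have rep: "rep (nbh w x) \<in> \<Omega> \<inter> nbh w x" if "x \<in> \<Omega>" for x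
      unfolding rep_def by (rule someI[of _ x]) (use that nbh_refl in blast)
    define g where "g x = (\<Sum>U\<in>\<U>. f (rep U) * of_bool (x \<in> U))" for x
    have g: "g x = f (rep (nbh w x))" if "x \<in> \<Omega>" for x
    proof -
      have "f (rep U) * of_bool (x \<in> U) = (if U = nbh w x then f (rep (nbh w x)) else 0)" if U: "U \<in> \<U>" for U
      proof (cases "x \<in> U")
        case True
        obtain z where "U = nbh w z" using U unfolding \<U>_def by blast
        then have "U = nbh w x" using True nbh_eq[of x w z] by simp
        then show ?thesis using True by simp
      next
        case False
        then have "U \<noteq> nbh w x" using nbh_refl by blast
        then show ?thesis using False by simp
      qed
      then have "g x = (\<Sum>U\<in>\<U>. if U = nbh w x then f (rep (nbh w x)) else 0)" unfolding g_def by (rule sum.cong[OF refl])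
      also have "\<dots> = f (rep (nbh w x))" using fin that by (simp add: \<U>_def)
      finally show ?thesis .
    qed
    have fg: "norm (f x - g x) < e / 2" if "x \<in> \<Omega>" for x
      unfolding g[OF that] by (rule w[OF that rep[OF that]])
    have "(\<lambda>N. \<Sum>U\<in>\<U>. f (rep U) * ((\<Sum>n=1..N. of_bool ((rk_shift ^^ n) \<omega> \<in> U) * moebius n) / of_nat N)) \<longlonglongrightarrow> (\<Sum>U\<in>\<U>. f (rep U) * 0)"
    proof (intro tendsto_sum tendsto_mult tendsto_const)
      fix U assume "U \<in> \<U>"
      then obtain x where "U = nbh w x" by (auto simp: \<U>_def)
      then have "local_set w U" by (simp add: local_set_nbh)
      then show "(\<lambda>N. (\<Sum>n=1..N. of_bool ((rk_shift ^^ n) \<omega> \<in> U) * moebius n) / of_nat N) \<longlonglongrightarrow> 0"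
        by (intro moebius_local_set[OF wm _ \<omega>_in] disj)
    qed
    moreover have "(\<Sum>U\<in>\<U>. f (rep U) * ((\<Sum>n=1..N. of_bool ((rk_shift ^^ n) \<omega> \<in> U) * moebius n) / of_nat N)) =
        (\<Sum>n=1..N. g ((rk_shift ^^ n) \<omega>) * moebius n) / of_nat N" for N
    proof -
      have "(\<Sum>n=1..N. g ((rk_shift ^^ n) \<omega>) * moebius n) = (\<Sum>n=1..N. \<Sum>U\<in>\<U>. f (rep U) * (of_bool ((rk_shift ^^ n) \<omega> \<in> U) * moebius n))"
        unfolding g_def by (simp add: sum_distrib_right mult.assoc)
      also have "\<dots> = (\<Sum>U\<in>\<U>. \<Sum>n=1..N. f (rep U) * (of_bool ((rk_shift ^^ n) \<omega> \<in> U) * moebius n))" by (rule sum.swap)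
      finally show ?thesis by (simp only: sum_distrib_left sum_divide_distrib times_divide_eq_right)
    qed
    ultimately have "(\<lambda>N. (\<Sum>n=1..N. g ((rk_shift ^^ n) \<omega>) * moebius n) / of_nat N) \<longlonglongrightarrow> 0" by simp
    then have "\<forall>\<^sub>F N in sequentially. dist ((\<Sum>n=1..N. g ((rk_shift ^^ n) \<omega>) * moebius n) / of_nat N) 0 < e / 2"
      by (rule tendstoD) (use e in simp)
    moreover have "\<forall>\<^sub>F N in sequentially. N \<ge> (1::nat)" by (rule eventually_ge_at_top)
    ultimately show "\<forall>\<^sub>F N in sequentially. dist ((\<Sum>n=1..N. f ((rk_shift ^^ n) \<omega>) * moebius n) / of_nat N) 0 < e"
    proof eventually_elim
      case (elim N)
      define F where "F = (\<Sum>n=1..N. f ((rk_shift ^^ n) \<omega>) * moebius n)"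
      define H where "H = (\<Sum>n=1..N. g ((rk_shift ^^ n) \<omega>) * moebius n)"
      have "norm (F - H) \<le> (\<Sum>n=1..N. e / 2)"
        unfolding F_def H_def sum_subtractf[symmetric] left_diff_distrib[symmetric]
      proof (rule sum_norm_le)
        fix n
        have "norm (f ((rk_shift ^^ n) \<omega>) - g ((rk_shift ^^ n) \<omega>)) * norm (moebius n) \<le> e / 2 * 1"
          using fg[OF rk_shift_Omega[OF \<omega>_in, of n]] norm_moebius_le[of n] e by (intro mult_mono) auto
        then show "norm ((f ((rk_shift ^^ n) \<omega>) - g ((rk_shift ^^ n) \<omega>)) * moebius n) \<le> e / 2"
          by (simp add: norm_mult)
      qed
      then have "norm (F - H) \<le> e / 2 * real N" by (simp add: mult.commute)
      moreover have "norm H < e / 2 * real N" using elim by (simp add: H_def norm_divide pos_divide_less_eq)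
      ultimately have "norm F < e * real N" using norm_triangle_ineq[of "F - H" H] by simp
      then show ?case using elim by (simp add: F_def norm_divide pos_divide_less_eq)
    qed
  qed
qed

end
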